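(* Let $(\sigma_s,\mu)\in\mathbb{R}^2$ satisfy $e^{2\pi\mu} > \sinh^2(2\pi\sigma_s)$. Then $$\mathcal{Q}\Big(b, \frac{\sigma_s}{b}, \frac{\mu}{b}\Big) = \frac{e^{\frac{\pi i}{4}}}{\sqrt{2}\, (e^{2 \pi \mu }-\sinh^2(2 \pi \sigma_s))^{1/4}}\, e^{\frac{f_{\mathcal{Q}}(\sigma_s, \mu)}{b^2}} \big(1 + O(b)\big) \qquad \text{as } b \to 0^+,$$ where $(e^{2 \pi \mu }-\sinh^2(2 \pi \sigma_s))^{1/4}>0$, and, writing $R:=\sqrt{e^{2 \pi \mu }-\sinh^2(2 \pi \sigma_s)}>0$, \begin{align*} f_{\mathcal{Q}}(\sigma_s, \mu) =& -\frac{\operatorname{Li}_2\big(-e^{2 \pi \mu }\big)}{2 \pi i} -\frac{\operatorname{Li}_2\big(e^{-2 \pi \sigma_s} (\cosh (2 \pi \sigma_s)+i R)\big)}{2 \pi i} -\frac{\operatorname{Li}_2\big(e^{2 \pi \sigma_s} (\cosh (2 \pi \sigma_s)+i R)\big)}{2 \pi i}\\ & + \Big(\frac{1}{2}+i \mu \Big) \ln \big(-\cosh (2 \pi \sigma_s)-i R\big) -\pi \mu +\frac{5 \pi i}{12}, \end{align*} with principal branches for all functions. Moreover, for all such $(\sigma_s,\mu)$, $$f_{\mathcal{Q}}(\sigma_s, \mu) = 4i\pi\, W\Big(i\sigma_s,-\mu - \frac{i}{2}\Big) - \frac{\operatorname{Li}_2(-e^{2\pi \mu})}{2\pi i} - 2i\pi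 \sigma_s^2 + \frac{i\pi}{4},$$ where $W$ is the Painlevé III$_3$ generating function.
   Context: Let $b>0$, $Q := b+b^{-1}$, and let $s_b$ be the hyperbolic gamma function defined for $|\operatorname{Im} z|<Q/2$ by $s_b(z)=\exp\left[ i \int_0^\infty \left(\frac{\sin(2yz)}{2\sinh(b^{-1}y)\sinh(by)}-\frac{z}{y}\right) \frac{dy}{y} \right]$ and extended meromorphically to $\mathbb{C}$ (zeros at $\frac{iQ}{2}+imb+ilb^{-1}$, poles at $-\frac{iQ}{2}-imb-ilb^{-1}$, $m,l\in\mathbb{Z}_{\geq0}$). For $(\sigma_s,\mu)\in\mathbb{R}^2$, define $$\mathcal{Q}(b,\sigma_s,\mu) = e^{i \pi (\frac{1}{6}+\frac{7 Q^2}{24}-\frac{\mu^2}{2}+i \mu Q- \sigma_s^2)} s_b(\mu) \int_{\mathsf{Q}} e^{-i\pi x^2} e^{2i\pi x(\mu-\frac{iQ}2)} s_b(x+\sigma_s) s_b(x-\sigma_s)\, dx,$$ where $\mathsf{Q}$ is any curve from $-\infty$ to $+\infty$ lying in the strip $-Q/2 < \operatorname{Im} x < -Q/4-\delta$ for some $\delta>0$. The Painlevé III$_3$ generating function is $$8\pi^2 W(\sigma,\nu) = \operatorname{Li}_2 \big( - e^{2i\pi(\sigma+\eta-\frac{i \nu}2)}\big) + \operatorname{Li}_2 \big( - e^{-2i\pi(\sigma+\eta+\frac{i \nu}2)}\big) - (2\pi \eta)^2 + (\pi \nu)^2,\qquad \eta = \frac{1}{2\pi}\arcsin(e^{\pi\nu}\sin(2\pi\sigma)),$$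 where principal branches of $\operatorname{Li}_2$ and $\arcsin$ are used in the region where $0<\eta<\sigma<\frac14$ and $\nu<0$, and $W$ is extended to other $(\sigma,\nu)$ by analytic continuation. Principal branches: $\operatorname{Im}\ln z\in(-\pi,\pi]$, $z^\alpha=e^{\alpha\ln z}$, and $\operatorname{Li}_2(z)=-\int_0^z\frac{\ln(1-u)}{u}du$ on $\mathbb{C}\setminus[1,\infty)$. *)

theory Defs
  imports "HOL-Complex_Analysis.Complex_Analysis" "HOL-Library.Landau_Symbols"
begin

definition Qb :: "real \<Rightarrow> real" where
  "Qb b = b + 1 / b"

text \<open>Hyperbolic gamma function s_b(z), given by its integral representation,
  valid on the strip abs (Im z) < Q/2 (this is the only region where it is evaluated below).\<close>
definition sb :: "real \<Rightarrow> complex \<Rightarrow> complex" where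
  "sb b z = exp (\<i> * integral {0<..}
      (\<lambda>y::real. (sin (2 * complex_of_real y * z)
                   / complex_of_real (2 * sinh (y / b) * sinh (b * y))
                 - z / complex_of_real y) / complex_of_real y))"

text \<open>The contour Q is taken to be the horizontal line Im x = -3Q/8, which lies in the
  strip -Q/2 < Im x < -Q/4 - delta (delta = Q/16); parametrised as x = t - i 3Q/8, dx = dt.\<close>
definition QQ :: "real \<Rightarrow> real \<Rightarrow> real \<Rightarrow> complex" where
  "QQ b sigma_s mu =
     exp (\<i> * pi * (1/6 + 7 * (Qb b)\<^sup>2 / 24 - mu\<^sup>2 / 2 + \<i> * mu * Qb b - sigma_s\<^sup>2))
     * sb b mu
     * integral UNIV (\<lambda>t::real.
         let x = complex_of_real t - \<i> * complex_of_real (3 * Qb b / 8) in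
         exp (- \<i> * pi * x\<^sup>2) * exp (2 * \<i> * pi * x * (mu - \<i> * Qb b / 2))
         * sb b (x + sigma_s) * sb b (x - sigma_s))"

text \<open>Dilogarithm, principal branch: Li2 z = - integral_0^z ln(1-u)/u du along the segment,
  for z outside [1,oo).\<close>
definition Li2 :: "complex \<Rightarrow> complex" where
  "Li2 z = - contour_integral (linepath 0 z) (\<lambda>u. Ln (1 - u) / u)"

definition fQ :: "real \<Rightarrow> real \<Rightarrow> complex" where
  "fQ sigma_s mu =
     (let R = sqrt (exp (2 * pi * mu) - (sinh (2 * pi * sigma_s))\<^sup>2);
          w = complex_of_real (cosh (2 * pi * sigma_s)) + \<i> * complex_of_real R in
      - Li2 (- complex_of_real (exp (2 * pi * mu))) / (2 * pi * \<i>)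
      - Li2 (complex_of_real (exp (- 2 * pi * sigma_s)) * w) / (2 * pi * \<i>)
      - Li2 (complex_of_real (exp (2 * pi * sigma_s)) * w) / (2 * pi * \<i>)
      + (1/2 + \<i> * mu) * Ln (- w)
      - pi * mu + 5 * pi * \<i> / 12)"

definition eta_base :: "real \<Rightarrow> real \<Rightarrow> real" where
  "eta_base sg nu = arcsin (exp (pi * nu) * sin (2 * pi * sg)) / (2 * pi)"

definition W_base_region :: "(real \<times> real) set" where
  "W_base_region = {(sg, nu). nu < 0 \<and> 0 < eta_base sg nu \<and> eta_base sg nu < sg \<and> sg < 1/4}"

definition W_base :: "real \<Rightarrow> real \<Rightarrow> complex" where
  "W_base sg nu =
     (let eta = eta_base sg nu in
      (Li2 (- exp (2 * \<i> * pi * (sg + eta - \<i> * nu / 2)))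
       + Li2 (- exp (- 2 * \<i> * pi * (sg + eta + \<i> * nu / 2)))
       - complex_of_real ((2 * pi * eta)\<^sup>2) + complex_of_real ((pi * nu)\<^sup>2)) / (8 * pi\<^sup>2))"

definition holomorphic2_on :: "(complex \<times> complex \<Rightarrow> complex) \<Rightarrow> (complex \<times> complex) set \<Rightarrow> bool" where
  "holomorphic2_on F U \<longleftrightarrow> open U \<and>
     (\<forall>p\<in>U. \<exists>D. (F has_derivative D) (at p) \<and>
        (\<forall>c v. D (c * fst v, c * snd v) = c * D v))"

definition W_continuation :: "(complex \<times> complex \<Rightarrow> complex) \<Rightarrow> (complex \<times> complex) set \<Rightarrow> bool" where
  "W_continuation F U \<longleftrightarrow> connected U \<and> holomorphic2_on F U \<and>
     (\<forall>(sg, nu) \<in> W_base_region.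
        (complex_of_real sg, complex_of_real nu) \<in> U \<and>
        F (complex_of_real sg, complex_of_real nu) = W_base sg nu)"

end

theory Submission
  imports Defs "HOL-Probability.Distributions"
begin

text \<open>
  In the variable \<open>X = b x\<close> one has \<open>sb b (X / b) = exp (\<i> (lam0 X / b\<^sup>2 + lamE (b\<^sup>2) X))\<close>, where
  \<open>lamE (b\<^sup>2) X = O(b\<^sup>2 \<bar>X\<bar>)\<close> uniformly on closed substrips of \<open>\<bar>Im X\<bar> < 1/2\<close>. The second derivative
  of \<open>lam0\<close> is a multiple of the Fourier sine transform of \<open>1 / sinh\<close>, that is \<open>- \<pi> tanh (\<pi> X)\<close>, which makes \<open>lam0\<close>
  a dilogarithm. The contour integral becomes \<open>\<integral> exp (\<Phi> X / b\<^sup>2 + O(1))\<close>. On every horizontal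
  line with \<open>-1/2 < Im X < 0\<close> the function \<open>Re \<Phi>\<close> is strictly concave, so on the line through the
  saddle point \<open>X0 = Ln (- w) / (2 \<pi>)\<close> Laplace's method applies directly, without steepest descent
  paths. The value of the exponent at the saddle is \<open>fQ\<close>.

  For the generating function, the principal-branch formula is analytic on a connected set that
  contains both the base region and all points \<open>(\<i> \<sigma>, - \<mu> - \<i> / 2)\<close>; there the two dilogarithms
  of \<open>W\<close> have arguments \<open>1 / (1 - x)\<close>, where \<open>x\<close> are the arguments in \<open>fQ\<close>.
\<close>

section \<open>The dilogarithm\<close>

text \<open>Putting y = b u turns sinh (b y) in the exponent of \<open>sb\<close> into sinh (h u)
  with h = b^2; replacing 1 / sinh (h u) by 1 / (h u) leaves \<open>lam0\<close> divided by h, and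
  the exact difference is \<open>lamE h\<close>. The bound for this remainder grows linearly in X,
  and so does the term pi X left in the exponent by the summand b of Q = b + 1/b. Neither estimate
  is uniform along a whole line, so both terms are paid for out of the decay of Re \<Phi> / h, which
  is possible once h is small. Two heights shape the contour: decay at the right end requires Im X <
  -1/4, and the remainder is controlled for Im X > -1/2. For small b the given line, at Im X =
  -(3/8) (1 + b^2), and the saddle point both lie strictly between them, so the line can be moved
  within a region of uniform decay. The hypothesis on sigma and mu makes the roots of the saddle
  equation a conjugate pair; on the side of W it keeps the argument of arcsin in (-1, 1). The closed
  forms for the dilogarithm and for \<open>lam0\<close> come from one device: a difference has
  derivative 0 on a connected set, and its constant is found at a convenient point.\<close>

definition Li2_domain :: "complex set" where
  "Li2_domain = {z. 1 - z \<notin> \<real>\<^sub>\<le>\<^sub>0}"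

lemma Li2_domainI_Im: "Im z \<noteq> 0 \<Longrightarrow> z \<in> Li2_domain"
  by (auto simp: Li2_domain_def complex_nonpos_Reals_iff)

lemma Li2_domainI_Re: "Re z < 1 \<Longrightarrow> z \<in> Li2_domain"
  by (auto simp: Li2_domain_def complex_nonpos_Reals_iff)

lemma Li2_domain_iff: "z \<in> Li2_domain \<longleftrightarrow> Re z < 1 \<or> Im z \<noteq> 0"
  by (auto simp: Li2_domain_def complex_nonpos_Reals_iff)

lemma open_Li2_domain: "open Li2_domain"
proof -
  have *: "Li2_domain = {z. Re z < 1} \<union> {z. Im z < 0} \<union> {z. Im z > 0}"
    by (auto simp: Li2_domain_iff)
  show ?thesis
    unfolding * by (intro open_Un open_halfspace_Re_lt open_halfspace_Im_lt open_halfspace_Im_gt)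
qed

lemma closed_segment_0_Li2_domain:
  assumes "z \<in> Li2_domain"
  shows "closed_segment 0 z \<subseteq> Li2_domain"
proof
  fix x assume "x \<in> closed_segment 0 z"
  then obtain u where u: "0 \<le> u" "u \<le> 1" "x = of_real u * z"
    by (auto simp: closed_segment_def scaleR_conv_of_real)
  show "x \<in> Li2_domain"
  proof (cases "u = 0 \<or> Im z \<noteq> 0")
    case True
    then show ?thesis using u by (cases "u = 0") (auto simp: Li2_domain_iff)
  next
    case False
    then have "Re z < 1" using assms by (auto simp: Li2_domain_iff)
    then have "u * Re z < 1"
      by (metis False mult.commute mult_le_cancel_left1 mult_less_cancel_right2 not_less_iff_gr_or_eq order_less_le_trans u(1,2) zero_less_one mult_left_le)
    then show ?thesis using u by (auto simp: Li2_domain_iff)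
  qed
qed

lemma Li2_integrand_tendsto_0: "((\<lambda>u. Ln (1 - u) / u) \<longlongrightarrow> -1) (at (0::complex))"
proof -
  have "((\<lambda>u. Ln (1 - u)) has_field_derivative -1) (at 0)"
    by (auto intro!: derivative_eq_intros)
  then show ?thesis by (simp add: has_field_derivative_iff)
qed

text \<open>The integrand of \<open>Li2\<close> has a removable singularity at 0, where division by
  zero gives it the value 0 instead of the limit -1. The patched function \<open>g\<close> is
  continuous on the star-shaped cut plane and holomorphic off 0, so it has a primitive there with 0
  as an exceptional point.\<close>

lemma Li2_has_field_derivative:
  assumes "z \<in> Li2_domain"
  shows "(Li2 has_field_derivative (if z = 0 then 1 else - Ln (1 - z) / z)) (at z)"
proof -
  define g :: "complex \<Rightarrow> complex" where "g z = (if z = 0 then -1 else Ln (1 - z) / z)" for z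
  have der: "g field_differentiable at x" if "x \<in> Li2_domain - {0}" for x
  proof -
    have "(\<lambda>z. Ln (1 - z) / z) field_differentiable at x"
      using that by (auto intro!: derivative_eq_intros simp: field_differentiable_def Li2_domain_def)
    then show ?thesis
      by (rule field_differentiable_transform_within[where d="norm x", rotated 3])
         (use that in \<open>auto simp: g_def dist_norm\<close>)
  qed
  have "continuous (at x) g" if "x \<in> Li2_domain" for x
  proof (cases "x = 0")
    case True
    have "(g \<longlongrightarrow> -1) (at 0)"
      using Li2_integrand_tendsto_0
      by (rule Lim_transform_eventually) (auto simp: g_def eventually_at_filter)
    then show ?thesis using True by (simp add: continuous_at g_def)
  next
    case False
    then show ?thesis using der that by (intro field_differentiable_imp_continuous_at) auto
  qed
  then have "continuous_on Li2_domain g" by (intro continuous_at_imp_continuous_on) auto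
  moreover have "starlike Li2_domain"
    unfolding starlike_def using closed_segment_0_Li2_domain
    by (intro bexI[of _ 0]) (auto simp: Li2_domain_iff)
  ultimately obtain P where P: "\<And>x. x \<in> Li2_domain \<Longrightarrow> (P has_field_derivative g x) (at x)"
    using holomorphic_starlike_primitive[where k="{0}", OF _ _ open_Li2_domain _ der] by auto
  have "Li2 x = P 0 - P x" if "x \<in> Li2_domain" for x
  proof (cases "x = 0")
    case True
    then show ?thesis by (simp add: Li2_def)
  next
    case False
    have "(g has_contour_integral (P (pathfinish (linepath 0 x)) - P (pathstart (linepath 0 x)))) (linepath 0 x)"
      using P closed_segment_0_Li2_domain[OF that]
      by (intro contour_integral_primitive[where S=Li2_domain])
         (auto simp: has_field_derivative_at_within simp del: linepath_0)
    then have "((\<lambda>t. g (linepath 0 x t) * (x - 0)) has_integral (P x - P 0)) {0..1}"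
      by (simp add: has_contour_integral_linepath)
    \<comment> \<open>The patched and the original integrand differ at parameter 0 alone, which does
      not affect the integral.\<close>
    then have "((\<lambda>t. Ln (1 - linepath 0 x t) / linepath 0 x t * (x - 0)) has_integral (P x - P 0)) {0..1}"
      by (rule has_integral_spike[where S="{0}", rotated 2])
         (use False in \<open>auto simp: g_def linepath_def\<close>)
    then have "((\<lambda>u. Ln (1 - u) / u) has_contour_integral (P x - P 0)) (linepath 0 x)"
      by (simp add: has_contour_integral_linepath)
    then show ?thesis by (simp add: Li2_def contour_integral_unique)
  qed
  moreover have "((\<lambda>x. P 0 - P x) has_field_derivative - g z) (at z)"
    using P[OF assms] by (auto intro!: derivative_eq_intros)
  ultimately have "(Li2 has_field_derivative - g z) (at z)"
    using assms open_Li2_domain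
    by (metis (no_types, lifting) has_field_derivative_transform_within_open)
  then show ?thesis by (simp add: g_def split: if_splits)
qed

lemma Li2_0 [simp]: "Li2 0 = 0"
  by (simp add: Li2_def)

lemma Li2_holomorphic_on_domain: "Li2 holomorphic_on Li2_domain"
  using Li2_has_field_derivative by (meson field_differentiable_def field_differentiable_at_within holomorphic_on_def)

lemma has_field_derivative_Li2_compose:
  assumes "(f has_field_derivative f') (at x)" "f x \<in> Li2_domain" "f x \<noteq> 0"
  shows "((\<lambda>x. Li2 (f x)) has_field_derivative (- Ln (1 - f x) / f x * f')) (at x)"
  using DERIV_chain2[OF Li2_has_field_derivative[OF assms(2)] assms(1)] assms(3) by simp

text \<open>The numbers -x and 1 - x have the same imaginary part, so their arguments lie in the
  same open half of (-pi, pi), or both vanish; the difference of the principal logarithms therefore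
  stays in the principal strip.\<close>

lemma Ln_neg_minus_Ln_one_minus:
  assumes "- x \<notin> \<real>\<^sub>\<le>\<^sub>0"
  shows "Ln (- x / (1 - x)) = Ln (- x) - Ln (1 - x)"
proof -
  have nz: "x \<noteq> 0" "1 - x \<noteq> 0" using assms by (auto simp: complex_nonpos_Reals_iff complex_eq_iff)
  have *: "\<bar>Im (Ln (- x) - Ln (1 - x))\<bar> < pi"
  proof -
    consider "Im x > 0" | "Im x < 0" | "Im x = 0" by linarith
    then show ?thesis
    proof cases
      case 1
      then have "Im (Ln (- x)) < 0" "Im (Ln (1 - x)) < 0"
        using nz Im_Ln_pos_le[of "-x"] Im_Ln_pos_le[of "1-x"] mpi_less_Im_Ln Im_Ln_le_pi
        by (smt (verit) add.inverse_inverse neg_equal_0_iff_equal Im_Ln_pos_le uminus_complex.sel minus_complex.sel one_complex.sel)+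
      then show ?thesis using nz mpi_less_Im_Ln[of "-x"] mpi_less_Im_Ln[of "1-x"] by simp
    next
      case 2
      then have "Im (Ln (- x)) > 0" "Im (Ln (1 - x)) > 0"
        using nz Im_Ln_pos_lt[of "-x"] Im_Ln_pos_lt[of "1-x"] by auto
      then show ?thesis using nz Im_Ln_le_pi[of "-x"] Im_Ln_le_pi[of "1-x"] by simp
    next
      case 3
      then have "Re x < 0" using assms by (auto simp: complex_nonpos_Reals_iff)
      then have "x = of_real (Re x)" using 3 by (simp add: complex_eq_iff)
      then obtain r where r: "x = of_real r" "r < 0" using \<open>Re x < 0\<close> by blast
      have "Ln (- x) = of_real (ln (- r))" "Ln (1 - x) = of_real (ln (1 - r))"
        using r Ln_of_real[of "-r"] Ln_of_real[of "1-r"] by auto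
      then show ?thesis by simp
    qed
  qed
  show ?thesis
    by (rule Ln_unique) (use * nz in \<open>auto simp: exp_diff\<close>)
qed

text \<open>The constant is read off at \<open>x = exp (\<i> \<pi> / 3)\<close>, a fixed point of \<open>x \<mapsto> 1 / (1 - x)\<close>.\<close>

lemma Li2_inverse_one_minus:
  assumes "- x \<notin> \<real>\<^sub>\<le>\<^sub>0"
  shows "Li2 (1 / (1 - x)) = Li2 x + Ln (- x) * Ln (1 - x) - (Ln (1 - x))\<^sup>2 / 2 + of_real (pi\<^sup>2 / 6)"
proof -
  define S :: "complex set" where "S = {x. - x \<notin> \<real>\<^sub>\<le>\<^sub>0}"
  define G where "G x = Li2 (1 / (1 - x)) - Li2 x - Ln (- x) * Ln (1 - x) + (Ln (1 - x))\<^sup>2 / 2" for x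
  have "starlike S"
    unfolding starlike_def
  proof (intro bexI ballI subsetI)
    show "-1 \<in> S" by (auto simp: S_def complex_nonpos_Reals_iff)
    fix x y assume x: "x \<in> S" and "y \<in> closed_segment (-1) x"
    then obtain u where u: "0 \<le> u" "u \<le> 1" "y = (1 - of_real u) * (-1) + of_real u * x"
      by (auto simp: closed_segment_def scaleR_conv_of_real)
    show "y \<in> S"
    proof (cases "u = 0")
      case True
      then show ?thesis using u by (auto simp: S_def complex_nonpos_Reals_iff)
    next
      case False
      have "(1 - u) + u * (- Re x) > 0" if "Re x < 0"
        using u False that by (intro add_nonneg_pos mult_pos_pos) auto
      then show ?thesis using x u False by (auto simp: S_def complex_nonpos_Reals_iff)
    qed
  qed
  then have conn: "connected S" by (rule starlike_imp_connected)
  have opS: "open S"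
  proof -
    have "S = {z. Re z < 0} \<union> {z. Im z < 0} \<union> {z. Im z > 0}"
      by (auto simp: S_def complex_nonpos_Reals_iff)
    then show ?thesis
      by (simp add: open_Un open_halfspace_Re_lt open_halfspace_Im_lt open_halfspace_Im_gt)
  qed
  have der: "(G has_field_derivative 0) (at x)" if "x \<in> S" for x
  proof -
    have nz: "x \<noteq> 0" "1 - x \<noteq> 0" "x \<noteq> 1" using that by (auto simp: S_def complex_nonpos_Reals_iff complex_eq_iff)
    have m: "- x \<notin> \<real>\<^sub>\<le>\<^sub>0" "1 - x \<notin> \<real>\<^sub>\<le>\<^sub>0" "x \<in> Li2_domain"
      using that by (auto simp: S_def complex_nonpos_Reals_iff Li2_domain_iff)
    have d: "1 / (1 - x) \<in> Li2_domain"
    proof (cases "Im x = 0")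
      case True
      then have "Re x < 0" using that by (auto simp: S_def complex_nonpos_Reals_iff)
      moreover have "x = of_real (Re x)" using True by (simp add: complex_eq_iff)
      ultimately obtain r where r: "x = of_real r" "r < 0" by blast
      have "1 / (1 - x) = of_real (1 / (1 - r))" using r by simp
      then show ?thesis using r by (intro Li2_domainI_Re) (simp add: field_simps del: of_real_divide)
    next
      case False
      then show ?thesis by (intro Li2_domainI_Im) (auto simp: Im_divide nz complex_eq_iff)
    qed
    have e: "1 - 1 / (1 - x) = - x / (1 - x)" using nz by (simp add: field_simps)
    have "((\<lambda>x. 1 / (1 - x)) has_field_derivative 1 / (1 - x)\<^sup>2) (at x)"
      using nz by (auto intro!: derivative_eq_intros simp: power2_eq_square)
    from has_field_derivative_Li2_compose[OF this d]
    have D1: "((\<lambda>x. Li2 (1 / (1 - x))) has_field_derivative (- (Ln (- x) - Ln (1 - x)) / (1 - x))) (at x)"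
      unfolding e Ln_neg_minus_Ln_one_minus[OF m(1)] using nz by (simp add: power2_eq_square)
    have D2: "(Li2 has_field_derivative (- Ln (1 - x) / x)) (at x)"
      using Li2_has_field_derivative[OF m(3)] nz by simp
    have D3: "((\<lambda>x. Ln (- x)) has_field_derivative 1 / x) (at x)"
      using m nz by (auto intro!: derivative_eq_intros simp: inverse_eq_divide)
    have D4: "((\<lambda>x. Ln (1 - x)) has_field_derivative - 1 / (1 - x)) (at x)"
      using m nz by (auto intro!: derivative_eq_intros simp: inverse_eq_divide)
    have D5: "((\<lambda>x. (Ln (1 - x))\<^sup>2 / 2) has_field_derivative - Ln (1 - x) / (1 - x)) (at x)"
      by (rule back_subst[where P="\<lambda>d. (_ has_field_derivative d) _",
            OF DERIV_cdivide[OF DERIV_power[OF D4, of 2], of 2]]) (use nz in \<open>simp add: field_simps\<close>)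
    show ?thesis
      unfolding G_def
      by (rule back_subst[where P="\<lambda>d. (_ has_field_derivative d) _",
            OF DERIV_add[OF DERIV_diff[OF DERIV_diff[OF D1 D2] DERIV_mult[OF D3 D4]] D5]])
         (simp add: diff_divide_distrib)
  qed
  have "G constant_on S"
    by (rule has_field_derivative_0_imp_constant_on[OF _ conn opS]) (use der in auto)
  then obtain c where c: "\<And>x. x \<in> S \<Longrightarrow> G x = c" by (auto simp: constant_on_def)
  define \<omega> where "\<omega> = cis (pi / 3)"
  have w: "\<omega> = Complex (1/2) (sqrt 3 / 2)" by (simp add: \<omega>_def cis.ctr cos_60 sin_60)
  have "\<omega> \<in> S" by (simp add: S_def w complex_nonpos_Reals_iff)
  have omw: "1 - \<omega> = cis (- pi / 3)"
    by (simp add: w complex_eq_iff cis.ctr cos_60 sin_60)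
  have fx: "1 / (1 - \<omega>) = \<omega>" unfolding omw by (simp add: \<omega>_def cis_divide[symmetric] field_simps cis_mult)
  have "- \<omega> = cis (- 2 * pi / 3)" by (simp add: w complex_eq_iff cis.ctr cos_120 sin_120)
  then have L1: "Ln (- \<omega>) = - \<i> * (2 * pi) / 3"
    using pi_gt_zero by (intro Ln_unique) (auto simp: cis_conv_exp intro: order_trans[of _ 0])
  have L2: "Ln (1 - \<omega>) = - \<i> * pi / 3"
    unfolding omw using pi_gt_zero by (intro Ln_unique) (auto simp: cis_conv_exp intro: order_trans[of _ 0])
  have "c = G \<omega>" using c \<open>\<omega> \<in> S\<close> by simp
  also have "\<dots> = of_real (pi\<^sup>2 / 6)"
    unfolding G_def fx L1 L2 by (simp add: field_simps power2_eq_square)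
  finally show ?thesis using c[of x] assms by (simp add: G_def S_def algebra_simps)
qed

text \<open>The map x to x / (x - 1) preserves the cut plane, because 1 - x / (x - 1) is the inverse
  of 1 - x, and it turns Ln (1 - x) into its negative. The derivative of the sum with the squared
  logarithm then vanishes, and every term is 0 at x = 0.\<close>

lemma Li2_Landen:
  assumes "x \<in> Li2_domain"
  shows "Li2 x + Li2 (x / (x - 1)) = - (Ln (1 - x))\<^sup>2 / 2"
proof -
  define G where "G x = Li2 x + Li2 (x / (x - 1)) + (Ln (1 - x))\<^sup>2 / 2" for x
  have conn: "connected Li2_domain"
    using closed_segment_0_Li2_domain
    by (intro starlike_imp_connected) (auto simp: starlike_def Li2_domainI_Re intro!: bexI[of _ 0])
  have der: "(G has_field_derivative 0) (at x)" if "x \<in> Li2_domain" for x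
  proof -
    have m: "1 - x \<notin> \<real>\<^sub>\<le>\<^sub>0" and nz: "x \<noteq> 1" "x - 1 \<noteq> 0" "1 - x \<noteq> 0" using that by (auto simp: Li2_domain_def)
    have e: "1 - x / (x - 1) = inverse (1 - x)" using nz by (simp add: field_simps)
    have d: "x / (x - 1) \<in> Li2_domain"
      unfolding Li2_domain_def mem_Collect_eq e using m
      by (metis inverse_inverse_eq nonpos_Reals_inverse_I)
    have "((\<lambda>x. x / (x - 1)) has_field_derivative - 1 / (x - 1)\<^sup>2) (at x)"
      using nz by (auto intro!: derivative_eq_intros simp: power2_eq_square field_simps)
    from DERIV_chain2[OF Li2_has_field_derivative[OF d] this]
    have D1: "((\<lambda>x. Li2 (x / (x - 1))) has_field_derivative (if x = 0 then -1 else - Ln (1 - x) / (x * (x - 1)))) (at x)"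
      unfolding e Ln_inverse[OF m]
      by (rule back_subst[where P="\<lambda>d. (_ has_field_derivative d) _"])
         (use nz in \<open>auto simp: divide_simps power2_eq_square\<close>)
    have D4: "((\<lambda>x. Ln (1 - x)) has_field_derivative - 1 / (1 - x)) (at x)"
      using m nz by (auto intro!: derivative_eq_intros simp: inverse_eq_divide)
    have D5: "((\<lambda>x. (Ln (1 - x))\<^sup>2 / 2) has_field_derivative - Ln (1 - x) / (1 - x)) (at x)"
      by (rule back_subst[where P="\<lambda>d. (_ has_field_derivative d) _",
            OF DERIV_cdivide[OF DERIV_power[OF D4, of 2], of 2]]) (use nz in \<open>simp add: field_simps\<close>)
    have "- Ln (1 - x) / x + - Ln (1 - x) / (x * (x - 1)) + - Ln (1 - x) / (1 - x) = 0" if "x \<noteq> 0"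
    proof -
      have e: "1 / (1 - x) = - 1 / x - 1 / (x * (x - 1))"
        using nz that by (simp add: divide_simps)
      have "Ln (1 - x) / (1 - x) = Ln (1 - x) * (1 / (1 - x))" by simp
      also have "\<dots> = - Ln (1 - x) / x - Ln (1 - x) / (x * (x - 1))"
        unfolding e by (simp add: right_diff_distrib)
      finally show ?thesis by simp
    qed
    then have "(if x = 0 then 1 else - Ln (1 - x) / x) +
        (if x = 0 then - 1 else - Ln (1 - x) / (x * (x - 1))) + - Ln (1 - x) / (1 - x) = 0"
      by simp
    then show ?thesis
      unfolding G_def
      using DERIV_add[OF DERIV_add[OF Li2_has_field_derivative[OF that] D1] D5] by metis
  qed
  have "G constant_on Li2_domain"
    by (rule has_field_derivative_0_imp_constant_on[OF _ conn open_Li2_domain]) (use der in auto)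
  then obtain c where c: "\<And>x. x \<in> Li2_domain \<Longrightarrow> G x = c" by (auto simp: constant_on_def)
  have "c = G 0" using c by (simp add: Li2_domain_iff)
  then have "c = 0" by (simp add: G_def)
  then show ?thesis using c[OF assms] by (simp add: G_def eq_neg_iff_add_eq_0)
qed

text \<open>Inversion and Landen's identity at x = -1 both involve Li2 (1/2) and the square of Ln 2;
  eliminating the former removes the latter too. The value is the source of the constant pi / 24 in
  \<open>lam0_eq\<close>.\<close>

lemma Li2_minus_one: "Li2 (-1) = - of_real (pi\<^sup>2 / 12)"
proof -
  have "Li2 (1 / 2) = Li2 (-1) - (Ln 2)\<^sup>2 / 2 + of_real (pi\<^sup>2 / 6)"
    using Li2_inverse_one_minus[of "-1"] by (simp add: complex_nonpos_Reals_iff)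
  moreover have "Li2 (-1) + Li2 (1 / 2) = - (Ln 2)\<^sup>2 / 2"
    using Li2_Landen[of "-1"] by (simp add: Li2_domain_iff)
  ultimately have "2 * Li2 (-1) = - of_real (pi\<^sup>2 / 6)" by (simp add: field_simps) algebra?
  then show ?thesis by (simp add: complex_eq_iff)
qed

section \<open>Integrals depending on a parameter\<close>

lemma integrable_on_continuous_bounded:
  fixes f :: "real \<Rightarrow> 'a :: euclidean_space"
  assumes "continuous_on S f" "S \<in> sets lebesgue" "g integrable_on S" "\<And>x. x \<in> S \<Longrightarrow> norm (f x) \<le> g x"
  shows "f integrable_on S" "f absolutely_integrable_on S"
  using measurable_bounded_by_integrable_imp_absolutely_integrable[OF continuous_imp_measurable_on_sets_lebesgue[OF assms(1,2)] assms(2-4)]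
  by (auto simp: absolutely_integrable_on_def)

text \<open>Dominated convergence for the truncated integrands. The abstract intervals let one
  statement serve the half-line, exhausted by [1/(n+1), n+1], and the real line, exhausted by
  [-n, n].\<close>

lemma integral_exhaustion_tendsto:
  fixes f :: "real \<Rightarrow> 'a :: euclidean_space" and a b :: "nat \<Rightarrow> real"
  assumes inc: "incseq (\<lambda>n. {a n..b n})" and S: "S = (\<Union>n. {a n..b n})"
    and f: "f integrable_on S" "g integrable_on S" "\<And>x. x \<in> S \<Longrightarrow> norm (f x) \<le> g x"
  shows "(\<lambda>n. integral {a n..b n} f) \<longlonglongrightarrow> integral S f"
proof -
  have eq: "integral {a n..b n} f = integral S (\<lambda>x. if x \<in> {a n..b n} then f x else 0)" for n
    using S by (subst integral_restrict_Int) (auto intro!: arg_cong[where f="\<lambda>A. integral A f"])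
  have "f integrable_on {a n..b n}" for n
    using integrable_on_subcbox[OF f(1), of "a n" "b n"] S by auto
  then have int: "(\<lambda>x. if x \<in> {a n..b n} then f x else 0) integrable_on S" for n
    unfolding integrable_restrict_Int[of "{a n..b n}"] using S
    by (metis Int_absorb2 UNIV_I UN_upper)
  have ev: "eventually (\<lambda>n. x \<in> {a n..b n}) sequentially" if x: "x \<in> S" for x
  proof -
    obtain m where "x \<in> {a m..b m}" using x S by auto
    then have "x \<in> {a n..b n}" if "n \<ge> m" for n
      using inc that unfolding incseq_def by blast
    then show ?thesis by (auto simp: eventually_sequentially)
  qed
  show ?thesis
    unfolding eq
  proof (rule dominated_convergence(2)[OF int f(2)])
    fix k x assume x: "x \<in> S"
    have "0 \<le> g x" using f(3)[OF x] norm_ge_zero order_trans by blast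
    then show "norm (if x \<in> {a k..b k} then f x else 0) \<le> g x"
      using f(3)[OF x] by auto
    show "(\<lambda>k. if x \<in> {a k..b k} then f x else 0) \<longlonglongrightarrow> f x"
      by (rule tendsto_eventually) (rule eventually_mono[OF ev[OF x]], simp)
  qed
qed

text \<open>Weierstrass' theorem: on each compact interval the Leibniz rule applies, and the
  truncated integrals converge locally uniformly in z, so their derivatives converge too. Domination
  concerns \<open>f\<close> and not \<open>f'\<close>, which is why the derivative appears as the
  limit \<open>D\<close> of integrals over compact intervals.\<close>

lemma has_field_derivative_parametric_integral:
  fixes f f' :: "complex \<Rightarrow> real \<Rightarrow> complex" and a b :: "nat \<Rightarrow> real"
  assumes inc: "incseq (\<lambda>n. {a n..b n})" and S: "S = (\<Union>n. {a n..b n})" and U: "open U"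
    and der: "\<And>z t. z \<in> U \<Longrightarrow> t \<in> S \<Longrightarrow> ((\<lambda>z. f z t) has_field_derivative f' z t) (at z)"
    and cf: "\<And>z. z \<in> U \<Longrightarrow> continuous_on S (f z)"
    and cf': "continuous_on (U \<times> S) (\<lambda>(z, t). f' z t)"
    and dom: "\<And>z. z \<in> U \<Longrightarrow> \<exists>d g. 0 < d \<and> cball z d \<subseteq> U \<and> g integrable_on S \<and>
                 (\<forall>w\<in>cball z d. \<forall>t\<in>S. norm (f w t) \<le> g t)"
    and z: "z \<in> U"
  obtains D where "((\<lambda>z. integral S (f z)) has_field_derivative D) (at z)"
    "(\<lambda>n. integral {a n..b n} (f' z)) \<longlonglongrightarrow> D"
proof -
  have sub: "{a n..b n} \<subseteq> S" for n using S by auto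
  have Sm: "S \<in> sets lebesgue" unfolding S by (intro sets.countable_UN) auto
  have "\<exists>g'. \<forall>x\<in>U. ((\<lambda>z. integral S (f z)) has_field_derivative g' x) (at x) \<and>
           (\<lambda>n. integral {a n..b n} (f' x)) \<longlonglongrightarrow> g' x"
  proof (rule has_complex_derivative_uniform_sequence[where f="\<lambda>n z. integral {a n..b n} (f z)" and f'="\<lambda>n z. integral {a n..b n} (f' z)", OF U])
    fix n x assume x: "x \<in> U"
    obtain d where d: "d > 0" "ball x d \<subseteq> U" using U x by (meson openE)
    have "((\<lambda>z. integral (cbox (a n) (b n)) (f z)) has_field_derivative integral (cbox (a n) (b n)) (f' x)) (at x within ball x d)"
    proof (rule leibniz_rule_field_derivative)
      fix z t assume "z \<in> ball x d" "t \<in> cbox (a n) (b n)"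
      then have "z \<in> U" "t \<in> S" using subsetD[OF d(2)] subsetD[OF sub[of n]] by simp_all
      then show "((\<lambda>z. f z t) has_field_derivative f' z t) (at z within ball x d)"
        by (rule has_field_derivative_at_within[OF der])
    next
      fix z assume "z \<in> ball x d"
      then show "f z integrable_on cbox (a n) (b n)"
        using continuous_on_subset[OF cf[OF subsetD[OF d(2)]] sub[of n]] by (intro integrable_continuous) simp
    next
      show "continuous_on (ball x d \<times> cbox (a n) (b n)) (\<lambda>(z, t). f' z t)"
        by (rule continuous_on_subset[OF cf']) (use d sub[of n] in auto)
    qed (use d in auto)
    then show "((\<lambda>z. integral {a n..b n} (f z)) has_field_derivative integral {a n..b n} (f' x)) (at x)"
      using d by (simp add: at_within_open[of _ "ball x d"])
  next
    fix x assume x: "x \<in> U"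
    obtain d g where d: "0 < d" "cball x d \<subseteq> U" "g integrable_on S"
      "\<And>w t. w \<in> cball x d \<Longrightarrow> t \<in> S \<Longrightarrow> norm (f w t) \<le> g t" using dom[OF x] by blast
    have g0: "0 \<le> g t" if "t \<in> S" for t
      using d(4)[of x t] d(1) that norm_ge_zero[of "f x t"] by (simp del: norm_ge_zero)
    have glim: "(\<lambda>n. integral {a n..b n} g) \<longlonglongrightarrow> integral S g"
      by (rule integral_exhaustion_tendsto[OF inc S d(3,3)]) (use g0 in auto)
    \<comment> \<open>The tail of \<open>f w\<close> is dominated by the tail of \<open>g\<close>,
      which does not depend on \<open>w\<close>; this is the uniformity in the parameter.\<close>
    have bound: "norm (integral S (f w) - integral {a n..b n} (f w)) \<le> integral S g - integral {a n..b n} g"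
      if w: "w \<in> cball x d" for w n
    proof -
      have fS: "f w integrable_on S"
        by (rule integrable_on_continuous_bounded(1)[OF cf Sm d(3)]) (use w d in auto)
      have fn: "f w integrable_on {a n..b n}" "g integrable_on {a n..b n}"
        using integrable_on_subcbox[OF fS, of "a n" "b n"] integrable_on_subcbox[OF d(3), of "a n" "b n"] sub by auto
      have *: "(\<lambda>t. if t \<in> {a n..b n} then f w t else 0) integrable_on S"
         "(\<lambda>t. if t \<in> {a n..b n} then g t else 0) integrable_on S"
        unfolding integrable_restrict_Int[of "{a n..b n}"] using fn sub[of n] by (auto simp: Int_absorb2)
      have e: "integral {a n..b n} (f w) = integral S (\<lambda>t. if t \<in> {a n..b n} then f w t else 0)"
              "integral {a n..b n} g = integral S (\<lambda>t. if t \<in> {a n..b n} then g t else 0)"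
        using sub[of n] by (auto simp: integral_restrict_Int Int_absorb2 simp del: atLeastAtMost_iff)
      show ?thesis
        unfolding e
        apply (subst integral_diff[symmetric, OF fS *(1)])
        apply (subst integral_diff[symmetric, OF d(3) *(2)])
        apply (rule integral_norm_bound_integral[OF integrable_diff[OF fS *(1)] integrable_diff[OF d(3) *(2)]])
        using d(4)[OF w] g0 by simp
    qed
    have "uniform_limit (cball x d) (\<lambda>n z. integral {a n..b n} (f z)) (\<lambda>z. integral S (f z)) sequentially"
    proof (rule uniform_limitI)
      fix e :: real assume "e > 0"
      have "\<forall>\<^sub>F n in sequentially. dist (integral {a n..b n} g) (integral S g) < e"
        using glim \<open>e > 0\<close> by (rule tendstoD)
      then show "\<forall>\<^sub>F n in sequentially. \<forall>w\<in>cball x d. dist (integral {a n..b n} (f w)) (integral S (f w)) < e"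
      proof eventually_elim
        case (elim n)
        show ?case
        proof
          fix w assume "w \<in> cball x d"
          from bound[OF this, of n] elim show "dist (integral {a n..b n} (f w)) (integral S (f w)) < e"
            by (simp add: dist_norm norm_minus_commute)
        qed
      qed
    qed
    then show "\<exists>d. 0 < d \<and> cball x d \<subseteq> U \<and> uniform_limit (cball x d) (\<lambda>n z. integral {a n..b n} (f z)) (\<lambda>z. integral S (f z)) sequentially"
      using d by blast
  qed
  then show thesis using z that by blast
qed

lemma UN_halfline: "{0<..} = (\<Union>n. {1 / real (Suc n)..real (Suc n)})"
proof (intro equalityI subsetI)
  fix x :: real assume "x \<in> {0<..}"
  then have x: "x > 0" by simp
  obtain m where m: "x < real m" using reals_Archimedean2 by blast
  obtain k where k: "1 / real (Suc k) < x" using x nat_approx_posE by metis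
  have "1 / real (Suc (max m k)) \<le> 1 / real (Suc k)"
    by (intro divide_left_mono) auto
  then have "x \<in> {1 / real (Suc (max m k))..real (Suc (max m k))}"
    using m k by auto
  then show "x \<in> (\<Union>n. {1 / real (Suc n)..real (Suc n)})" by blast
next
  fix x :: real assume "x \<in> (\<Union>n. {1 / real (Suc n)..real (Suc n)})"
  then obtain n where "1 / real (Suc n) \<le> x" by auto
  moreover have "0 < 1 / real (Suc n)" by simp
  ultimately have "0 < x" by linarith
  then show "x \<in> {0<..}" by simp
qed

lemma incseq_halfline: "incseq (\<lambda>n. {1 / real (Suc n)..real (Suc n)})"
proof (intro incseq_SucI subsetI)
  fix n x assume "x \<in> {1 / real (Suc n)..real (Suc n)}"
  moreover have "1 / real (Suc (Suc n)) \<le> 1 / real (Suc n)" by (intro divide_left_mono) auto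
  ultimately show "x \<in> {1 / real (Suc (Suc n))..real (Suc (Suc n))}" by auto
qed

lemma halfline_lebesgue: "{0::real<..} \<in> sets lebesgue"
  by auto

text \<open>A dominating function for \<open>f'\<close> at the single point \<open>z\<close>
  identifies the abstract limit \<open>D\<close> with the integral of \<open>f' z\<close>, since
  both are limits of the same integrals over compact intervals.\<close>

lemma has_field_derivative_halfline_integral:
  fixes f f' :: "complex \<Rightarrow> real \<Rightarrow> complex"
  assumes U: "open U"
    and der: "\<And>z t. z \<in> U \<Longrightarrow> t > 0 \<Longrightarrow> ((\<lambda>z. f z t) has_field_derivative f' z t) (at z)"
    and cf: "\<And>z. z \<in> U \<Longrightarrow> continuous_on {0<..} (f z)"
    and cf': "continuous_on (U \<times> {0<..}) (\<lambda>(z, t). f' z t)"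
    and dom: "\<And>z. z \<in> U \<Longrightarrow> \<exists>d g. 0 < d \<and> cball z d \<subseteq> U \<and> g integrable_on {0<..} \<and>
                 (\<forall>w\<in>cball z d. \<forall>t\<in>{0<..}. norm (f w t) \<le> g t)"
    and dom': "g' integrable_on {0<..}" "\<And>t. t > 0 \<Longrightarrow> norm (f' z t) \<le> g' t"
    and z: "z \<in> U"
  shows "((\<lambda>z. integral {0<..} (f z)) has_field_derivative integral {0<..} (f' z)) (at z)"
proof -
  have "continuous_on {0<..} (f' z)"
    using continuous_on_compose2[OF cf', of "{0<..}" "\<lambda>t. (z, t)"] z
    by (auto simp: continuous_on_Pair)
  then have "f' z integrable_on {0<..}"
    by (rule integrable_on_continuous_bounded(1)[OF _ halfline_lebesgue dom'(1)]) (use dom' in auto)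
  then have lim: "(\<lambda>n. integral {1 / real (Suc n)..real (Suc n)} (f' z)) \<longlonglongrightarrow> integral {0<..} (f' z)"
    by (rule integral_exhaustion_tendsto[OF incseq_halfline UN_halfline _ dom'(1)]) (use dom' in auto)
  obtain D where D: "((\<lambda>z. integral {0<..} (f z)) has_field_derivative D) (at z)"
    "(\<lambda>n. integral {1 / real (Suc n)..real (Suc n)} (f' z)) \<longlonglongrightarrow> D"
    by (rule has_field_derivative_parametric_integral[OF incseq_halfline UN_halfline U _ cf cf' dom z])
       (use der in auto)
  show ?thesis using LIMSEQ_unique[OF lim D(2)] D(1) by simp
qed

lemma integral_UNIV_affine:
  fixes f :: "real \<Rightarrow> complex"
  assumes "integrable lborel f" "c > 0"
  shows "integral UNIV (\<lambda>t. f (d + c * t)) = integral UNIV f / of_real c"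
proof -
  have "integral UNIV (\<lambda>t. f (d + c * t)) = (\<integral>t. f (d + c * t) \<partial>lborel)"
    using assms by (intro integral_lborel lborel_integrable_real_affine) auto
  moreover have "integral UNIV f = (\<integral>t. f t \<partial>lborel)"
    using assms by (intro integral_lborel)
  ultimately show ?thesis
    using lborel_integral_real_affine[of c f d] assms by (simp add: scaleR_conv_of_real)
qed

lemma integrable_lborel_continuous_bounded:
  fixes f :: "real \<Rightarrow> 'a :: euclidean_space"
  assumes "continuous_on S f" "S \<in> sets borel" "g integrable_on S" "\<And>x. x \<in> S \<Longrightarrow> norm (f x) \<le> g x"
  shows "set_integrable lborel S f"
proof -
  have "f absolutely_integrable_on S"
    by (rule integrable_on_continuous_bounded(2)[OF assms(1) _ assms(3,4)]) (use assms in auto)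
  moreover have "set_borel_measurable borel S f"
    unfolding set_borel_measurable_def using assms borel_measurable_continuous_on_indicator by blast
  ultimately show ?thesis
    by (simp add: set_integrable_def set_borel_measurable_def integrable_completion)
qed

text \<open>Serves twice: with factor 1/2 in the duplication identity for \<open>lam0'\<close>, and
  with factor 1 / b in the substitution y = b u that rescales \<open>sb\<close>.\<close>

lemma integral_halfline_scale:
  fixes f :: "real \<Rightarrow> complex"
  assumes "continuous_on {0<..} f" "g integrable_on {0<..}" "\<And>x. x > 0 \<Longrightarrow> norm (f x) \<le> g x" "c > 0"
  shows "integral {0<..} (\<lambda>t. f (c * t)) = integral {0<..} f / of_real c"
proof -
  have *: "set_integrable lborel {0<..} f"
    by (rule integrable_lborel_continuous_bounded[OF assms(1) _ assms(2)]) (use assms in auto)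
  have eq: "integral {0<..} h = integral UNIV (\<lambda>t. indicator {0<..} t *\<^sub>R h t)" for h :: "real \<Rightarrow> complex"
    by (subst integral_restrict_UNIV[symmetric]) (rule integral_cong, simp add: indicator_def)
  have "(\<lambda>t. indicator {0<..} t *\<^sub>R f (c * t)) = (\<lambda>t. indicator {0<..} (0 + c * t) *\<^sub>R f (0 + c * t))"
    using assms(4) by (auto simp: indicator_def zero_less_mult_iff)
  then show ?thesis
    unfolding eq using integral_UNIV_affine[OF *[unfolded set_integrable_def] assms(4), of 0] by simp
qed

section \<open>Elementary estimates\<close>

lemma norm_cos_le_exp_Im: "norm (cos z) \<le> exp \<bar>Im z\<bar>"
proof -
  have "norm (cos z) \<le> (norm (exp (\<i> * z)) + norm (exp (- (\<i> * z)))) / 2"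
    unfolding cos_exp_eq norm_divide norm_numeral by (intro divide_right_mono norm_triangle_ineq) simp
  also have "\<dots> \<le> (exp \<bar>Im z\<bar> + exp \<bar>Im z\<bar>) / 2"
    by (intro divide_right_mono add_mono) auto
  finally show ?thesis by simp
qed

text \<open>The mean value inequality on the segment from 0 to z, where both factors of the bound
  are largest at z. Each application integrates once and gains a factor |z|, which leads from cos to
  sin, then to cos - 1 and to sin z - z.\<close>

lemma norm_diff_le_along_segment:
  fixes f :: "complex \<Rightarrow> complex"
  assumes der: "\<And>z. (f has_field_derivative f' z) (at z)" and "f 0 = 0"
    and bd: "\<And>z. norm (f' z) \<le> norm z ^ n * exp \<bar>Im z\<bar>"
  shows "norm (f z) \<le> norm z ^ Suc n * exp \<bar>Im z\<bar>"
proof -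
  have "norm (f z - f 0) \<le> (norm z ^ n * exp \<bar>Im z\<bar>) * norm (z - 0)"
  proof (rule field_differentiable_bound[where S="closed_segment 0 z" and f'=f'])
    fix x assume "x \<in> closed_segment 0 z"
    then obtain u where u: "0 \<le> u" "u \<le> 1" "x = of_real u * z"
      by (auto simp: closed_segment_def scaleR_conv_of_real)
    have "norm (f' x) \<le> norm x ^ n * exp \<bar>Im x\<bar>" by (rule bd)
    also have "\<dots> \<le> norm z ^ n * exp \<bar>Im z\<bar>"
      using u by (intro mult_mono power_mono) (auto simp: norm_mult abs_mult mult_left_le_one_le)
    finally show "norm (f' x) \<le> norm z ^ n * exp \<bar>Im z\<bar>" .
  qed (auto intro: has_field_derivative_at_within der)
  then show ?thesis using assms(2) by (simp add: mult_ac)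
qed

lemma norm_sin_le: "norm (sin z) \<le> norm z * exp \<bar>Im z\<bar>"
  using norm_diff_le_along_segment[of sin cos 0 z] norm_cos_le_exp_Im
  by (auto intro: DERIV_sin)

lemma norm_cos_minus_1_le: "norm (cos z - 1) \<le> norm z ^ 2 * exp \<bar>Im z\<bar>"
proof -
  have "((\<lambda>z. cos z - 1) has_field_derivative - sin z) (at z)" for z :: complex
    by (auto intro!: derivative_eq_intros)
  from norm_diff_le_along_segment[OF this, of 1 z] show ?thesis
    using norm_sin_le by (simp add: numeral_2_eq_2)
qed

lemma norm_sin_minus_id_le: "norm (sin z - z) \<le> norm z ^ 3 * exp \<bar>Im z\<bar>"
proof -
  have "((\<lambda>z. sin z - z) has_field_derivative cos z - 1) (at z)" for z :: complex
    by (auto intro!: derivative_eq_intros)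
  from norm_diff_le_along_segment[OF this, of 2 z] show ?thesis
    using norm_cos_minus_1_le by (simp add: numeral_3_eq_3 numeral_2_eq_2)
qed

lemma sinh_ge_id: "x \<ge> 0 \<Longrightarrow> sinh (x :: real) \<ge> x"
proof -
  assume x: "x \<ge> 0"
  have "\<exists>y. ((\<lambda>x. sinh x - x) has_real_derivative y) (at t) \<and> 0 \<le> y" if "0 \<le> t" for t :: real
    by (rule exI[of _ "cosh t - 1"]) (auto intro!: derivative_eq_intros cosh_real_ge_1)
  then have "sinh 0 - 0 \<le> sinh x - x"
    by (intro DERIV_nonneg_imp_nondecreasing[OF x]) auto
  then show ?thesis by simp
qed

lemma sinh_le_mult_cosh: "x \<ge> 0 \<Longrightarrow> sinh (x :: real) \<le> x * cosh x"
proof -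
  assume x: "x \<ge> 0"
  have "\<exists>y. ((\<lambda>x. x * cosh x - sinh x) has_real_derivative y) (at t) \<and> 0 \<le> y" if "0 \<le> t" for t :: real
    by (rule exI[of _ "t * sinh t"]) (use that in \<open>auto intro!: derivative_eq_intros\<close>)
  then have "0 * cosh 0 - sinh 0 \<le> x * cosh x - sinh x"
    by (intro DERIV_nonneg_imp_nondecreasing[OF x]) auto
  then show ?thesis by simp
qed

lemma sinh_minus_id_le: "x \<ge> 0 \<Longrightarrow> sinh x - x \<le> x\<^sup>2 / 2 * sinh (x :: real)"
proof -
  assume x: "x \<ge> 0"
  have "sinh x - x \<le> x * (cosh x - 1)"
    using sinh_le_mult_cosh[OF x] by (simp add: algebra_simps)
  also have "cosh x - 1 = 2 * sinh (x/2) * sinh (x/2)"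
    using cosh_double[of "x/2"] cosh_square_eq[of "x/2"] by (simp add: power2_eq_square)
  also have "x * (2 * sinh (x/2) * sinh (x/2)) \<le> x * (2 * (x/2 * cosh (x/2)) * sinh (x/2))"
    using x sinh_le_mult_cosh[of "x/2"] by (intro mult_left_mono mult_right_mono) auto
  also have "\<dots> = x\<^sup>2 / 2 * sinh x"
    using sinh_double[of "x/2"] by (simp add: power2_eq_square)
  finally show ?thesis .
qed

text \<open>The linear bound has two uses: it makes (1/u - 1/sinh u) / u bounded near 0, and with x
  = h u it shows that replacing 1 / sinh (h u) by 1 / (h u) costs only O(h u).\<close>

lemma inverse_minus_inverse_sinh:
  fixes x :: real
  assumes "x > 0"
  shows "0 \<le> 1 / x - 1 / sinh x" "1 / x - 1 / sinh x \<le> x / 2"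
proof -
  have s: "sinh x > 0" using assms by simp
  have e: "1 / x - 1 / sinh x = (sinh x - x) / (x * sinh x)" using assms s by (simp add: field_simps)
  show "0 \<le> 1 / x - 1 / sinh x" unfolding e using assms s sinh_ge_id[of x] by auto
  have "(sinh x - x) / (x * sinh x) \<le> (x\<^sup>2 / 2 * sinh x) / (x * sinh x)"
    using assms s sinh_minus_id_le[of x] by (intro divide_right_mono) auto
  also have "\<dots> = x / 2" using assms s by (simp add: field_simps power2_eq_square)
  finally show "1 / x - 1 / sinh x \<le> x / 2" unfolding e .
qed

text \<open>The factor sin (2 u X) grows at most at rate 2 kappa and 1 / sinh u decays at rate 1, so
  the net rate is 1 - 2 kappa = 2 delta. Half of it is spent on the factor 1 + 2 u, the other half
  remains.\<close>

lemma id_div_sinh_le: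
  fixes u \<kappa> :: real
  assumes "u > 0" "\<kappa> < 1/2"
  shows "u * exp (2 * \<kappa> * u) / sinh u \<le> (1 + 2 / (1/2 - \<kappa>)) * exp (- (1/2 - \<kappa>) * u)"
proof -
  define \<delta> where "\<delta> = 1/2 - \<kappa>"
  have d: "\<delta> > 0" using assms by (simp add: \<delta>_def)
  have s: "sinh u > 0" using assms by simp
  have "(1 + 2 * u) * exp (- 2 * u) \<le> exp (2 * u) * exp (- 2 * u)"
    using exp_ge_add_one_self[of "2 * u"] by (intro mult_right_mono) auto
  then have "(1 + 2 * u) * exp (- 2 * u) \<le> 1" by (simp flip: exp_add)
  moreover have "sinh u * ((1 + 2 * u) * exp (- u)) = (1 + 2 * u) * (1 - exp (- 2 * u)) / 2"
    by (simp add: sinh_field_def field_simps flip: exp_add)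
  \<comment> \<open>Equivalent to 2 u <= (1 + 2 u) (1 - exp (-2 u)), that is, to 1 + 2 u <= exp (2
    u).\<close>
  ultimately have "u \<le> sinh u * ((1 + 2 * u) * exp (- u))"
    by (simp add: algebra_simps)
  then have "u / sinh u \<le> (1 + 2 * u) * exp (- u)"
    using s by (simp add: divide_simps mult_ac)
  then have "u / sinh u * exp (2 * \<kappa> * u) \<le> (1 + 2 * u) * exp (- u) * exp (2 * \<kappa> * u)"
    by (intro mult_right_mono) auto
  also have "\<dots> = (1 + 2 * u) * exp (- 2 * \<delta> * u)"
    by (simp add: \<delta>_def algebra_simps flip: exp_add)
  also have "\<dots> \<le> (1 + 2 / \<delta>) * exp (\<delta> * u) * exp (- 2 * \<delta> * u)"
  proof (intro mult_right_mono)
    have "\<delta> * u \<le> exp (\<delta> * u)" using exp_ge_add_one_self[of "\<delta> * u"] by linarith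
    then have "u \<le> exp (\<delta> * u) / \<delta>" using d by (simp add: field_simps)
    moreover have "1 \<le> exp (\<delta> * u)" using d assms by simp
    ultimately show "1 + 2 * u \<le> (1 + 2 / \<delta>) * exp (\<delta> * u)"
      unfolding distrib_right times_divide_eq_left by linarith
  qed auto
  also have "\<dots> = (1 + 2 / \<delta>) * exp (- \<delta> * u)"
    by (simp add: algebra_simps flip: exp_add)
  finally show ?thesis by (simp add: \<delta>_def)
qed

lemma integrable_on_exp_minus_halfline: "c > 0 \<Longrightarrow> (\<lambda>u. exp (- c * u) :: real) integrable_on {0<..}"
proof -
  assume "c > 0"
  then have "(\<lambda>u. exp (- c * u) :: real) integrable_on {0..}"
    by (rule integrable_on_exp_minus_to_infinity)
  then show ?thesis
  proof (rule integrable_spike_set)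
    show "negligible {x \<in> {0..} - {0<..}. exp (- c * x) \<noteq> 0}"
      by (rule negligible_subset[of "{0}"]) auto
    show "negligible {x \<in> {0<..} - {0..}. exp (- c * x) \<noteq> 0}"
      by (rule negligible_subset[of "{0}"]) auto
  qed
qed

lemma integrable_on_id_div_sinh:
  assumes "\<kappa> < (1/2 :: real)"
  shows "(\<lambda>u. u * exp (2 * \<kappa> * u) / sinh u :: real) integrable_on {0<..}"
proof (rule measurable_bounded_by_integrable_imp_integrable)
  show "(\<lambda>u. u * exp (2 * \<kappa> * u) / sinh u) \<in> borel_measurable (lebesgue_on {0<..})"
    by (intro continuous_imp_measurable_on_sets_lebesgue continuous_intros) auto
  show "(\<lambda>u. (1 + 2 / (1/2 - \<kappa>)) * exp (- (1/2 - \<kappa>) * u)) integrable_on {0<..}"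
    using assms by (intro integrable_on_mult_right integrable_on_exp_minus_halfline) auto
  show "norm (u * exp (2 * \<kappa> * u) / sinh u) \<le> (1 + 2 / (1/2 - \<kappa>)) * exp (- (1/2 - \<kappa>) * u)"
    if "u \<in> {0<..}" for u
    using id_div_sinh_le[of u \<kappa>] assms that by simp
qed auto

lemma integrable_on_inverse_minus_inverse_sinh:
  "(\<lambda>u. (1 / u - 1 / sinh u) / u :: real) integrable_on {0<..}"
proof -
  have c: "continuous_on {0<..} (\<lambda>u::real. (1 / u - 1 / sinh u) / u)"
    by (intro continuous_intros) auto
  have "(\<lambda>u. (1 / u - 1 / sinh u) / u :: real) integrable_on {0<..<1}"
  proof (rule measurable_bounded_by_integrable_imp_integrable)
    show "(\<lambda>u. (1 / u - 1 / sinh u) / u) \<in> borel_measurable (lebesgue_on {0<..<1::real})"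
      by (rule continuous_imp_measurable_on_sets_lebesgue[OF continuous_on_subset[OF c]]) auto
    show "(\<lambda>u. 1/2 :: real) integrable_on {0<..<1::real}"
      using integrable_on_open_interval_real by blast
    show "norm ((1 / u - 1 / sinh u) / u) \<le> 1/2" if "u \<in> {0<..<1}" for u :: real
      using inverse_minus_inverse_sinh[of u] that by (simp add: field_simps)
  qed auto
  moreover have "(\<lambda>u. (1 / u - 1 / sinh u) / u :: real) integrable_on {1..}"
  proof (rule measurable_bounded_by_integrable_imp_integrable)
    show "(\<lambda>u. (1 / u - 1 / sinh u) / u) \<in> borel_measurable (lebesgue_on {1::real..})"
      by (rule continuous_imp_measurable_on_sets_lebesgue[OF continuous_on_subset[OF c]]) auto
    show "(\<lambda>u. 1 / u ^ 2 :: real) integrable_on {1::real..}"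
      using has_integral_integrable[OF has_integral_inverse_power_to_inf[of 2 1]] by simp
    show "norm ((1 / u - 1 / sinh u) / u) \<le> 1 / u ^ 2" if "u \<in> {1..}" for u :: real
      using inverse_minus_inverse_sinh[of u] that by (simp add: field_simps power2_eq_square)
  qed auto
  moreover have "negligible ({0<..<1} \<inter> {1::real..})"
    by (rule negligible_subset[of "{}"]) auto
  ultimately have "(\<lambda>u. (1 / u - 1 / sinh u) / u :: real) integrable_on ({0<..<1} \<union> {1..})"
    by (intro integrable_Un)
  moreover have "{0<..<1} \<union> {1::real..} = {0<..}" by auto
  ultimately show ?thesis by simp
qed

section \<open>The Fourier sine transform of the hyperbolic cosecant\<close>

lemma has_integral_exp_complex_halfline:
  assumes z: "Re z > 0"
  shows "((\<lambda>u. exp (- z * of_real u)) has_integral 1 / z) {0<..}"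
proof -
  have nz: "z \<noteq> 0" using z by auto
  have bd: "norm (exp (- z * of_real u)) \<le> exp (- Re z * u)" for u by simp
  have int: "(\<lambda>u. exp (- z * of_real u)) integrable_on {0<..}"
    by (rule integrable_on_continuous_bounded(1)[OF _ halfline_lebesgue integrable_on_exp_minus_halfline[OF z] bd])
       (intro continuous_intros)
  have lim: "(\<lambda>n. integral {1 / real (Suc n)..real (Suc n)} (\<lambda>u. exp (- z * of_real u)))
      \<longlonglongrightarrow> integral {0<..} (\<lambda>u. exp (- z * of_real u))"
    by (rule integral_exhaustion_tendsto[OF incseq_halfline UN_halfline int integrable_on_exp_minus_halfline[OF z] bd])
  have "integral {1 / real (Suc n)..real (Suc n)} (\<lambda>u. exp (- z * of_real u)) =
      (- exp (- z * of_real (real (Suc n))) / z) - (- exp (- z * of_real (1 / real (Suc n))) / z)" for n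
  proof (rule integral_unique, rule fundamental_theorem_of_calculus)
    have "1 / real (Suc n) \<le> 1" by simp
    then show "1 / real (Suc n) \<le> real (Suc n)" by linarith
    fix x :: real
    have "((\<lambda>w. - exp (- z * w) / z) has_field_derivative exp (- z * of_real x)) (at (of_real x))"
      using nz by (auto intro!: derivative_eq_intros)
    then show "((\<lambda>u. - exp (- z * of_real u) / z) has_vector_derivative exp (- z * of_real x))
         (at x within {1 / real (Suc n)..real (Suc n)})"
      by (rule has_vector_derivative_real_field)
  qed
  moreover have "(\<lambda>n. (- exp (- z * of_real (real (Suc n))) / z) - (- exp (- z * of_real (1 / real (Suc n))) / z))
     \<longlonglongrightarrow> (- 0 / z) - (- exp (- z * of_real 0) / z)"
  proof (intro tendsto_intros nz)
    show "(\<lambda>n. exp (- z * of_real (real (Suc n)))) \<longlonglongrightarrow> 0"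
    proof (rule tendsto_norm_zero_cancel)
      have "(\<lambda>n. exp (- Re z) ^ Suc n) \<longlonglongrightarrow> 0"
        using z by (intro LIMSEQ_Suc LIMSEQ_power_zero) auto
      moreover have "norm (exp (- z * of_real (real (Suc n)))) = exp (- Re z) ^ Suc n" for n
        unfolding exp_of_nat_mult[symmetric] norm_exp_eq_Re by (simp add: algebra_simps)
      ultimately show "(\<lambda>n. norm (exp (- z * of_real (real (Suc n))))) \<longlonglongrightarrow> 0"
        by (simp only:)
    qed
    show "(\<lambda>n. 1 / real (Suc n)) \<longlonglongrightarrow> 0"
      using LIMSEQ_inverse_real_of_nat by (simp add: inverse_eq_divide)
  qed
  ultimately have "(\<lambda>n. integral {1 / real (Suc n)..real (Suc n)} (\<lambda>u. exp (- z * of_real u))) \<longlonglongrightarrow> 1 / z"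
    by simp
  with lim have "integral {0<..} (\<lambda>u. exp (- z * of_real u)) = 1 / z"
    using LIMSEQ_unique by blast
  then show ?thesis using int by (simp add: has_integral_integrable_integral)
qed

text \<open>Both sides of the reflection formula for Gamma z Gamma (1 - z) are differentiated, and
  the result is divided by the common value pi / sin (pi z).\<close>

lemma Digamma_reflection:
  fixes z :: complex
  assumes "z \<notin> \<int>"
  shows "Digamma (1 - z) - Digamma z = pi * cos (pi * z) / sin (pi * z)"
proof -
  have "1 - z \<notin> \<int>" using assms by (metis Ints_1 Ints_diff diff_diff_eq2 add_diff_cancel_left')
  then have nI: "z \<notin> \<int>\<^sub>\<le>\<^sub>0" "1 - z \<notin> \<int>\<^sub>\<le>\<^sub>0" using assms by (auto simp: nonpos_Ints_Int)
  have s: "sin (pi * z) \<noteq> 0"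
    using assms by (auto simp: sin_eq_0)
  have "((\<lambda>z. Gamma z * Gamma (1 - z)) has_field_derivative
      Gamma z * Digamma z * Gamma (1 - z) - Gamma z * (Gamma (1 - z) * Digamma (1 - z))) (at z)"
    using nI by (auto intro!: derivative_eq_intros)
  moreover have "((\<lambda>z. of_real pi / sin (pi * z)) has_field_derivative
      - pi * (pi * cos (pi * z)) / (sin (pi * z))\<^sup>2) (at z)"
    using s by (auto intro!: derivative_eq_intros simp: power2_eq_square)
  ultimately have "Gamma z * Digamma z * Gamma (1 - z) - Gamma z * (Gamma (1 - z) * Digamma (1 - z)) =
      - pi * (pi * cos (pi * z)) / (sin (pi * z))\<^sup>2"
    unfolding Gamma_reflection_complex by (rule DERIV_unique)
  then have "(Gamma z * Gamma (1 - z)) * (Digamma (1 - z) - Digamma z) = pi * (pi * cos (pi * z)) / (sin (pi * z))\<^sup>2"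
    by (simp add: algebra_simps)
  then have "(pi / sin (pi * z)) * (Digamma (1 - z) - Digamma z) = (pi / sin (pi * z)) * (pi * cos (pi * z) / sin (pi * z))"
    unfolding Gamma_reflection_complex by (simp add: power2_eq_square)
  moreover have "of_real pi / sin (pi * z) \<noteq> 0" using s by simp
  ultimately show ?thesis by (metis mult_left_cancel)
qed

lemma cosh_pi_strip_Re_pos:
  fixes X :: complex
  assumes "\<bar>Im X\<bar> < 1/2"
  shows "Re (cosh (pi * X)) > 0"
proof -
  have "cos (pi * Im X) > 0"
  proof -
    have "\<bar>pi * Im X\<bar> < pi / 2" using assms by (simp add: abs_mult)
    then show ?thesis by (intro cos_gt_zero_pi) linarith+
  qed
  moreover have "Re (cosh (pi * X)) = cosh (pi * Re X) * cos (pi * Im X)"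
    by (simp add: cosh_field_def Re_exp sinh_field_def cosh_def field_simps)
  ultimately show ?thesis by simp
qed

text \<open>A truncated geometric series for 1 / sinh u. The closed form shows that the partial sums
  lie between 0 and 1 / sinh u, which provides the domination in
  \<open>integral_sin_div_sinh\<close>.\<close>

lemma sum_exp_odd_eq:
  fixes u :: real assumes "u > 0"
  shows "(\<Sum>k<n. 2 * exp (- (2 * real k + 1) * u)) = (1 - exp (- 2 * real n * u)) / sinh u"
proof (induction n)
  case (Suc n)
  have "2 * exp (- (2 * real n + 1) * u) * sinh u = exp (- 2 * real n * u) - exp (- 2 * real (Suc n) * u)"
    by (simp add: sinh_field_def algebra_simps exp_add exp_diff exp_minus) (simp add: field_simps flip: exp_add)
  then show ?case using Suc assms by (simp add: field_simps)
qed auto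

lemma norm_sin_strip_le:
  fixes X :: complex
  assumes "u > 0" "\<bar>Im X\<bar> \<le> \<kappa>"
  shows "norm (sin (2 * of_real u * X)) \<le> 2 * u * norm X * exp (2 * \<kappa> * u)"
proof -
  have "\<bar>Im (2 * of_real u * X)\<bar> \<le> 2 * \<kappa> * u"
    using assms by (simp add: abs_mult mult.commute)
  then have "norm (2 * of_real u * X) * exp \<bar>Im (2 * of_real u * X)\<bar> \<le> norm (2 * of_real u * X) * exp (2 * \<kappa> * u)"
    by (intro mult_left_mono) auto
  with norm_sin_le[of "2 * of_real u * X"] have "norm (sin (2 * of_real u * X)) \<le> norm (2 * of_real u * X) * exp (2 * \<kappa> * u)"
    by (rule order_trans)
  then show ?thesis using assms by (simp add: norm_mult)
qed

text \<open>Expanding 1 / sinh u into twice the sum of exp (-(2k+1) u) and integrating term by term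
  gives the difference of two Digamma series, at a = 1/2 - i X and b = 1/2 + i X. As b = 1 - a, the
  reflection formula sums them to pi cot (pi a), and cot (pi a) = i tanh (pi X).\<close>

lemma integral_sin_div_sinh:
  fixes X :: complex
  assumes X: "\<bar>Im X\<bar> < 1/2"
  shows "integral {0<..} (\<lambda>u. sin (2 * of_real u * X) / of_real (sinh u)) = pi / 2 * (sinh (pi * X) / cosh (pi * X))"
proof -
  define \<kappa> where "\<kappa> = \<bar>Im X\<bar>"
  define s where "s u = sin (2 * of_real u * X) / complex_of_real (sinh u)" for u
  define g where "g u = (2 * norm X) * (u * exp (2 * \<kappa> * u) / sinh u)" for u
  have gint: "g integrable_on {0<..}"
    unfolding g_def using X by (intro integrable_on_mult_right integrable_on_id_div_sinh) (auto simp: \<kappa>_def)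
  have sg: "norm (s u) \<le> g u" if "u > 0" for u
    using norm_sin_strip_le[OF that, of X \<kappa>] that
    by (auto simp: s_def g_def norm_divide \<kappa>_def field_simps)
  have scont: "continuous_on {0<..} s"
    unfolding s_def by (intro continuous_intros) auto
  define F where "F n u = s u * of_real (1 - exp (- 2 * real n * u))" for n u
  have Fint: "F n integrable_on {0<..}" and Fg: "\<And>u. u > 0 \<Longrightarrow> norm (F n u) \<le> g u" for n
  proof -
    show *: "norm (F n u) \<le> g u" if "u > 0" for u
    proof -
      have "norm (F n u) = norm (s u) * (1 - exp (- 2 * real n * u))"
        using that by (simp add: F_def norm_mult del: of_real_diff)
      also have "\<dots> \<le> norm (s u) * 1" by (intro mult_left_mono) auto
      finally show ?thesis using sg[OF that] by simp
    qed
    show "F n integrable_on {0<..}"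
      by (rule integrable_on_continuous_bounded(1)[OF _ halfline_lebesgue gint])
         (use * in \<open>auto simp: F_def intro!: continuous_intros scont\<close>)
  qed
  have lim: "(\<lambda>n. integral {0<..} (F n)) \<longlonglongrightarrow> integral {0<..} s"
  proof (rule dominated_convergence(2)[OF Fint gint])
    fix u :: real assume u: "u \<in> {0<..}"
    have "(\<lambda>n. exp (- 2 * u) ^ n) \<longlonglongrightarrow> 0"
      using u by (intro LIMSEQ_power_zero) auto
    then have "(\<lambda>n. exp (- 2 * real n * u)) \<longlonglongrightarrow> 0"
      by (simp add: exp_of_nat_mult[symmetric] mult_ac)
    then have "(\<lambda>n. s u * of_real (1 - exp (- 2 * real n * u))) \<longlonglongrightarrow> s u * of_real (1 - 0)"
      by (intro tendsto_intros)
    then show "(\<lambda>n. F n u) \<longlonglongrightarrow> s u" by (simp add: F_def)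
  qed (use Fg in auto)
  define c where "c k = (2 * of_nat k + 1 :: complex)" for k
  define a where "a = 1/2 - \<i> * X"
  define b where "b = 1/2 + \<i> * X"
  have val: "integral {0<..} (F n) = (\<Sum>k<n. (inverse (a + of_nat k) - inverse (b + of_nat k)) / (2 * \<i>))" for n
  proof (rule integral_unique)
    have "((\<lambda>u. \<Sum>k<n. (exp (- (c k - 2 * \<i> * X) * of_real u) - exp (- (c k + 2 * \<i> * X) * of_real u)) / \<i>)
       has_integral (\<Sum>k<n. (1 / (c k - 2 * \<i> * X) - 1 / (c k + 2 * \<i> * X)) / \<i>)) {0<..}"
      using X by (intro has_integral_sum has_integral_divide has_integral_diff has_integral_exp_complex_halfline)
         (auto simp: c_def abs_if split: if_splits)
    also have "(\<Sum>k<n. (1 / (c k - 2 * \<i> * X) - 1 / (c k + 2 * \<i> * X)) / \<i>) =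
       (\<Sum>k<n. (inverse (a + of_nat k) - inverse (b + of_nat k)) / (2 * \<i>))"
    proof (rule sum.cong)
      fix k
      have eqs: "c k - 2 * \<i> * X = 2 * (a + of_nat k)" "c k + 2 * \<i> * X = 2 * (b + of_nat k)"
        by (auto simp: c_def a_def b_def)
      have half: "1 / (2 * p) - 1 / (2 * q) = (inverse p - inverse q) / 2" for p q :: complex
        by (simp add: inverse_eq_divide diff_divide_distrib mult.commute)
      show "(1 / (c k - 2 * \<i> * X) - 1 / (c k + 2 * \<i> * X)) / \<i> =
         (inverse (a + of_nat k) - inverse (b + of_nat k)) / (2 * \<i>)"
        unfolding eqs half by (simp only: divide_divide_eq_left)
    qed simp
    finally show "(F n has_integral (\<Sum>k<n. (inverse (a + of_nat k) - inverse (b + of_nat k)) / (2 * \<i>))) {0<..}"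
    proof (rule has_integral_eq[rotated])
      fix u :: real assume u: "u \<in> {0<..}"
      have "(\<Sum>k<n. (exp (- (c k - 2 * \<i> * X) * of_real u) - exp (- (c k + 2 * \<i> * X) * of_real u)) / \<i>) =
        (\<Sum>k<n. sin (2 * of_real u * X) * of_real (2 * exp (- (2 * real k + 1) * u)))"
      proof (rule sum.cong)
        fix k
        have e: "- (c k - 2 * \<i> * X) * of_real u = - c k * of_real u + \<i> * (2 * of_real u * X)"
             "- (c k + 2 * \<i> * X) * of_real u = - c k * of_real u + - (\<i> * (2 * of_real u * X))"
          by (auto simp: algebra_simps)
        have "complex_of_real (2 * exp (- (2 * real k + 1) * u)) = 2 * exp (- c k * of_real u)"
          by (simp add: c_def exp_of_real[symmetric])
        then show "(exp (- (c k - 2 * \<i> * X) * of_real u) - exp (- (c k + 2 * \<i> * X) * of_real u)) / \<i> =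
          sin (2 * of_real u * X) * of_real (2 * exp (- (2 * real k + 1) * u))"
          unfolding e exp_add by (simp add: sin_exp_eq right_diff_distrib diff_divide_distrib mult_ac)
      qed simp
      also have "\<dots> = sin (2 * of_real u * X) * of_real ((1 - exp (- 2 * real n * u)) / sinh u)"
        using u by (subst sum_exp_odd_eq[symmetric]) (auto simp: sum_distrib_left)
      finally show "(\<Sum>k<n. (exp (- (c k - 2 * \<i> * X) * of_real u) - exp (- (c k + 2 * \<i> * X) * of_real u)) / \<i>) = F n u"
        by (simp add: F_def s_def)
    qed
  qed
  have nz: "a \<noteq> 0" "b \<noteq> 0" using X by (auto simp: a_def b_def complex_eq_iff)
  \<comment> \<open>The two series diverge separately; ln n is inserted into each so that the limit
    formula for Digamma applies, and it cancels in the difference.\<close>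
  have "(\<lambda>n. ((of_real (ln (real n)) - (\<Sum>k<n. inverse (b + of_nat k))) -
       (of_real (ln (real n)) - (\<Sum>k<n. inverse (a + of_nat k)))) / (2 * \<i>)) \<longlonglongrightarrow> (Digamma b - Digamma a) / (2 * \<i>)"
    using nz by (intro tendsto_intros Digamma_LIMSEQ) auto
  then have "(\<lambda>n. integral {0<..} (F n)) \<longlonglongrightarrow> (Digamma b - Digamma a) / (2 * \<i>)"
    unfolding val by (simp add: sum_divide_distrib sum_subtractf algebra_simps diff_divide_distrib)
  with lim have "integral {0<..} s = (Digamma b - Digamma a) / (2 * \<i>)"
    using LIMSEQ_unique by blast
  also have "b = 1 - a" by (simp add: a_def b_def)
  also have "Digamma (1 - a) - Digamma a = pi * cos (pi * a) / sin (pi * a)"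
  proof (rule Digamma_reflection)
    show "a \<notin> \<int>"
    proof
      assume "a \<in> \<int>"
      then obtain m where "a = of_int m" by (auto elim: Ints_cases)
      then have "Re a = of_int m" by simp
      then have "1/2 + Im X = of_int m" by (simp add: a_def)
      then have "(0::real) < of_int m" "of_int m < (1::real)" using X by linarith+
      then show False by simp
    qed
  qed
  also have "pi * a = of_real pi / 2 - \<i> * (pi * X)" by (simp add: a_def algebra_simps)
  also have "sin (of_real pi / 2 - \<i> * (pi * X)) = cosh (pi * X)"
    by (simp add: sin_diff cosh_conv_cos flip: sin_of_real cos_of_real)
  also have "cos (of_real pi / 2 - \<i> * (pi * X)) = \<i> * sinh (pi * X)"
    by (simp add: cos_diff sinh_conv_sin flip: sin_of_real cos_of_real)
  finally show ?thesis by (simp add: s_def mult_ac)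
qed

section \<open>The classical limit of the hyperbolic gamma function\<close>

text \<open>In the variable X = b x the strip |Im x| < Q/2 becomes |Im X| < (1 + b^2) / 2. The width
  chosen here works for every b at once, and on it cosh (pi X) has positive real part.\<close>

definition half_strip :: "complex set" where
  "half_strip = {X. \<bar>Im X\<bar> < 1/2}"

lemma open_half_strip: "open half_strip"
proof -
  have *: "half_strip = {X. Im X < 1/2} \<inter> {X. Im X > -1/2}" by (auto simp: half_strip_def)
  show ?thesis unfolding * by (intro open_Int open_halfspace_Im_lt open_halfspace_Im_gt)
qed

lemma convex_half_strip: "convex half_strip"
proof -
  have *: "half_strip = {X. Im X < 1/2} \<inter> {X. Im X > -1/2}" by (auto simp: half_strip_def)
  show ?thesis unfolding * by (intro convex_Int convex_halfspace_Im_lt convex_halfspace_Im_gt)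
qed

lemma half_strip_neighbourhood:
  fixes X :: complex
  assumes "X \<in> half_strip"
  obtains d \<kappa> where "d > 0" "\<kappa> < 1/2" "cball X d \<subseteq> half_strip"
    "\<And>w. w \<in> cball X d \<Longrightarrow> \<bar>Im w\<bar> \<le> \<kappa>" "\<And>w. w \<in> cball X d \<Longrightarrow> norm w \<le> norm X + d"
proof
  define d where "d = (1/2 - \<bar>Im X\<bar>) / 2"
  show "d > 0" "\<bar>Im X\<bar> + d < 1/2" using assms unfolding d_def half_strip_def by (simp, simp add: field_simps)
  show *: "\<bar>Im w\<bar> \<le> \<bar>Im X\<bar> + d" if "w \<in> cball X d" for w
    using that abs_Im_le_cmod[of "X - w"] by (simp add: dist_norm)
  show "norm w \<le> norm X + d" if "w \<in> cball X d" for w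
    using that norm_triangle_ineq2[of w X] by (simp add: dist_norm norm_minus_commute)
  show "cball X d \<subseteq> half_strip"
    using * \<open>\<bar>Im X\<bar> + d < 1/2\<close> by (force simp: half_strip_def)
qed

text \<open>The substitution y = b u puts sinh u sinh (b^2 u) into the denominator of the exponent
  of \<open>sb\<close> at X / b; with sinh (b^2 u) replaced by b^2 u the integrand is this kernel
  divided by b^2. The two primed kernels are its derivatives in X.\<close>

definition lam0_kernel :: "complex \<Rightarrow> real \<Rightarrow> complex" where
  "lam0_kernel X u = (sin (2 * of_real u * X) / of_real (2 * u * sinh u) - X / of_real u) / of_real u"

definition lam0_kernel' :: "complex \<Rightarrow> real \<Rightarrow> complex" where
  "lam0_kernel' X u = (cos (2 * of_real u * X) / of_real (sinh u) - 1 / of_real u) / of_real u"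

definition lam0_kernel'' :: "complex \<Rightarrow> real \<Rightarrow> complex" where
  "lam0_kernel'' X u = - 2 * (sin (2 * of_real u * X) / of_real (sinh u))"

text \<open>M bounds |X| and kappa bounds |Im X|. The first summand is the Taylor remainder of sine
  or cosine, the second comes from 1/u - 1/sinh u; the exponent n is 1 for the kernel and 0 for its
  first derivative.\<close>

definition lam0_bound :: "nat \<Rightarrow> real \<Rightarrow> real \<Rightarrow> real \<Rightarrow> real" where
  "lam0_bound n M \<kappa> u = M ^ n * (4 * M\<^sup>2 * (u * exp (2 * \<kappa> * u) / sinh u) + (1 / u - 1 / sinh u) / u)"

lemma lam0_bound_integrable: "\<kappa> < 1/2 \<Longrightarrow> lam0_bound n M \<kappa> integrable_on {0<..}"
  unfolding lam0_bound_def
  by (intro integrable_add integrable_on_mult_right integrable_on_id_div_sinh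
            integrable_on_inverse_minus_inverse_sinh)

lemma lam0_kernel_bound:
  assumes u: "u > 0" and X: "\<bar>Im X\<bar> \<le> \<kappa>" "norm X \<le> M"
  shows "norm (lam0_kernel X u) \<le> lam0_bound 1 M \<kappa> u"
    and "norm (lam0_kernel' X u) \<le> lam0_bound 0 M \<kappa> u"
    and "norm (lam0_kernel'' X u) \<le> 4 * M * (u * exp (2 * \<kappa> * u) / sinh u)"
proof -
  have s: "sinh u > 0" using u by simp
  define z where "z = 2 * of_real u * X"
  have z: "norm z = 2 * u * norm X" "\<bar>Im z\<bar> \<le> 2 * \<kappa> * u"
    using u X by (auto simp: z_def norm_mult abs_mult mult.commute)
  have expz: "exp \<bar>Im z\<bar> \<le> exp (2 * \<kappa> * u)" using z by simp
  have nz: "complex_of_real u \<noteq> 0" "complex_of_real (sinh u) \<noteq> 0" using u s by auto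
  have M0: "M \<ge> 0" using X norm_ge_zero order_trans by blast
  define r where "r = (1 / u - 1 / sinh u) / u"
  have r0: "r \<ge> 0" using inverse_minus_inverse_sinh[OF u] u by (simp add: r_def)
  \<comment> \<open>Both terms of the kernel are singular at u = 0. Subtracting the linear part of
    the sine regroups them into a cubic remainder and X times \<open>r\<close>, each of them
    integrable.\<close>
  have e1: "lam0_kernel X u = (sin z - z) / of_real (2 * u\<^sup>2 * sinh u) - X * of_real r"
    using nz by (simp add: lam0_kernel_def z_def r_def field_simps power2_eq_square)
  have "norm (sin z - z) \<le> (2 * u * M) ^ 3 * exp (2 * \<kappa> * u)"
    by (rule order_trans[OF norm_sin_minus_id_le])
       (use u X z expz M0 in \<open>auto intro!: mult_mono power_mono mult_left_mono\<close>)
  then have "norm ((sin z - z) / of_real (2 * u\<^sup>2 * sinh u)) \<le> (2 * u * M) ^ 3 * exp (2 * \<kappa> * u) / (2 * u\<^sup>2 * sinh u)"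
    unfolding norm_divide norm_of_real using u s by (simp add: divide_right_mono)
  also have "\<dots> = M * (4 * M\<^sup>2 * (u * exp (2 * \<kappa> * u) / sinh u))"
    using u s by (simp add: field_simps power2_eq_square power3_eq_cube)
  finally have b1: "norm ((sin z - z) / of_real (2 * u\<^sup>2 * sinh u)) \<le> M * (4 * M\<^sup>2 * (u * exp (2 * \<kappa> * u) / sinh u))" .
  have "norm (X * of_real r) \<le> M * r" using X r0 by (simp add: norm_mult mult_right_mono)
  with b1 show "norm (lam0_kernel X u) \<le> lam0_bound 1 M \<kappa> u"
    unfolding e1 using norm_triangle_ineq4[of "(sin z - z) / of_real (2 * u\<^sup>2 * sinh u)" "X * of_real r"]
    by (simp add: lam0_bound_def r_def distrib_left)
  have e2: "lam0_kernel' X u = (cos z - 1) / of_real (u * sinh u) - of_real r"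
    using nz by (simp add: lam0_kernel'_def z_def r_def field_simps power2_eq_square)
  have "norm (cos z - 1) \<le> (2 * u * M) ^ 2 * exp (2 * \<kappa> * u)"
    by (rule order_trans[OF norm_cos_minus_1_le])
       (use u X z expz M0 in \<open>auto intro!: mult_mono power_mono mult_left_mono\<close>)
  then have "norm ((cos z - 1) / of_real (u * sinh u)) \<le> (2 * u * M) ^ 2 * exp (2 * \<kappa> * u) / (u * sinh u)"
    unfolding norm_divide norm_of_real using u s by (simp add: divide_right_mono)
  also have "\<dots> = 4 * M\<^sup>2 * (u * exp (2 * \<kappa> * u) / sinh u)"
    using u s by (simp add: field_simps power2_eq_square)
  finally have b2: "norm ((cos z - 1) / of_real (u * sinh u)) \<le> 4 * M\<^sup>2 * (u * exp (2 * \<kappa> * u) / sinh u)" .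
  have "norm (complex_of_real r) \<le> r" using r0 by simp
  with b2 show "norm (lam0_kernel' X u) \<le> lam0_bound 0 M \<kappa> u"
    unfolding e2 using norm_triangle_ineq4[of "(cos z - 1) / of_real (u * sinh u)" "of_real r"]
    by (simp add: lam0_bound_def r_def)
  have "norm (sin z) \<le> (2 * u * M) * exp (2 * \<kappa> * u)"
    by (rule order_trans[OF norm_sin_le])
       (use u X z expz M0 in \<open>auto intro!: mult_mono mult_left_mono\<close>)
  then have "2 * (norm (sin z) / sinh u) \<le> 2 * ((2 * u * M) * exp (2 * \<kappa> * u) / sinh u)"
    using s by (intro mult_left_mono divide_right_mono) auto
  then show "norm (lam0_kernel'' X u) \<le> 4 * M * (u * exp (2 * \<kappa> * u) / sinh u)"
    using s u by (simp add: lam0_kernel''_def z_def norm_mult norm_divide mult_ac)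
qed

lemma continuous_on_lam0_kernel:
  "continuous_on {0<..} (lam0_kernel X)" "continuous_on {0<..} (lam0_kernel' X)"
  "continuous_on (U \<times> {0<..}) (\<lambda>(X, u). lam0_kernel' X u)"
  "continuous_on (U \<times> {0<..}) (\<lambda>(X, u). lam0_kernel'' X u)"
  unfolding lam0_kernel_def lam0_kernel'_def lam0_kernel''_def case_prod_beta
  by (auto intro!: continuous_intros)

definition lam0 :: "complex \<Rightarrow> complex" where
  "lam0 X = integral {0<..} (lam0_kernel X)"

definition lam0' :: "complex \<Rightarrow> complex" where
  "lam0' X = integral {0<..} (lam0_kernel' X)"

lemma has_field_derivative_half_strip_integral:
  fixes f f' :: "complex \<Rightarrow> real \<Rightarrow> complex" and g g' :: "real \<Rightarrow> real \<Rightarrow> real \<Rightarrow> real"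
  assumes der: "\<And>z t. t > 0 \<Longrightarrow> ((\<lambda>z. f z t) has_field_derivative f' z t) (at z)"
    and cont: "\<And>z. continuous_on {0<..} (f z)" "continuous_on (half_strip \<times> {0<..}) (\<lambda>(z, t). f' z t)"
    and g: "\<And>M \<kappa>. \<kappa> < 1/2 \<Longrightarrow> g M \<kappa> integrable_on {0<..}" "\<And>M \<kappa>. \<kappa> < 1/2 \<Longrightarrow> g' M \<kappa> integrable_on {0<..}"
    and bound: "\<And>z t M \<kappa>. t > 0 \<Longrightarrow> \<bar>Im z\<bar> \<le> \<kappa> \<Longrightarrow> norm z \<le> M \<Longrightarrow> norm (f z t) \<le> g M \<kappa> t"
      "\<And>z t M \<kappa>. t > 0 \<Longrightarrow> \<bar>Im z\<bar> \<le> \<kappa> \<Longrightarrow> norm z \<le> M \<Longrightarrow> norm (f' z t) \<le> g' M \<kappa> t"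
    and X: "X \<in> half_strip"
  shows "((\<lambda>X. integral {0<..} (f X)) has_field_derivative integral {0<..} (f' X)) (at X)"
proof (rule has_field_derivative_halfline_integral[OF open_half_strip der cont])
  fix z assume "z \<in> half_strip"
  then obtain d \<kappa> where k: "d > 0" "\<kappa> < 1/2" "cball z d \<subseteq> half_strip"
    "\<And>w. w \<in> cball z d \<Longrightarrow> \<bar>Im w\<bar> \<le> \<kappa>" "\<And>w. w \<in> cball z d \<Longrightarrow> norm w \<le> norm z + d"
    using half_strip_neighbourhood by blast
  show "\<exists>d g. 0 < d \<and> cball z d \<subseteq> half_strip \<and> g integrable_on {0<..} \<and>
     (\<forall>w\<in>cball z d. \<forall>t\<in>{0<..}. norm (f w t) \<le> g t)"
    using k(1,3) g(1)[OF k(2)]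
    by (intro exI[of _ d] exI[of _ "g (norm z + d) \<kappa>"]) (use bound(1) k(4,5) in auto)
next
  show "g' (norm X) \<bar>Im X\<bar> integrable_on {0<..}" using X by (intro g(2)) (simp add: half_strip_def)
  show "norm (f' X t) \<le> g' (norm X) \<bar>Im X\<bar> t" if "t > 0" for t by (rule bound(2)[OF that]) auto
qed (use X in auto)

lemma has_field_derivative_lam0_integral:
  assumes "X \<in> half_strip"
  shows "(lam0 has_field_derivative lam0' X) (at X)"
  unfolding lam0_def[abs_def] lam0'_def
proof (rule has_field_derivative_half_strip_integral[where g="lam0_bound 1" and g'="lam0_bound 0",
      OF _ continuous_on_lam0_kernel(1,3) _ _ _ _ assms])
  fix z and t :: real assume "t > 0"
  then show "((\<lambda>z. lam0_kernel z t) has_field_derivative lam0_kernel' z t) (at z)"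
    unfolding lam0_kernel_def lam0_kernel'_def
    by (auto intro!: derivative_eq_intros simp: field_simps)
qed (simp_all add: lam0_bound_integrable lam0_kernel_bound del: One_nat_def)

lemma has_field_derivative_lam0'_integral:
  fixes X :: complex
  assumes "X \<in> half_strip"
  shows "(lam0' has_field_derivative - pi * (sinh (pi * X) / cosh (pi * X))) (at X)"
proof -
  have "(lam0' has_field_derivative integral {0<..} (lam0_kernel'' X)) (at X)"
    unfolding lam0'_def[abs_def]
  proof (rule has_field_derivative_half_strip_integral[where g="lam0_bound 0"
        and g'="\<lambda>M \<kappa> u. 4 * M * (u * exp (2 * \<kappa> * u) / sinh u)",
        OF _ continuous_on_lam0_kernel(2,4) _ _ _ _ assms])
    fix z and t :: real assume "t > 0"
    then show "((\<lambda>z. lam0_kernel' z t) has_field_derivative lam0_kernel'' z t) (at z)"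
      unfolding lam0_kernel''_def lam0_kernel'_def
      by (auto intro!: derivative_eq_intros simp: field_simps)
  next
    fix M \<kappa> :: real assume "\<kappa> < 1/2"
    then show "(\<lambda>u. 4 * M * (u * exp (2 * \<kappa> * u) / sinh u)) integrable_on {0<..}"
      by (intro integrable_on_mult_right integrable_on_id_div_sinh)
  qed (simp_all add: lam0_bound_integrable lam0_kernel_bound(2) lam0_kernel_bound(3)[simplified])
  also have "integral {0<..} (lam0_kernel'' X) = - 2 * (pi / 2 * (sinh (pi * X) / cosh (pi * X)))"
    unfolding lam0_kernel''_def integral_mult_right
    using assms by (subst integral_sin_div_sinh) (auto simp: half_strip_def)
  finally show ?thesis by simp
qed

text \<open>The bound pi / 2 on the argument, rather than pi, is what allows two such logarithms, or
  one of them and pi X, to be added within the principal branch.\<close>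

lemma two_cosh_half_strip:
  fixes X :: complex
  assumes "X \<in> half_strip"
  shows "2 * cosh (complex_of_real pi * X) \<noteq> 0" "\<bar>Im (Ln (2 * cosh (complex_of_real pi * X)))\<bar> < pi / 2"
    "((\<lambda>X::complex. Ln (2 * cosh (complex_of_real pi * X))) has_field_derivative
       pi * (sinh (complex_of_real pi * X) / cosh (complex_of_real pi * X))) (at X)"
proof -
  have c: "Re (2 * cosh (complex_of_real pi * X)) > 0" using cosh_pi_strip_Re_pos assms by (auto simp: half_strip_def)
  then show nz: "2 * cosh (complex_of_real pi * X) \<noteq> 0" by auto
  show "\<bar>Im (Ln (2 * cosh (complex_of_real pi * X)))\<bar> < pi / 2" using Re_Ln_pos_lt[OF nz] c by simp
  have "2 * cosh (complex_of_real pi * X) \<notin> \<real>\<^sub>\<le>\<^sub>0" using c by (auto simp: complex_nonpos_Reals_iff)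
  then show "((\<lambda>X::complex. Ln (2 * cosh (complex_of_real pi * X))) has_field_derivative
       pi * (sinh (complex_of_real pi * X) / cosh (complex_of_real pi * X))) (at X)"
    using nz by (auto intro!: derivative_eq_intros simp: field_simps)
qed

text \<open>Integrating \<open>lam0''\<close> leaves a constant, which the duplication identity
  \<open>2 lam0' (\<i> / 4) = lam0' 0\<close> (substitute \<open>u \<mapsto> 2 u\<close>) forces to vanish.\<close>

lemma lam0'_quarter: "2 * lam0' (\<i> / 4) = lam0' 0"
proof -
  have k: "lam0_kernel' (\<i> / 4) u = lam0_kernel' 0 (1/2 * u) / 4" if "u > 0" for u
  proof -
    have c: "cos (2 * complex_of_real u * (\<i> / 4)) = of_real (cosh (u / 2))"
    proof -
      have "2 * complex_of_real u * (\<i> / 4) = \<i> * of_real (u / 2)" by simp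
      then show ?thesis
        by (simp only: cosh_conv_cos[symmetric]) (simp add: cosh_field_def exp_of_real[symmetric])
    qed
    \<comment> \<open>The point i/4 is chosen because the cosine becomes cosh (u/2) there; it
      cancels one factor of this formula and leaves the kernel at X = 0 in the variable u/2.\<close>
    have "sinh u = 2 * sinh (u / 2) * cosh (u / 2)" using sinh_double[of "u / 2"] by simp
    moreover have "sinh (u / 2) > 0" "cosh (u / 2) > 0" using that by auto
    ultimately have "cosh (u / 2) / sinh u = 1 / (2 * sinh (u / 2))" by (simp add: field_simps)
    then have "complex_of_real (cosh (u / 2)) / of_real (sinh u) = of_real (1 / (2 * sinh (u / 2)))"
      by (metis of_real_divide)
    then show ?thesis unfolding lam0_kernel'_def c using that \<open>sinh (u / 2) > 0\<close>
      by (simp add: field_simps)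
  qed
  have "lam0' (\<i> / 4) = integral {0<..} (\<lambda>u. lam0_kernel' 0 (1/2 * u) / 4)"
    unfolding lam0'_def by (rule integral_cong) (use k in auto)
  also have "\<dots> = integral {0<..} (\<lambda>u. lam0_kernel' 0 (1/2 * u)) / 4"
    by simp
  also have "integral {0<..} (\<lambda>u. lam0_kernel' 0 (1/2 * u)) = integral {0<..} (lam0_kernel' 0) / of_real (1/2)"
    by (rule integral_halfline_scale[OF continuous_on_lam0_kernel(2) lam0_bound_integrable[of 0 0 0] lam0_kernel_bound(2)])
       auto
  finally show ?thesis by (simp add: lam0'_def mult.commute)
qed

lemma lam0'_eq:
  fixes X :: complex
  assumes "X \<in> half_strip"
  shows "lam0' X = - Ln (2 * cosh (pi * X))"
proof -
  define G where "G X = lam0' X + Ln (2 * cosh (pi * X))" for X :: complex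
  have der: "(G has_field_derivative 0) (at X)" if "X \<in> half_strip" for X :: complex
    using DERIV_add[OF has_field_derivative_lam0'_integral[OF that] two_cosh_half_strip(3)[OF that]]
    unfolding G_def by simp
  have "G constant_on half_strip"
    by (rule has_field_derivative_0_imp_constant_on[OF _ convex_connected[OF convex_half_strip] open_half_strip])
       (use der in auto)
  then obtain c where c: "\<And>x. x \<in> half_strip \<Longrightarrow> G x = c" by (auto simp: constant_on_def)
  have "c = lam0' 0 + Ln 2" using c[of 0] by (simp add: G_def half_strip_def)
  \<comment> \<open>As 2 cosh (i pi / 4) is the square root of 2, the logarithm at i/4 is half of
    the one at 0. With \<open>lam0'_quarter\<close> the two expressions for c combine to c = 2
    c.\<close>
  moreover have "c = lam0' (\<i> / 4) + Ln 2 / 2"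
  proof -
    have e: "cosh (pi * (\<i> / 4)) = of_real (sqrt 2 / 2)"
    proof -
      have "\<i> * (pi * (\<i> / 4)) = - of_real (pi / 4)" by (simp add: complex_eq_iff)
      then show ?thesis by (simp only: cosh_conv_cos cos_minus cos_of_real cos_45)
    qed
    have "Ln (of_real (sqrt 2)) = of_real (ln (sqrt 2))" by (rule Ln_of_real) simp
    also have "ln (sqrt 2) = ln 2 / 2" by (simp add: ln_sqrt)
    also have "complex_of_real (ln 2 / 2) = Ln 2 / 2" using Ln_of_real[of 2] by simp
    finally have "Ln (complex_of_real (sqrt 2)) = Ln 2 / 2" .
    moreover have "lam0' (\<i> / 4) + Ln (of_real (sqrt 2)) = c"
      using c[of "\<i> / 4"] unfolding G_def e by (simp add: half_strip_def)
    ultimately show ?thesis by (metis)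
  qed
  ultimately have "c = 0" using lam0'_quarter by (simp add: field_simps)
  then show ?thesis using c[OF assms] by (simp add: G_def add_eq_0_iff)
qed

lemma has_field_derivative_lam0:
  fixes X :: complex
  assumes "X \<in> half_strip"
  shows "(lam0 has_field_derivative - Ln (2 * cosh (pi * X))) (at X)"
  using has_field_derivative_lam0_integral[OF assms] lam0'_eq[OF assms] by simp

lemma minus_exp_in_Li2_domain:
  fixes X :: complex
  assumes "X \<in> half_strip"
  shows "- exp (2 * pi * X) \<in> Li2_domain"
proof (cases "Im X = 0")
  case True
  then show ?thesis by (intro Li2_domainI_Re) (auto simp: Re_exp intro: less_trans[of _ 0])
next
  case False
  have "sin (2 * pi * Im X) \<noteq> 0"
  proof
    assume "sin (2 * pi * Im X) = 0"
    then obtain i :: int where "2 * pi * Im X = of_int i * pi" using sin_zero_iff_int2 by blast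
    then have "Im X = of_int i / 2" by simp
    then have "\<bar>of_int i\<bar> < (1::real)" "i \<noteq> 0" using assms False by (auto simp: half_strip_def)
    then show False by linarith
  qed
  then show ?thesis by (intro Li2_domainI_Im) (simp add: Im_exp)
qed

lemma Ln_2_cosh_strip:
  fixes X :: complex
  assumes "X \<in> half_strip"
  shows "Ln (1 + exp (2 * pi * X)) = Ln (2 * cosh (pi * X)) + pi * X"
proof (rule Ln_unique)
  note c = two_cosh_half_strip[OF assms]
  have "exp (Ln (2 * cosh (pi * X)) + pi * X) = (2 * cosh (pi * X)) * exp (pi * X)"
    unfolding exp_add exp_Ln[OF c(1)] ..
  also have "\<dots> = 1 + exp (2 * pi * X)"
    by (simp add: cosh_field_def field_simps flip: exp_add)
  finally show "exp (Ln (2 * cosh (pi * X)) + pi * X) = 1 + exp (2 * pi * X)" .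
  note c(2)
  moreover have "\<bar>pi * Im X\<bar> < pi / 2" using assms by (simp add: half_strip_def abs_mult)
  ultimately show "- pi < Im (Ln (2 * cosh (pi * X)) + pi * X)" "Im (Ln (2 * cosh (pi * X)) + pi * X) \<le> pi"
    by simp_all
qed

lemma lam0_eq:
  fixes X :: complex
  assumes "X \<in> half_strip"
  shows "lam0 X = pi * X\<^sup>2 / 2 + Li2 (- exp (2 * pi * X)) / (2 * pi) + pi / 24"
proof -
  define G where "G X = lam0 X - (pi * X\<^sup>2 / 2 + Li2 (- exp (2 * pi * X)) / (2 * pi) + pi / 24)" for X :: complex
  have der: "(G has_field_derivative 0) (at X)" if "X \<in> half_strip" for X :: complex
  proof -
    have "((\<lambda>X. - exp (2 * pi * X)) has_field_derivative - (2 * pi * exp (2 * pi * X))) (at X)"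
      by (auto intro!: derivative_eq_intros)
    from has_field_derivative_Li2_compose[OF this minus_exp_in_Li2_domain[OF that]]
    have "((\<lambda>X. Li2 (- exp (2 * pi * X))) has_field_derivative - (2 * pi * (Ln (2 * cosh (pi * X)) + pi * X))) (at X)"
      unfolding Ln_2_cosh_strip[OF that, symmetric] by (simp add: mult.commute)
    then have "((\<lambda>X. pi * X\<^sup>2 / 2 + Li2 (- exp (2 * pi * X)) / (2 * pi) + pi / 24) has_field_derivative
        pi * X - (Ln (2 * cosh (pi * X)) + pi * X)) (at X)"
      by (auto intro!: derivative_eq_intros)
    from DERIV_diff[OF has_field_derivative_lam0[OF that] this]
    show ?thesis unfolding G_def by simp
  qed
  have "G constant_on half_strip"
    by (rule has_field_derivative_0_imp_constant_on[OF _ convex_connected[OF convex_half_strip] open_half_strip])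
       (use der in auto)
  then obtain c where c: "\<And>x. x \<in> half_strip \<Longrightarrow> G x = c" by (auto simp: constant_on_def)
  \<comment> \<open>The kernel vanishes identically at X = 0, so the additive constant must equal
    -Li2 (-1) / (2 pi), which is pi / 24.\<close>
  have "lam0 0 = 0" by (simp add: lam0_def lam0_kernel_def[abs_def])
  then have "c = 0" using c[of 0]
    by (simp add: G_def half_strip_def Li2_minus_one field_simps power2_eq_square)
  then show ?thesis using c[OF assms] by (simp add: G_def)
qed

text \<open>The kernel is odd in X. The dilogarithm in \<open>lam0_eq\<close> stays bounded as Re X
  tends to minus infinity, and oddness carries the formula over to the other end.\<close>

lemma lam0_uminus: "lam0 (- X) = - lam0 X"
proof -
  have "lam0_kernel (- X) = (\<lambda>u. - lam0_kernel X u)"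
    by (auto simp: lam0_kernel_def diff_divide_distrib)
  then show ?thesis by (simp add: lam0_def)
qed

text \<open>With h = b^2 this is exactly what is left of the exponent of \<open>sb\<close> once 1 /
  sinh (h u) is replaced by 1 / (h u); the splitting involves no approximation.\<close>

definition lamE_kernel :: "real \<Rightarrow> complex \<Rightarrow> real \<Rightarrow> complex" where
  "lamE_kernel h X u = sin (2 * of_real u * X) / of_real (2 * u * sinh u) * of_real (1 / sinh (h * u) - 1 / (h * u))"

definition lamE :: "real \<Rightarrow> complex \<Rightarrow> complex" where
  "lamE h X = integral {0<..} (lamE_kernel h X)"

lemma lamE_kernel_bound:
  assumes u: "u > 0" and h: "h > 0" and X: "\<bar>Im X\<bar> \<le> \<kappa>" "norm X \<le> M"
  shows "norm (lamE_kernel h X u) \<le> (h / 2 * M) * (u * exp (2 * \<kappa> * u) / sinh u)"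
proof -
  have s: "sinh u > 0" using u by simp
  have M0: "M \<ge> 0" using X norm_ge_zero order_trans by blast
  have "norm (sin (2 * of_real u * X)) \<le> 2 * u * norm X * exp (2 * \<kappa> * u)"
    by (rule norm_sin_strip_le[OF u X(1)])
  also have "\<dots> \<le> 2 * u * M * exp (2 * \<kappa> * u)"
    using u X(2) by (intro mult_right_mono mult_left_mono) auto
  finally have *: "norm (sin (2 * of_real u * X)) \<le> 2 * u * M * exp (2 * \<kappa> * u)" .
  have pos: "2 * u * sinh u > 0" using u s by simp
  have "norm (sin (2 * of_real u * X) / of_real (2 * u * sinh u)) \<le> 2 * u * M * exp (2 * \<kappa> * u) / (2 * u * sinh u)"
    unfolding norm_divide norm_of_real abs_of_pos[OF pos] using pos * by (intro divide_right_mono) auto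
  moreover have "norm (complex_of_real (1 / sinh (h * u) - 1 / (h * u))) \<le> h * u / 2"
    unfolding norm_of_real using inverse_minus_inverse_sinh[of "h * u"] u h by simp
  ultimately have "norm (lamE_kernel h X u) \<le> (2 * u * M * exp (2 * \<kappa> * u) / (2 * u * sinh u)) * (h * u / 2)"
    unfolding lamE_kernel_def norm_mult using u s M0 by (intro mult_mono) auto
  also have "\<dots> = (h / 2 * M) * (u * exp (2 * \<kappa> * u) / sinh u)"
    using u s by (simp add: field_simps)
  finally show ?thesis .
qed

lemma continuous_on_lamE_kernel: "h > 0 \<Longrightarrow> continuous_on {0<..} (lamE_kernel h X)"
  unfolding lamE_kernel_def by (intro continuous_intros) auto

text \<open>The constant depends on kappa alone: it is half the integral of u exp (2 kappa u) / sinh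
  u. The bound is of order h but grows with |X|, so along a horizontal line it has to be absorbed by
  the decay of the leading term.\<close>

lemma lamE_bound:
  assumes "\<kappa> < 1/2"
  obtains C where "C \<ge> 0" "\<And>h X. h > 0 \<Longrightarrow> \<bar>Im X\<bar> \<le> \<kappa> \<Longrightarrow> norm (lamE h X) \<le> C * h * norm X"
proof
  define C where "C = integral {0<..} (\<lambda>u. u * exp (2 * \<kappa> * u) / sinh u) / 2"
  show "C \<ge> 0" unfolding C_def using integrable_on_id_div_sinh[OF assms]
    by (intro divide_nonneg_pos integral_nonneg) auto
  fix h X assume h: "h > (0::real)" and X: "\<bar>Im X\<bar> \<le> \<kappa>"
  have int: "(\<lambda>u. (h / 2 * norm X) * (u * exp (2 * \<kappa> * u) / sinh u)) integrable_on {0<..}"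
    by (intro integrable_on_mult_right integrable_on_id_div_sinh assms)
  have bd: "norm (lamE_kernel h X u) \<le> (h / 2 * norm X) * (u * exp (2 * \<kappa> * u) / sinh u)" if "u > 0" for u
    by (rule lamE_kernel_bound[OF that h X order_refl])
  have "norm (lamE h X) \<le> integral {0<..} (\<lambda>u. (h / 2 * norm X) * (u * exp (2 * \<kappa> * u) / sinh u))"
    unfolding lamE_def
    by (rule integral_norm_bound_integral[OF integrable_on_continuous_bounded(1)[OF continuous_on_lamE_kernel[OF h] halfline_lebesgue int] int])
       (use bd in auto)
  also have "\<dots> = C * h * norm X" unfolding integral_mult_right C_def by simp
  finally show "norm (lamE h X) \<le> C * h * norm X" .
qed

text \<open>The contour is moved for the exact integrand, remainder included, so the remainder has
  to be holomorphic and not merely small.\<close>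

lemma lamE_holomorphic:
  assumes h: "h > 0"
  shows "lamE h holomorphic_on half_strip"
proof -
  define f' where "f' X u = cos (2 * of_real u * X) / of_real (sinh u) * complex_of_real (1 / sinh (h * u) - 1 / (h * u))" for X u
  have "((\<lambda>z. integral {0<..} (lamE_kernel h z)) has_field_derivative integral {0<..} (f' X)) (at X)"
    if X: "X \<in> half_strip" for X
  proof (rule has_field_derivative_half_strip_integral[where g="\<lambda>M \<kappa> u. (h / 2 * M) * (u * exp (2 * \<kappa> * u) / sinh u)"
        and g'="\<lambda>M \<kappa> u. h / 2 * (u * exp (2 * \<kappa> * u) / sinh u)", OF _ continuous_on_lamE_kernel[OF h] _ _ _ _ _ X])
    fix z and t :: real assume t: "t > 0"
    then show "((\<lambda>z. lamE_kernel h z t) has_field_derivative f' z t) (at z)"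
      unfolding lamE_kernel_def f'_def
      using h by (auto intro!: derivative_eq_intros simp: field_simps)
    fix M \<kappa> assume z: "\<bar>Im z\<bar> \<le> \<kappa>" and M: "norm z \<le> M"
    show "norm (lamE_kernel h z t) \<le> (h / 2 * M) * (t * exp (2 * \<kappa> * t) / sinh t)"
      by (rule lamE_kernel_bound[OF t h z M])
    have "\<bar>Im (2 * of_real t * z)\<bar> \<le> 2 * \<kappa> * t" using t z by (simp add: abs_mult mult.commute)
    then have "norm (cos (2 * of_real t * z)) \<le> exp (2 * \<kappa> * t)"
      by (intro order_trans[OF norm_cos_le_exp_Im]) simp
    moreover have "norm (complex_of_real (1 / sinh (h * t) - 1 / (h * t))) \<le> h * t / 2"
      unfolding norm_of_real using inverse_minus_inverse_sinh[of "h * t"] t h by simp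
    ultimately have "norm (cos (2 * of_real t * z)) / sinh t * norm (complex_of_real (1 / sinh (h * t) - 1 / (h * t)))
        \<le> exp (2 * \<kappa> * t) / sinh t * (h * t / 2)"
      using t by (intro mult_mono divide_right_mono) auto
    then show "norm (f' z t) \<le> h / 2 * (t * exp (2 * \<kappa> * t) / sinh t)"
      using t unfolding f'_def norm_mult norm_divide norm_of_real[of "sinh t"] by (simp add: mult_ac)
  next
    show "continuous_on (half_strip \<times> {0<..}) (\<lambda>(z, t). f' z t)"
      unfolding f'_def case_prod_beta using h by (intro continuous_intros) auto
  qed (intro integrable_on_mult_right integrable_on_id_div_sinh; assumption)+
  then show ?thesis unfolding lamE_def[abs_def]
    by (meson field_differentiable_def field_differentiable_at_within holomorphic_on_def)
qed

text \<open>An exact identity, obtained with u = y / b. It holds for every b > 0, since |Im X| < 1/2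
  puts X / b inside the strip |Im z| < Q/2.\<close>

lemma sb_eq_lam:
  assumes b: "b > 0" and X: "X \<in> half_strip"
  shows "sb b (X / of_real b) = exp (\<i> * (lam0 X / of_real (b\<^sup>2) + lamE (b\<^sup>2) X))"
proof -
  obtain d \<kappa> where k: "d > 0" "\<kappa> < 1/2" "\<And>w. w \<in> cball X d \<Longrightarrow> \<bar>Im w\<bar> \<le> \<kappa>"
    by (rule half_strip_neighbourhood[OF X]) auto
  have Xk: "\<bar>Im X\<bar> \<le> \<kappa>" using k by auto
  define h where "h = b\<^sup>2"
  have h: "h > 0" using b by (simp add: h_def)
  define g where "g u = lam0_bound 1 (norm X) \<kappa> u / h + (h / 2 * norm X) * (u * exp (2 * \<kappa> * u) / sinh u)" for u
  have g1: "lam0_bound 1 (norm X) \<kappa> integrable_on {0<..}"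
    by (rule lam0_bound_integrable[OF k(2)])
  have g2: "(\<lambda>u. (h / 2 * norm X) * (u * exp (2 * \<kappa> * u) / sinh u)) integrable_on {0<..}"
    by (intro integrable_on_mult_right integrable_on_id_div_sinh k)
  have gint: "g integrable_on {0<..}"
    unfolding g_def by (intro integrable_add integrable_on_divide g1 g2)
  have i1: "lam0_kernel X integrable_on {0<..}"
    by (rule integrable_on_continuous_bounded(1)[OF continuous_on_lam0_kernel(1) halfline_lebesgue g1])
       (use lam0_kernel_bound(1) Xk in auto)
  have i2: "lamE_kernel h X integrable_on {0<..}"
    by (rule integrable_on_continuous_bounded(1)[OF continuous_on_lamE_kernel[OF h] halfline_lebesgue g2])
       (use lamE_kernel_bound Xk h in auto)
  define F where "F u = lam0_kernel X u / of_real h + lamE_kernel h X u" for u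
  have Fg: "norm (F u) \<le> g u" if "u > 0" for u
  proof -
    have "norm (lam0_kernel X u / of_real h) \<le> lam0_bound 1 (norm X) \<kappa> u / h"
      using lam0_kernel_bound(1)[OF that Xk order_refl] h by (simp add: norm_divide divide_right_mono)
    with lamE_kernel_bound[OF that h Xk order_refl] show ?thesis
      unfolding F_def g_def by (intro norm_triangle_mono)
  qed
  have Fc: "continuous_on {0<..} F"
    unfolding F_def using h by (intro continuous_intros continuous_on_lam0_kernel continuous_on_lamE_kernel) auto
  have "(sin (2 * of_real y * (X / of_real b)) / of_real (2 * sinh (y / b) * sinh (b * y))
                 - (X / of_real b) / of_real y) / of_real y = F (1 / b * y) / of_real b" if y: "y > 0" for y
  proof -
    define u where "u = y / b"
    have u: "u > 0" "y = b * u" "b * y = h * u" using b y by (auto simp: u_def h_def power2_eq_square)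
    define S1 where "S1 = complex_of_real (sinh u)"
    define S2 where "S2 = complex_of_real (sinh (h * u))"
    define A where "A = sin (2 * of_real u * X)"
    define U where "U = complex_of_real u"
    define B where "B = complex_of_real b"
    have nz: "S1 \<noteq> 0" "S2 \<noteq> 0" "U \<noteq> 0" "B \<noteq> 0" using u h b by (auto simp: S1_def S2_def U_def B_def)
    have f1: "2 * of_real y * (X / of_real b) = 2 * of_real u * X" using b u by simp
    have "F u / B = ((A / (2 * U * S1) - X / U) / U / B\<^sup>2 + A / (2 * U * S1) * (1 / S2 - 1 / (B\<^sup>2 * U))) / B"
      by (simp add: F_def lam0_kernel_def lamE_kernel_def S1_def S2_def A_def U_def B_def h_def)
    also have "\<dots> = (A / (2 * S1 * S2) - X / B / (B * U)) / (B * U)"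
      using nz by (simp add: field_simps power2_eq_square)
    also have "\<dots> = (sin (2 * of_real y * (X / of_real b)) / of_real (2 * sinh (y / b) * sinh (b * y))
                 - (X / of_real b) / of_real y) / of_real y"
      unfolding f1 u(3) by (simp add: S1_def S2_def A_def U_def B_def u_def[symmetric] u(2))
    finally show ?thesis using u(2) b by (simp add: B_def)
  qed
  then have "integral {0<..} (\<lambda>y. (sin (2 * of_real y * (X / of_real b)) / of_real (2 * sinh (y / b) * sinh (b * y))
                 - (X / of_real b) / of_real y) / of_real y) = integral {0<..} (\<lambda>y. F (1 / b * y) / of_real b)"
    by (intro integral_cong) auto
  also have "\<dots> = integral {0<..} (\<lambda>y. F (1 / b * y)) / of_real b" by simp
  also have "integral {0<..} (\<lambda>y. F (1 / b * y)) = integral {0<..} F / of_real (1 / b)"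
    by (rule integral_halfline_scale[OF Fc gint Fg]) (use b in auto)
  also have "integral {0<..} F / of_real (1 / b) / of_real b = integral {0<..} F"
    using b by simp
  also have "integral {0<..} F = lam0 X / of_real h + lamE h X"
    unfolding F_def lam0_def lamE_def
    by (subst integral_add) (use i1 i2 in \<open>auto intro!: integrable_on_divide\<close>)
  finally show ?thesis unfolding sb_def h_def by simp
qed

section \<open>Integrals over horizontal lines and Laplace's method\<close>

lemma integrable_lborel_exp_minus_abs:
  assumes "c > 0"
  shows "integrable lborel (\<lambda>t::real. exp (- c * \<bar>t\<bar>))"
proof -
  have "set_integrable lborel {0..} (\<lambda>t::real. exp (- c * \<bar>t\<bar>))"
    by (rule integrable_lborel_continuous_bounded[OF _ _ integrable_on_exp_minus_to_infinity[OF assms, of 0]])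
       (auto intro!: continuous_intros)
  then have "has_bochner_integral lborel (\<lambda>x. indicator {0..} x *\<^sub>R exp (- c * \<bar>x\<bar>))
       (integral\<^sup>L lborel (\<lambda>x. indicator {0..} x *\<^sub>R exp (- c * \<bar>x\<bar>)))"
    by (simp add: set_integrable_def has_bochner_integral_integrable)
  from has_bochner_integral_even_function[OF this] show ?thesis
    by (simp add: has_bochner_integral_iff)
qed

lemma integrable_on_exp_minus_abs:
  assumes "c > 0"
  shows "(\<lambda>t::real. exp (- c * \<bar>t\<bar>)) integrable_on UNIV"
  using integrable_lborel_exp_minus_abs[OF assms] integrable_on_lborel by blast

lemma integrable_line:
  fixes f :: "real \<Rightarrow> complex"
  assumes "continuous_on UNIV f" "g integrable_on UNIV" "\<And>t. norm (f t) \<le> g t"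
  shows "integrable lborel f" "f integrable_on UNIV"
  using integrable_lborel_continuous_bounded[OF assms(1) _ assms(2,3)]
  by (auto simp: set_integrable_def integrable_on_lborel)

lemma UN_symmetric_intervals: "(UNIV :: real set) = (\<Union>n. {- real n..real n})"
proof (intro equalityI subsetI)
  fix x :: real
  obtain n where "\<bar>x\<bar> \<le> real n" using real_arch_simple by blast
  then show "x \<in> (\<Union>n. {- real n..real n})" by (intro UN_I[of n]) auto
qed auto

lemma incseq_symmetric_intervals: "incseq (\<lambda>n. {- real n..real n})"
  by (auto simp: incseq_def)

lemma exponential_decay_extend:
  fixes f :: "real \<Rightarrow> complex"
  assumes "continuous_on UNIV f" "\<And>t. \<bar>t\<bar> \<ge> M \<Longrightarrow> norm (f t) \<le> C * exp (- c * \<bar>t\<bar>)"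
  obtains K where "\<And>t. norm (f t) \<le> K * exp (- c * \<bar>t\<bar>)"
proof -
  have "compact ((\<lambda>t. f t * of_real (exp (c * \<bar>t\<bar>))) ` {-M..M})"
    by (intro compact_continuous_image continuous_intros continuous_on_subset[OF assms(1)]) auto
  then obtain B where B: "\<And>t. t \<in> {-M..M} \<Longrightarrow> norm (f t * of_real (exp (c * \<bar>t\<bar>))) \<le> B"
    by (meson bounded_iff compact_imp_bounded image_eqI)
  have "norm (f t) \<le> max B C * exp (- c * \<bar>t\<bar>)" for t
  proof (cases "\<bar>t\<bar> \<ge> M")
    case True
    have "C * exp (- c * \<bar>t\<bar>) \<le> max B C * exp (- c * \<bar>t\<bar>)" by (intro mult_right_mono) auto
    with assms(2)[OF True] show ?thesis by linarith
  next
    case False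
    then have "norm (f t * of_real (exp (c * \<bar>t\<bar>))) \<le> B" by (intro B) auto
    then have "norm (f t) \<le> B * exp (- c * \<bar>t\<bar>)"
      by (simp add: norm_mult exp_minus field_simps)
    also have "\<dots> \<le> max B C * exp (- c * \<bar>t\<bar>)" by (intro mult_right_mono) auto
    finally show ?thesis .
  qed
  then show thesis by (rule that)
qed

text \<open>On a convex set the integrand has a primitive \<open>P\<close>, so the difference of two
  truncated horizontal integrals equals the difference of the increments of \<open>P\<close> along
  the vertical segments at Re z = n and Re z = -n. These have fixed length and an exponentially
  small integrand.\<close>

lemma integral_horizontal_line_shift:
  fixes F :: "complex \<Rightarrow> complex"
  assumes F: "F holomorphic_on S" "open S" "convex S"
    and sub: "\<And>z. Im z \<in> closed_segment y1 y2 \<Longrightarrow> z \<in> S"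
    and decay: "\<And>z. Im z \<in> closed_segment y1 y2 \<Longrightarrow> \<bar>Re z\<bar> \<ge> M \<Longrightarrow> norm (F z) \<le> C * exp (- c * \<bar>Re z\<bar>)"
    and c: "c > 0"
  shows "integrable lborel (\<lambda>t. F (Complex t y1))"
    and "integral UNIV (\<lambda>t. F (Complex t y1)) = integral UNIV (\<lambda>t. F (Complex t y2))"
proof -
  have Cx: "Complex t y = of_real t + \<i> * of_real y" for t y by (simp add: complex_eq_iff)
  have lim: "integrable lborel (\<lambda>t. F (Complex t y)) \<and>
      (\<lambda>n. integral {- real n..real n} (\<lambda>t. F (Complex t y))) \<longlonglongrightarrow> integral UNIV (\<lambda>t. F (Complex t y))"
    if y: "y \<in> closed_segment y1 y2" for y
  proof -
    have cont: "continuous_on UNIV (\<lambda>t. F (Complex t y))"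
      unfolding Cx
      by (rule continuous_on_compose2[OF holomorphic_on_imp_continuous_on[OF F(1)]])
         (auto intro!: continuous_intros sub simp: y)
    obtain K where K: "\<And>t. norm (F (Complex t y)) \<le> K * exp (- c * \<bar>t\<bar>)"
      by (rule exponential_decay_extend[OF cont, of M C c]) (use decay[of "Complex _ y"] y in auto)
    have g: "(\<lambda>t. K * exp (- c * \<bar>t\<bar>)) integrable_on UNIV"
      by (intro integrable_on_mult_right integrable_on_exp_minus_abs c)
    note int = integrable_line[OF cont g K]
    show ?thesis
      using int(1) integral_exhaustion_tendsto[OF incseq_symmetric_intervals UN_symmetric_intervals int(2) g K] by blast
  qed
  then show "integrable lborel (\<lambda>t. F (Complex t y1))" by simp
  obtain P where P0: "\<And>x. x \<in> S \<Longrightarrow> (P has_field_derivative F x) (at x within S)"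
    by (rule holomorphic_convex_primitive'[OF F(3,2,1)]) blast
  then have P: "(P has_field_derivative F x) (at x)" if "x \<in> S" for x
    using that F(2) by (metis at_within_open)
  have int: "integral {- real n..real n} (\<lambda>t. F (Complex t y)) = P (Complex (real n) y) - P (Complex (- real n) y)"
    if y: "y \<in> closed_segment y1 y2" for y and n :: nat
  proof (rule integral_unique, rule fundamental_theorem_of_calculus)
    fix x :: real
    have "((\<lambda>w. P (w + \<i> * of_real y)) has_field_derivative F (of_real x + \<i> * of_real y)) (at (of_real x))"
      using P[OF sub, of "of_real x + \<i> * of_real y"] y by (simp add: DERIV_shift)
    then show "((\<lambda>t. P (Complex t y)) has_vector_derivative F (Complex x y)) (at x within {- real n..real n})"
      unfolding Cx by (rule has_vector_derivative_real_field)
  qed auto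
  have vert: "norm (P (Complex r y1) - P (Complex r y2)) \<le> C * exp (- c * \<bar>r\<bar>) * \<bar>y1 - y2\<bar>" if r: "\<bar>r\<bar> \<ge> M" for r
  proof -
    have seg: "Re z = r \<and> Im z \<in> closed_segment y1 y2" if "z \<in> closed_segment (Complex r y1) (Complex r y2)" for z
    proof -
      from that have "\<exists>u. 0 \<le> u \<and> u \<le> 1 \<and> z = (1 - u) *\<^sub>R Complex r y1 + u *\<^sub>R Complex r y2"
        by (simp only: in_segment(1))
      then obtain u where u: "0 \<le> u" "u \<le> 1" "z = (1 - u) *\<^sub>R Complex r y1 + u *\<^sub>R Complex r y2"
        by (elim exE conjE)
      have "Re z = r" "Im z = (1 - u) *\<^sub>R y1 + u *\<^sub>R y2"
        unfolding u(3) by (simp_all add: left_diff_distrib)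
      then show ?thesis using u(1,2) by (auto simp only: in_segment(1))
    qed
    have "norm (P (Complex r y1) - P (Complex r y2)) \<le> C * exp (- c * \<bar>r\<bar>) * norm (Complex r y1 - Complex r y2)"
    proof (rule field_differentiable_bound[OF convex_closed_segment])
      fix z assume "z \<in> closed_segment (Complex r y1) (Complex r y2)"
      note z = seg[OF this]
      show "(P has_field_derivative F z) (at z within closed_segment (Complex r y1) (Complex r y2))"
        by (rule has_field_derivative_at_within[OF P[OF sub]]) (use z in simp)
      show "norm (F z) \<le> C * exp (- c * \<bar>r\<bar>)" using decay[of z] z r by simp
    qed auto
    also have "Complex r y1 - Complex r y2 = \<i> * of_real (y1 - y2)" by (simp add: complex_eq_iff)
    finally show ?thesis by (simp only: norm_mult norm_ii norm_of_real mult_1)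
  qed
  define d where "d n = integral {- real n..real n} (\<lambda>t. F (Complex t y1)) - integral {- real n..real n} (\<lambda>t. F (Complex t y2))" for n
  have "d \<longlonglongrightarrow> integral UNIV (\<lambda>t. F (Complex t y1)) - integral UNIV (\<lambda>t. F (Complex t y2))"
    unfolding d_def using lim by (intro tendsto_diff) auto
  moreover have "d \<longlonglongrightarrow> 0"
  proof (rule Lim_null_comparison)
    show "\<forall>\<^sub>F n in sequentially. norm (d n) \<le> 2 * (C * exp (- c * real n) * \<bar>y1 - y2\<bar>)"
    proof -
      have "\<forall>\<^sub>F n in sequentially. M \<le> real n"
        using filterlim_real_sequentially unfolding filterlim_at_top by blast
      then show ?thesis
      proof eventually_elim
        case (elim n)
        have "d n = (P (Complex (real n) y1) - P (Complex (real n) y2)) - (P (Complex (- real n) y1) - P (Complex (- real n) y2))"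
          unfolding d_def by (subst (1 2) int) auto
        then show ?case
          using vert[of "real n"] vert[of "- real n"] elim
            norm_triangle_ineq4[of "P (Complex (real n) y1) - P (Complex (real n) y2)" "P (Complex (- real n) y1) - P (Complex (- real n) y2)"]
          by simp
      qed
    qed
    have "(\<lambda>n. exp (- c) ^ n) \<longlonglongrightarrow> 0" using c by (intro LIMSEQ_power_zero) auto
    then have "(\<lambda>n. exp (- c * real n)) \<longlonglongrightarrow> 0"
      by (simp add: exp_of_nat_mult[symmetric] mult_ac)
    then have "(\<lambda>n. 2 * (C * exp (- c * real n) * \<bar>y1 - y2\<bar>)) \<longlonglongrightarrow> 2 * (C * 0 * \<bar>y1 - y2\<bar>)"
      by (intro tendsto_intros)
    then show "(\<lambda>n. 2 * (C * exp (- c * real n) * \<bar>y1 - y2\<bar>)) \<longlonglongrightarrow> 0" by simp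
  qed
  ultimately show "integral UNIV (\<lambda>t. F (Complex t y1)) = integral UNIV (\<lambda>t. F (Complex t y2))"
    using LIMSEQ_unique by fastforce
qed

section \<open>Gaussian integrals and the Laplace estimate\<close>

lemma exp_minus_square_le: "r \<ge> 0 \<Longrightarrow> exp (- r * t\<^sup>2) \<le> exp r * exp (- r * \<bar>t\<bar>)" for r t :: real
proof -
  assume r: "r \<ge> 0"
  have "\<bar>t\<bar> \<le> t\<^sup>2 + 1"
    using zero_le_power2[of "\<bar>t\<bar> - 1"] by (simp add: power2_eq_square algebra_simps)
  then have "r * \<bar>t\<bar> \<le> r * (t\<^sup>2 + 1)" using r by (intro mult_left_mono)
  then show ?thesis by (simp add: algebra_simps flip: exp_add)
qed

text \<open>The integral times csqrt a is holomorphic for Re a > 0, and on the positive reals its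
  value is the normalization of the normal density; the identity theorem carries this to the
  half-plane and fixes the branch of the root.\<close>

lemma gaussian_integral_complex:
  assumes a: "Re a > 0"
  shows "integral UNIV (\<lambda>t::real. exp (- a * of_real (t\<^sup>2))) = of_real (sqrt pi) / csqrt a"
    and "(\<lambda>t::real. exp (- a * of_real (t\<^sup>2))) integrable_on UNIV"
proof -
  define H where "H = {a. Re a > 0}"
  define f where "f a t = exp (- a * of_real (t\<^sup>2))" for a :: complex and t :: real
  define G where "G a = integral UNIV (f a)" for a
  have dom: "norm (f a t) \<le> exp r * exp (- r * \<bar>t\<bar>)" if "Re a \<ge> r" "r > 0" for a r t
  proof -
    have "norm (f a t) = exp (- Re a * t\<^sup>2)" by (simp add: f_def)
    also have "\<dots> \<le> exp (- r * t\<^sup>2)" using that by (simp add: mult_right_mono)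
    also have "\<dots> \<le> exp r * exp (- r * \<bar>t\<bar>)" using that by (intro exp_minus_square_le) auto
    finally show ?thesis .
  qed
  have g: "(\<lambda>t. exp r * exp (- r * \<bar>t\<bar>)) integrable_on UNIV" if "r > 0" for r :: real
    by (intro integrable_on_mult_right integrable_on_exp_minus_abs that)
  have cf: "continuous_on UNIV (f a)" for a unfolding f_def by (intro continuous_intros)
  have int: "f a integrable_on UNIV" if "Re a > 0" for a
    by (rule integrable_line(2)[OF cf g[OF that] dom]) (use that in auto)
  from int[OF a] show "(\<lambda>t::real. exp (- a * of_real (t\<^sup>2))) integrable_on UNIV" by (simp add: f_def[abs_def])
  have opH: "open H" unfolding H_def by (rule open_halfspace_Re_gt)
  have convH: "convex H" unfolding H_def by (rule convex_halfspace_Re_gt)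
  have "\<exists>D. (G has_field_derivative D) (at a)" if aH: "a \<in> H" for a
  proof -
    obtain D where "((\<lambda>z. integral UNIV (f z)) has_field_derivative D) (at a)"
    proof (rule has_field_derivative_parametric_integral[OF incseq_symmetric_intervals UN_symmetric_intervals opH _ _ _ _ aH, of f "\<lambda>a t. - of_real (t\<^sup>2) * exp (- a * of_real (t\<^sup>2))"])
      fix z :: complex and t :: real
      show "((\<lambda>z. f z t) has_field_derivative - of_real (t\<^sup>2) * exp (- z * of_real (t\<^sup>2))) (at z)"
        unfolding f_def by (auto intro!: derivative_eq_intros)
    next
      show "continuous_on (H \<times> UNIV) (\<lambda>(z, t). - of_real (t\<^sup>2) * exp (- z * of_real (t\<^sup>2)))"
        unfolding case_prod_beta by (intro continuous_intros)
    next
      fix z assume "z \<in> H"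
      then have z: "Re z > 0" by (simp add: H_def)
      have *: "Re w \<ge> Re z / 2" if "w \<in> cball z (Re z / 2)" for w
        using that abs_Re_le_cmod[of "z - w"] by (simp add: dist_norm)
      show "\<exists>d g. 0 < d \<and> cball z d \<subseteq> H \<and> g integrable_on UNIV \<and> (\<forall>w\<in>cball z d. \<forall>t\<in>UNIV. norm (f w t) \<le> g t)"
        by (rule exI[of _ "Re z / 2"], rule exI[of _ "\<lambda>t. exp (Re z / 2) * exp (- (Re z / 2) * \<bar>t\<bar>)"])
           (use z * g[of "Re z / 2"] dom[of "Re z / 2"] in \<open>force simp: H_def\<close>)
    qed (use cf in auto)
    then show ?thesis unfolding G_def[abs_def] by blast
  qed
  then have holG: "G holomorphic_on H"
    by (meson field_differentiable_def field_differentiable_at_within holomorphic_on_def)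
  have hol: "(\<lambda>a. G a * csqrt a - of_real (sqrt pi)) holomorphic_on H"
    by (intro holomorphic_intros holG) (auto simp: H_def complex_nonpos_Reals_iff)
  have real: "G (of_real r) * csqrt (of_real r) - of_real (sqrt pi) = 0" if r: "r > 0" for r
  proof -
    \<comment> \<open>The standard deviation for which t^2 / (2 s^2) = r t^2.\<close>
    define s where "s = sqrt (1 / (2 * r))"
    have s: "s > 0" "2 * s\<^sup>2 = 1 / r" using r by (auto simp: s_def)
    have nd: "normal_density 0 s t = sqrt (r / pi) * exp (- r * t\<^sup>2)" for t
    proof -
      have "2 * pi * s\<^sup>2 = pi / r" using s by (simp add: field_simps)
      moreover have "- (t - 0)\<^sup>2 / (2 * s\<^sup>2) = - r * t\<^sup>2" unfolding s(2) using r by simp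
      ultimately show ?thesis unfolding normal_density_def by (simp add: real_sqrt_divide)
    qed
    have "((\<lambda>t. sqrt (r / pi) * exp (- r * t\<^sup>2)) has_integral 1) UNIV"
      using has_integral_integral_lborel[OF integrable_normal_density[OF s(1), of 0]] integral_normal_density[OF s(1), of 0]
      unfolding nd by simp
    then have "((\<lambda>t. sqrt (pi / r) * (sqrt (r / pi) * exp (- r * t\<^sup>2))) has_integral sqrt (pi / r) * 1) UNIV"
      by (rule has_integral_mult_right)
    moreover have "sqrt (pi / r) * (sqrt (r / pi) * x) = x" for x
      using r by (simp add: real_sqrt_divide)
    ultimately have "((\<lambda>t. exp (- r * t\<^sup>2)) has_integral sqrt (pi / r)) UNIV" by simp
    then have "((\<lambda>t. complex_of_real (exp (- r * t\<^sup>2))) has_integral of_real (sqrt (pi / r))) UNIV"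
      by (rule has_integral_of_real)
    moreover have "(\<lambda>t. complex_of_real (exp (- r * t\<^sup>2))) = f (of_real r)"
      by (auto simp: f_def exp_of_real[symmetric])
    ultimately have "G (of_real r) = of_real (sqrt (pi / r))"
      unfolding G_def by (simp add: integral_unique)
    moreover have "csqrt (of_real r) = of_real (sqrt r)" using r by (simp add: csqrt_of_real_nonneg)
    ultimately show ?thesis using r by (simp add: real_sqrt_divide)
  qed
  have "G a * csqrt a - of_real (sqrt pi) = 0"
  proof (rule analytic_continuation[OF hol opH convex_connected[OF convH], of "of_real ` {0<..}" 1 a])
    show "1 islimpt complex_of_real ` {0<..}"
    proof (rule islimptI)
      fix T :: "complex set" assume "1 \<in> T" "open T"
      then obtain e where e: "e > 0" "ball 1 e \<subseteq> T" by (meson openE)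
      have "dist 1 (complex_of_real (1 + e / 2)) < e"
        using e by (simp add: dist_norm norm_divide)
      then have "of_real (1 + e / 2) \<in> T" using e by (auto simp del: of_real_add)
      then show "\<exists>y\<in>complex_of_real ` {0<..}. y \<in> T \<and> y \<noteq> 1"
        using e by (intro bexI[of _ "of_real (1 + e / 2)"]) (auto simp del: of_real_add simp: of_real_eq_1_iff)
    qed
  qed (use real a in \<open>auto simp: H_def\<close>)
  moreover have "csqrt a \<noteq> 0" using a by auto
  ultimately have "G a = of_real (sqrt pi) / csqrt a" by (simp add: field_simps)
  then show "integral UNIV (\<lambda>t::real. exp (- a * of_real (t\<^sup>2))) = of_real (sqrt pi) / csqrt a"
    by (simp add: G_def f_def[abs_def])
qed

lemma norm_exp_diff_le:
  fixes u v :: complex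
  assumes "Re u \<le> m" "Re v \<le> m"
  shows "norm (exp u - exp v) \<le> exp m * norm (u - v)"
  by (rule field_differentiable_bound[OF convex_halfspace_Re_le[of m], where f'=exp])
     (use assms in \<open>auto intro: DERIV_exp has_field_derivative_at_within\<close>)

text \<open>The constant c is half the minimum of -f'' on [-1, 1], attained by compactness; this
  gives the quadratic bound there. Beyond, the graph lies below its tangents at 1 and -1, whose
  slopes are at most -c and at least c because f drops by at least c between 0 and these
  points.\<close>

lemma strictly_concave_decay:
  fixes f f' f'' :: "real \<Rightarrow> real"
  assumes f': "\<And>t. (f has_real_derivative f' t) (at t)" and f'': "\<And>t. (f' has_real_derivative f'' t) (at t)"
    and cont: "continuous_on {-1..1} f''" and neg: "\<And>t. f'' t < 0" and "f 0 = 0" "f' 0 = 0"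
  obtains c where "c > 0" "\<And>t. \<bar>t\<bar> \<le> 1 \<Longrightarrow> f t \<le> - c * t\<^sup>2" "\<And>t. \<bar>t\<bar> \<ge> 1 \<Longrightarrow> f t \<le> - c * \<bar>t\<bar>"
proof -
  have "\<exists>x\<in>{-1..1}. \<forall>y\<in>{-1..1}. f'' y \<le> f'' x"
    by (rule continuous_attains_sup) (use cont in auto)
  then obtain x where "\<forall>y\<in>{-1..1}. f'' y \<le> f'' x" by blast
  then have x: "f'' y \<le> f'' x" if "\<bar>y\<bar> \<le> 1" for y
  proof -
    have "y \<in> {-1..1}" using that by (simp add: abs_le_iff)
    with \<open>\<forall>y\<in>{-1..1}. f'' y \<le> f'' x\<close> show ?thesis by blast
  qed
  define c where "c = - f'' x / 2"
  have c: "c > 0" using neg[of x] by (simp add: c_def)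
  have q: "f t \<le> - c * t\<^sup>2" if "\<bar>t\<bar> \<le> 1" for t
  proof -
    have "- (f' 0 + 2 * c * 0) * (t - 0) \<le> - (f t + c * t\<^sup>2) - - (f 0 + c * 0\<^sup>2)"
    proof (rule f''_imp_f'[of "{-1..1}" "\<lambda>t. - (f t + c * t\<^sup>2)" "\<lambda>t. - (f' t + 2 * c * t)" "\<lambda>t. - (f'' t + 2 * c)"])
      fix t :: real assume "t \<in> {-1..1}"
      show "((\<lambda>t. - (f t + c * t\<^sup>2)) has_real_derivative - (f' t + 2 * c * t)) (at t)"
        by (auto intro!: derivative_eq_intros f')
      show "((\<lambda>t. - (f' t + 2 * c * t)) has_real_derivative - (f'' t + 2 * c)) (at t)"
        by (auto intro!: derivative_eq_intros f'')
      show "- (f'' t + 2 * c) \<ge> 0" using x[of t] \<open>t \<in> {-1..1}\<close> by (simp add: c_def abs_le_iff)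
    qed (use that in auto)
    then show ?thesis using assms by simp
  qed
  have tangent: "f y \<le> f x + f' x * (y - x)" for x y
  proof -
    have "- f' x * (y - x) \<le> - f y - - f x"
      by (rule f''_imp_f'[of UNIV "\<lambda>t. - f t" "\<lambda>t. - f' t" "\<lambda>t. - f'' t"])
         (use neg in \<open>auto intro!: derivative_eq_intros f' f'' less_imp_le\<close>)
    then show ?thesis by simp
  qed
  have "f t \<le> - c * \<bar>t\<bar>" if "\<bar>t\<bar> \<ge> 1" for t
  proof (cases "t \<ge> 0")
    case True
    have "f' 1 \<le> - c" using tangent[of 0 1] q[of 1] assms by simp
    then have "f' 1 * (t - 1) \<le> - c * (t - 1)" using True that by (intro mult_right_mono) auto
    then show ?thesis using tangent[of t 1] q[of 1] True by (simp add: algebra_simps)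
  next
    case False
    have "c \<le> f' (-1)" using tangent[of 0 "-1"] q[of "-1"] assms by simp
    then have "f' (-1) * (t + 1) \<le> c * (t + 1)" using False that by (intro mult_right_mono_neg) auto
    then show ?thesis using tangent[of t "-1"] q[of "-1"] False by (simp add: algebra_simps)
  qed
  with c q show thesis by (rule that)
qed

text \<open>The line is split at b |t| = 1. Inside, the cubic Taylor error and the perturbation are
  of order b (1 + |t|^3) after rescaling, and the mean value inequality for exp applies with a
  Gaussian majorant. Outside, the two exponentials are estimated separately: each is O(exp (-c
  |t|)), and a factor b (1 + |t|^3) >= 1 may be inserted since b |t| >= 1.\<close>

lemma laplace_pointwise_bound:
  fixes \<phi> :: "real \<Rightarrow> complex" and \<zeta> :: "real \<Rightarrow> real \<Rightarrow> complex"
  assumes c: "c > 0" "Re a \<ge> c" and C: "C \<ge> 0" "C1 \<ge> 0"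
    and cubic: "\<And>t. \<bar>t\<bar> \<le> 1 \<Longrightarrow> norm (\<phi> t + a * of_real (t\<^sup>2)) \<le> C * \<bar>t\<bar> ^ 3"
    and near: "\<And>t. \<bar>t\<bar> \<le> 1 \<Longrightarrow> Re (\<phi> t) \<le> - c * t\<^sup>2"
    and far: "\<And>t. \<bar>t\<bar> \<ge> 1 \<Longrightarrow> Re (\<phi> t) \<le> - c * \<bar>t\<bar>"
    and b: "0 < b" "b \<le> 1/2" "C1 * b \<le> c"
    and \<zeta>: "\<And>t. norm (\<zeta> b t) \<le> C1 * (\<bar>t\<bar> + b)"
  shows "norm (exp (\<phi> (b * t) / of_real (b\<^sup>2) + \<zeta> b (b * t)) - exp (- a * of_real (t\<^sup>2)))
    \<le> b * (((C + 2 * C1) * exp (2 * C1 + c) + exp C1 + exp c) * ((1 + \<bar>t\<bar> ^ 3) * exp (- c * \<bar>t\<bar>)))"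
proof -
  define u where "u = \<phi> (b * t) / of_real (b\<^sup>2) + \<zeta> b (b * t)"
  define v where "v = - a * of_real (t\<^sup>2)"
  define E where "E = (1 + \<bar>t\<bar> ^ 3) * exp (- c * \<bar>t\<bar>)"
  have E0: "E \<ge> 0" by (simp add: E_def)
  have tt: "\<bar>t\<bar> \<le> 1 + \<bar>t\<bar> ^ 3"
  proof (cases "\<bar>t\<bar> \<le> 1")
    case False
    then have "\<bar>t\<bar> * 1 \<le> \<bar>t\<bar> * \<bar>t\<bar>\<^sup>2" by (intro mult_left_mono one_le_power) auto
    then show ?thesis by (simp add: power3_eq_cube power2_eq_square)
  qed (auto intro: order_trans)
  have Rev: "Re v \<le> - c * t\<^sup>2" using c by (simp add: v_def mult_right_mono)
  have bt: "\<bar>b * t\<bar> = b * \<bar>t\<bar>" using b by (simp add: abs_mult)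
  have Reu: "Re u = Re (\<phi> (b * t)) / b\<^sup>2 + Re (\<zeta> b (b * t))"
    by (simp add: u_def Re_divide_of_real)
  have Rez: "Re (\<zeta> b (b * t)) \<le> C1 * (b * \<bar>t\<bar> + b)"
    using \<zeta>[of "b * t"] complex_Re_le_cmod[of "\<zeta> b (b * t)"] bt by simp
  show ?thesis
  proof (cases "b * \<bar>t\<bar> \<le> 1")
    case True
    have "Re (\<phi> (b * t)) \<le> - c * (b * t)\<^sup>2" using near[of "b * t"] True bt by simp
    then have "Re (\<phi> (b * t)) / b\<^sup>2 \<le> - c * (b * t)\<^sup>2 / b\<^sup>2" using b by (intro divide_right_mono) auto
    also have "\<dots> = - c * t\<^sup>2" using b by (simp add: power_mult_distrib)
    finally have R1: "Re (\<phi> (b * t)) / b\<^sup>2 \<le> - c * t\<^sup>2" .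
    \<comment> \<open>Here b |t| and b are at most 1, so the perturbation costs at most the constant
      factor exp (2 C1).\<close>
    have "C1 * (b * \<bar>t\<bar> + b) \<le> C1 * 2" using C True b by (intro mult_left_mono) auto
    then have R2: "Re u \<le> - c * t\<^sup>2 + 2 * C1" using R1 Rez Reu by simp
    have "u - v = (\<phi> (b * t) + a * of_real ((b * t)\<^sup>2)) / of_real (b\<^sup>2) + \<zeta> b (b * t)"
      using b by (simp add: u_def v_def add_divide_distrib power_mult_distrib)
    then have "norm (u - v) \<le> norm (\<phi> (b * t) + a * of_real ((b * t)\<^sup>2)) / b\<^sup>2 + norm (\<zeta> b (b * t))"
      by (metis norm_triangle_ineq norm_divide norm_of_real abs_of_nonneg zero_le_power2)
    also have "\<dots> \<le> C * (b * \<bar>t\<bar>) ^ 3 / b\<^sup>2 + C1 * (b * \<bar>t\<bar> + b)"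
      using cubic[of "b * t"] \<zeta>[of "b * t"] True bt b by (intro add_mono divide_right_mono) auto
    also have "C * (b * \<bar>t\<bar>) ^ 3 / b\<^sup>2 = b * (C * \<bar>t\<bar> ^ 3)"
      using b by (simp add: power_mult_distrib power3_eq_cube power2_eq_square)
    also have "b * (C * \<bar>t\<bar> ^ 3) + C1 * (b * \<bar>t\<bar> + b) = b * (C * \<bar>t\<bar> ^ 3 + C1 * \<bar>t\<bar> + C1)"
      by (simp add: algebra_simps)
    also have "\<dots> \<le> b * (C * (1 + \<bar>t\<bar> ^ 3) + C1 * (1 + \<bar>t\<bar> ^ 3) + C1 * (1 + \<bar>t\<bar> ^ 3))"
    proof -
      have "C * \<bar>t\<bar> ^ 3 \<le> C * (1 + \<bar>t\<bar> ^ 3)" using C by (intro mult_left_mono) auto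
      moreover have "C1 * \<bar>t\<bar> \<le> C1 * (1 + \<bar>t\<bar> ^ 3)" using C tt by (intro mult_left_mono) auto
      moreover have "C1 * 1 \<le> C1 * (1 + \<bar>t\<bar> ^ 3)" using C by (intro mult_left_mono) auto
      ultimately show ?thesis using b by (intro mult_left_mono) auto
    qed
    also have "\<dots> = b * ((C + 2 * C1) * (1 + \<bar>t\<bar> ^ 3))" by (simp add: algebra_simps)
    finally have uv: "norm (u - v) \<le> b * ((C + 2 * C1) * (1 + \<bar>t\<bar> ^ 3))" .
    have "norm (exp u - exp v) \<le> exp (- c * t\<^sup>2 + 2 * C1) * norm (u - v)"
      using R2 Rev C by (intro norm_exp_diff_le) auto
    also have "\<dots> \<le> (exp (2 * C1 + c) * exp (- c * \<bar>t\<bar>)) * (b * ((C + 2 * C1) * (1 + \<bar>t\<bar> ^ 3)))"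
    proof (intro mult_mono uv)
      have "exp (- c * t\<^sup>2) \<le> exp c * exp (- c * \<bar>t\<bar>)" using c by (intro exp_minus_square_le) auto
      then have "exp (2 * C1) * exp (- c * t\<^sup>2) \<le> exp (2 * C1) * (exp c * exp (- c * \<bar>t\<bar>))"
        by (intro mult_left_mono) auto
      then show "exp (- c * t\<^sup>2 + 2 * C1) \<le> exp (2 * C1 + c) * exp (- c * \<bar>t\<bar>)"
        unfolding exp_add by (simp only: mult_ac)
    qed auto
    also have "\<dots> = b * ((C + 2 * C1) * exp (2 * C1 + c) * E)" by (simp add: E_def)
    also have "\<dots> \<le> b * (((C + 2 * C1) * exp (2 * C1 + c) + exp C1 + exp c) * E)"
      using b E0 by (intro mult_left_mono mult_right_mono) auto
    finally show ?thesis by (simp add: u_def v_def E_def)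
  next
    case False
    then have bt1: "b * \<bar>t\<bar> \<ge> 1" by simp
    have "Re (\<phi> (b * t)) \<le> - c * (b * \<bar>t\<bar>)" using far[of "b * t"] bt1 bt by simp
    then have "Re (\<phi> (b * t)) / b\<^sup>2 \<le> - c * (b * \<bar>t\<bar>) / b\<^sup>2" using b by (intro divide_right_mono) auto
    also have "\<dots> = - (c * \<bar>t\<bar>) / b" using b by (simp add: power2_eq_square)
    \<comment> \<open>As 1 / b >= 2, the rate 2 c is available; one half of it pays for the growth
      C1 b |t| <= c |t| of the perturbation, the other half is kept.\<close>
    also have "\<dots> \<le> - (2 * (c * \<bar>t\<bar>))"
    proof -
      have "2 * (c * \<bar>t\<bar>) \<le> (1 / b) * (c * \<bar>t\<bar>)"
        using b c by (intro mult_right_mono) (auto simp: field_simps)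
      then show ?thesis by simp
    qed
    finally have "Re u \<le> - (2 * (c * \<bar>t\<bar>)) + C1 * (b * \<bar>t\<bar> + b)" using Rez Reu by simp
    also have "C1 * (b * \<bar>t\<bar> + b) = (C1 * b) * \<bar>t\<bar> + C1 * b" by (simp add: algebra_simps)
    also have "\<dots> \<le> c * \<bar>t\<bar> + C1 * 1"
      using b C by (intro add_mono mult_right_mono mult_left_mono) auto
    finally have Ru: "Re u \<le> - c * \<bar>t\<bar> + C1" by simp
    have nu: "norm (exp u) \<le> exp C1 * exp (- c * \<bar>t\<bar>)"
      using Ru by (simp add: mult.commute flip: exp_add)
    have "norm (exp v) \<le> exp (- c * t\<^sup>2)" using Rev by simp
    also have "\<dots> \<le> exp c * exp (- c * \<bar>t\<bar>)" using c by (intro exp_minus_square_le) auto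
    finally have nv: "norm (exp v) \<le> exp c * exp (- c * \<bar>t\<bar>)" .
    have "norm (exp u - exp v) \<le> (exp C1 + exp c) * exp (- c * \<bar>t\<bar>) * 1"
      using norm_triangle_ineq4[of "exp u" "exp v"] nu nv by (simp add: algebra_simps)
    also have "\<dots> \<le> (exp C1 + exp c) * exp (- c * \<bar>t\<bar>) * (b * (1 + \<bar>t\<bar> ^ 3))"
    proof (intro mult_left_mono)
      have "b * \<bar>t\<bar> \<le> b * (1 + \<bar>t\<bar> ^ 3)" using tt b by (intro mult_left_mono) auto
      then show "1 \<le> b * (1 + \<bar>t\<bar> ^ 3)" using bt1 by linarith
    qed (auto intro: add_nonneg_nonneg)
    also have "\<dots> = b * ((exp C1 + exp c) * E)" by (simp add: E_def)
    also have "\<dots> \<le> b * (((C + 2 * C1) * exp (2 * C1 + c) + exp C1 + exp c) * E)"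
    proof -
      have "0 \<le> (C + 2 * C1) * exp (2 * C1 + c)" using C by simp
      then show ?thesis using b E0 by (intro mult_left_mono mult_right_mono) auto
    qed
    finally show ?thesis by (simp add: u_def v_def E_def)
  qed
qed

lemma integrable_on_cubic_exp_minus_abs:
  assumes c: "c > 0"
  shows "(\<lambda>t::real. (1 + \<bar>t\<bar> ^ 3) * exp (- c * \<bar>t\<bar>)) integrable_on UNIV"
proof -
  have "set_integrable lborel UNIV (\<lambda>t::real. (1 + \<bar>t\<bar> ^ 3) * exp (- c * \<bar>t\<bar>))"
  proof (rule integrable_lborel_continuous_bounded)
    show "(\<lambda>t. (1 + (6 / c) ^ 3) * exp (- (c / 2) * \<bar>t\<bar>)) integrable_on UNIV"
      using c by (intro integrable_on_mult_right integrable_on_exp_minus_abs) auto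
    fix t :: real
    \<comment> \<open>A sixth of the rate bounds |t|, so its cube costs half of the rate and the
      other half ensures integrability.\<close>
    have "c / 6 * \<bar>t\<bar> \<le> exp (c / 6 * \<bar>t\<bar>)" using exp_ge_add_one_self[of "c / 6 * \<bar>t\<bar>"] by linarith
    then have "(c / 6 * \<bar>t\<bar>) ^ 3 \<le> exp (c / 6 * \<bar>t\<bar>) ^ 3" using c by (intro power_mono) auto
    also have "\<dots> = exp (c / 2 * \<bar>t\<bar>)" by (simp add: exp_of_nat_mult[symmetric])
    finally have "(6 / c) ^ 3 * (c / 6 * \<bar>t\<bar>) ^ 3 \<le> (6 / c) ^ 3 * exp (c / 2 * \<bar>t\<bar>)"
      using c by (intro mult_left_mono) auto
    moreover have "(6 / c) ^ 3 * (c / 6 * \<bar>t\<bar>) ^ 3 = \<bar>t\<bar> ^ 3"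
      unfolding power_mult_distrib[symmetric] using c by simp
    moreover have "1 \<le> exp (c / 2 * \<bar>t\<bar>)" using c by simp
    ultimately have "1 + \<bar>t\<bar> ^ 3 \<le> (1 + (6 / c) ^ 3) * exp (c / 2 * \<bar>t\<bar>)"
      unfolding distrib_right by linarith
    then have "(1 + \<bar>t\<bar> ^ 3) * exp (- c * \<bar>t\<bar>) \<le> (1 + (6 / c) ^ 3) * exp (c / 2 * \<bar>t\<bar>) * exp (- c * \<bar>t\<bar>)"
      by (intro mult_right_mono) auto
    also have "\<dots> = (1 + (6 / c) ^ 3) * exp (- (c / 2) * \<bar>t\<bar>)"
      by (simp add: mult.assoc flip: exp_add)
    finally show "norm ((1 + \<bar>t\<bar> ^ 3) * exp (- c * \<bar>t\<bar>)) \<le> (1 + (6 / c) ^ 3) * exp (- (c / 2) * \<bar>t\<bar>)"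
      by simp
  qed (auto intro!: continuous_intros)
  then show ?thesis by (simp add: set_integrable_def integrable_on_lborel)
qed

section \<open>The saddle point\<close>

lemma has_real_derivative_Re_horizontal:
  assumes "(F has_field_derivative D) (at (z + of_real t))"
  shows "((\<lambda>t. Re (F (z + of_real t))) has_real_derivative Re D) (at t)"
proof -
  have "((\<lambda>w. F (z + w)) has_field_derivative D) (at (of_real t))"
    using assms DERIV_shift[of F D "of_real t" z] by (simp add: add.commute)
  then have "((\<lambda>t. F (z + of_real t)) has_vector_derivative D) (at t)"
    by (rule has_vector_derivative_real_field)
  then have "((\<lambda>t. Re (F (z + of_real t))) has_vector_derivative Re D) (at t)"
    by (rule bounded_linear.has_vector_derivative[OF bounded_linear_Re])
  then show ?thesis by (simp add: has_real_derivative_iff_has_vector_derivative)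
qed

text \<open>Multiplying by the conjugate of cosh gives Im tanh (x + i y) = sin y cos y / |cosh (x +
  i y)|^2, with -pi/2 < y < 0. This sign is the strict concavity of Re \<Phi> on horizontal
  lines.\<close>

lemma Im_sinh_div_cosh_neg:
  fixes X :: complex
  assumes "-1/2 < Im X" "Im X < 0"
  shows "Im (sinh (pi * X) / cosh (pi * X)) < 0"
proof -
  define x y where "x = pi * Re X" and "y = pi * Im X"
  have eX: "pi * X = of_real x + \<i> * of_real y" by (simp add: x_def y_def complex_eq_iff)
  have rs: "sinh (of_real x + \<i> * of_real y) = Complex (sinh x * cos y) (cosh x * sin y)"
    "cosh (of_real x + \<i> * of_real y) = Complex (cosh x * cos y) (sinh x * sin y)"
    by (auto simp: complex_eq_iff sinh_field_def cosh_field_def Re_exp Im_exp field_simps)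
  have y: "- (pi / 2) < y" "y < 0"
    using assms pi_gt_zero mult_strict_left_mono[of "-1/2" "Im X" pi] by (auto simp: y_def mult_less_0_iff)
  have c: "cos y > 0" using y by (intro cos_gt_zero_pi) auto
  have s: "sin y < 0" using y sin_gt_zero[of "- y"] pi_gt_zero by simp
  have p: "(cosh x * cos y)\<^sup>2 + (sinh x * sin y)\<^sup>2 > 0"
    using c by (intro add_pos_nonneg) auto
  have "cosh x * sin y * (cosh x * cos y) - sinh x * cos y * (sinh x * sin y) = ((cosh x)\<^sup>2 - (sinh x)\<^sup>2) * (sin y * cos y)"
    by (simp add: algebra_simps power2_eq_square)
  also have "\<dots> = sin y * cos y" by (simp add: hyperbolic_pythagoras)
  finally have "Im (sinh (pi * X) / cosh (pi * X)) = sin y * cos y / ((cosh x * cos y)\<^sup>2 + (sinh x * sin y)\<^sup>2)"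
    unfolding eX rs by (simp add: Im_divide)
  then show ?thesis using p s c by (simp add: divide_neg_pos mult_neg_pos)
qed

locale saddle =
  fixes \<sigma> \<mu> :: real
  assumes cond: "exp (2 * pi * \<mu>) > (sinh (2 * pi * \<sigma>))\<^sup>2"
begin

definition R :: real where "R = sqrt (exp (2 * pi * \<mu>) - (sinh (2 * pi * \<sigma>))\<^sup>2)"

definition w :: complex where "w = of_real (cosh (2 * pi * \<sigma>)) + \<i> * of_real R"

text \<open>The solution of exp (2 pi X) = -w, which is the saddle equation after exponentiation;
  the principal logarithm places it in -1/2 < Im X < -1/4.\<close>

definition X0 :: complex where "X0 = Ln (- w) / (2 * pi)"

text \<open>With x = X / b this is the coefficient of b^(-2) in the exponent of the integrand. The
  term pi X comes from the summand 1 / b of Q in -i Q / 2; the summand b gives another pi X, of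
  order 1, which is kept in \<open>F\<close> and \<open>\<zeta>\<close>.\<close>

definition \<Phi> :: "complex \<Rightarrow> complex" where
  "\<Phi> (X::complex) = - \<i> * pi * X\<^sup>2 + (2 * pi * \<i> * \<mu> + pi) * X + \<i> * lam0 (X + complex_of_real \<sigma>) + \<i> * lam0 (X - complex_of_real \<sigma>)"

definition \<Phi>' :: "complex \<Rightarrow> complex" where
  "\<Phi>' (X::complex) = - 2 * \<i> * pi * X + (2 * pi * \<i> * \<mu> + pi) - \<i> * Ln (2 * cosh (complex_of_real pi * (X + complex_of_real \<sigma>))) - \<i> * Ln (2 * cosh (complex_of_real pi * (X - complex_of_real \<sigma>)))"

definition \<Phi>'' :: "complex \<Rightarrow> complex" where
  "\<Phi>'' (X::complex) = - 2 * \<i> * pi - \<i> * pi * (sinh (complex_of_real pi * (X + complex_of_real \<sigma>)) / cosh (complex_of_real pi * (X + complex_of_real \<sigma>)) + sinh (complex_of_real pi * (X - complex_of_real \<sigma>)) / cosh (complex_of_real pi * (X - complex_of_real \<sigma>)))"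

text \<open>Minus half the second derivative of \<Phi> at the saddle point
  (\<open>\<Phi>''_X0\<close>), so that exp (-a t^2) is the Gaussian model of the integrand.\<close>

definition a :: complex where "a = 2 * pi * R * exp (- 2 * pi * \<mu>) * w"

lemma R_pos: "R > 0" and R_sq: "R\<^sup>2 = exp (2 * pi * \<mu>) - (sinh (2 * pi * \<sigma>))\<^sup>2"
  using cond by (auto simp: R_def)

lemma w_simps: "Re w = cosh (2 * pi * \<sigma>)" "Im w = R" by (auto simp: w_def)

lemma w_nz: "w \<noteq> 0" and Re_w_pos: "Re w > 0"
  using R_pos w_simps by auto

lemma Ln_minus_w: "Ln (- w) = Ln w - \<i> * pi"
  using Ln_minus[OF w_nz] R_pos w_simps by simp

text \<open>The number w lies in the open first quadrant, so the argument of -w is between -pi and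
  -pi/2. Both bounds matter: -1/2 keeps the saddle in the half strip, -1/4 in the region where the
  integrand decays at the right end.\<close>

lemma Im_X0: "-1/2 < Im X0" "Im X0 < -1/4"
proof -
  have "\<bar>Im (Ln w)\<bar> < pi / 2" using Re_Ln_pos_lt[OF w_nz] Re_w_pos by simp
  moreover have "Im (Ln w) > 0" using Im_Ln_pos_lt[OF w_nz] R_pos w_simps by simp
  moreover have "Im X0 = (Im (Ln w) - pi) / (2 * pi)" unfolding X0_def Ln_minus_w
    by (simp add: Im_divide_of_real[of _ "2 * pi", simplified])
  moreover have "(Im (Ln w) - pi) / (2 * pi) = Im (Ln w) / (2 * pi) - 1/2" by (simp add: field_simps)
  moreover have "Im (Ln w) / (2 * pi) > 0" "Im (Ln w) / (2 * pi) < 1/4"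
    using calculation by (auto simp: field_simps)
  ultimately show "-1/2 < Im X0" "Im X0 < -1/4" by linarith+
qed

lemma exp_X0: "exp (2 * pi * X0) = - w"
  using w_nz by (simp add: X0_def)

lemma X0_half_strip: "X0 \<in> half_strip" using Im_X0 by (auto simp: half_strip_def abs_if)

lemma half_strip_shift: "X \<in> half_strip \<Longrightarrow> X + complex_of_real s \<in> half_strip" "X \<in> half_strip \<Longrightarrow> X - complex_of_real s \<in> half_strip"
  by (auto simp: half_strip_def)

lemma \<Phi>_derivative: fixes X :: complex assumes "X \<in> half_strip" shows "(\<Phi> has_field_derivative \<Phi>' X) (at X)"
proof -
  have 1: "((\<lambda>X::complex. lam0 (X + complex_of_real \<sigma>)) has_field_derivative - Ln (2 * cosh (complex_of_real pi * (X + complex_of_real \<sigma>)))) (at X)"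
    using has_field_derivative_lam0[OF half_strip_shift(1)[OF assms, of \<sigma>]] by (simp add: DERIV_shift)
  have 2: "((\<lambda>X::complex. lam0 (X - complex_of_real \<sigma>)) has_field_derivative - Ln (2 * cosh (complex_of_real pi * (X - complex_of_real \<sigma>)))) (at X)"
    using has_field_derivative_lam0[OF half_strip_shift(2)[OF assms, of \<sigma>]]
      DERIV_shift[of lam0 _ X "- of_real \<sigma>"] by simp
  show ?thesis unfolding \<Phi>_def \<Phi>'_def
    by (rule derivative_eq_intros 1 2 refl)+ simp
qed

lemma \<Phi>'_derivative: fixes X :: complex assumes "X \<in> half_strip" shows "(\<Phi>' has_field_derivative \<Phi>'' X) (at X)"
proof -
  have 1: "((\<lambda>X::complex. Ln (2 * cosh (complex_of_real pi * (X + complex_of_real \<sigma>)))) has_field_derivative pi * (sinh (complex_of_real pi * (X + complex_of_real \<sigma>)) / cosh (complex_of_real pi * (X + complex_of_real \<sigma>)))) (at X)"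
    using two_cosh_half_strip(3)[OF half_strip_shift(1)[OF assms, of \<sigma>]]
      DERIV_shift[of "\<lambda>X. Ln (2 * cosh (complex_of_real pi * X))" _ X "of_real \<sigma>"] by simp
  have 2: "((\<lambda>X::complex. Ln (2 * cosh (complex_of_real pi * (X - complex_of_real \<sigma>)))) has_field_derivative pi * (sinh (complex_of_real pi * (X - complex_of_real \<sigma>)) / cosh (complex_of_real pi * (X - complex_of_real \<sigma>)))) (at X)"
    using two_cosh_half_strip(3)[OF half_strip_shift(2)[OF assms, of \<sigma>]]
      DERIV_shift[of "\<lambda>X. Ln (2 * cosh (complex_of_real pi * X))" _ X "- of_real \<sigma>"] by simp
  show ?thesis unfolding \<Phi>'_def \<Phi>''_def
    by (rule derivative_eq_intros 1 2 refl)+ (simp add: algebra_simps)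
qed

text \<open>The saddle equation cleared of logarithms. Its discriminant is 4 (sinh^2 (2 pi sigma) -
  exp (2 pi mu)), negative by hypothesis, so the roots are conjugate and w is the one with positive
  imaginary part.\<close>

lemma p_quadratic: "w\<^sup>2 - 2 * w * cosh (2 * pi * \<sigma>) + 1 = - of_real (exp (2 * pi * \<mu>))"
proof -
  have "w\<^sup>2 - 2 * w * cosh (2 * pi * \<sigma>) + 1 = of_real (- R\<^sup>2 - (cosh (2 * pi * \<sigma>))\<^sup>2 + 1)"
    by (simp add: w_def power2_eq_square algebra_simps)
  also have "- R\<^sup>2 - (cosh (2 * pi * \<sigma>))\<^sup>2 + 1 = - exp (2 * pi * \<mu>)"
    unfolding R_sq using cosh_square_eq[of "2 * pi * \<sigma>"] by simp
  finally show ?thesis by simp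
qed

text \<open>The product formula reduces the two cosh to exp (2 pi X0), its inverse and 2 cosh (2 pi
  sigma), whose sum is the quadratic polynomial in w divided by -w.\<close>

lemma cosh_prod_X0:
  "(2 * cosh (complex_of_real pi * (X0 + \<sigma>))) * (2 * cosh (complex_of_real pi * (X0 - \<sigma>))) = of_real (exp (2 * pi * \<mu>)) / w"
proof -
  have "(2 * cosh (complex_of_real pi * (X0 + \<sigma>))) * (2 * cosh (complex_of_real pi * (X0 - \<sigma>))) =
     exp (2 * pi * X0) + exp (- (2 * pi * X0)) + (exp (2 * pi * \<sigma>) + exp (- (2 * pi * \<sigma>)))"
    by (simp add: cosh_field_def algebra_simps exp_of_real[symmetric] flip: exp_add)
  also have "exp (- (2 * pi * X0)) = - 1 / w" unfolding exp_minus exp_X0 using w_nz by (simp add: field_simps)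
  also have "complex_of_real (exp (2 * pi * \<sigma>) + exp (- (2 * pi * \<sigma>))) = 2 * cosh (2 * pi * \<sigma>)"
    by (simp add: cosh_field_def)
  also have "exp (2 * pi * X0) + - 1 / w + 2 * cosh (2 * pi * \<sigma>) = - (w\<^sup>2 - 2 * w * cosh (2 * pi * \<sigma>) + 1) / w"
    unfolding exp_X0 using w_nz by (simp add: field_simps power2_eq_square)
  finally show ?thesis unfolding p_quadratic by simp
qed

text \<open>Exponentiation loses multiples of 2 pi i. The sum \<open>L\<close> of two logarithms has
  |Im L| < pi, and \<open>Z\<close> lies in the same strip by the bounds on Im X0, so Ln recovers
  both from their common exponential.\<close>

lemma \<Phi>'_X0: "\<Phi>' X0 = 0"
proof -
  define L where "L = Ln (2 * cosh (complex_of_real pi * (X0 + \<sigma>))) + Ln (2 * cosh (complex_of_real pi * (X0 - \<sigma>)))"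
  define Z where "Z = - (2 * pi * X0) + 2 * pi * \<mu> - \<i> * pi"
  note s = half_strip_shift(1)[OF X0_half_strip, of \<sigma>] half_strip_shift(2)[OF X0_half_strip, of \<sigma>]
  have "exp L = of_real (exp (2 * pi * \<mu>)) / w"
    unfolding L_def exp_add using two_cosh_half_strip(1)[OF s(1)] two_cosh_half_strip(1)[OF s(2)] cosh_prod_X0 by simp
  moreover have "exp Z = of_real (exp (2 * pi * \<mu>)) / w"
    unfolding Z_def exp_diff exp_add exp_minus exp_X0 using w_nz by (simp add: exp_of_real[symmetric] field_simps)
  ultimately have "Ln (exp L) = Ln (exp Z)" by simp
  moreover have "Ln (exp L) = L"
    using two_cosh_half_strip(2)[OF s(1)] two_cosh_half_strip(2)[OF s(2)] by (intro Ln_exp) (auto simp: L_def)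
  moreover have "Ln (exp Z) = Z"
  proof (intro Ln_exp)
    have "Im Z = - 2 * pi * Im X0 - pi" by (simp add: Z_def)
    moreover have "- 2 * pi * Im X0 < pi" "- 2 * pi * Im X0 > 0"
      using mult_strict_left_mono[of "-1/2" "Im X0" "2 * pi"] mult_strict_left_mono[of "Im X0" 0 "2 * pi"] Im_X0 pi_gt_zero
      by auto
    ultimately show "- pi < Im Z" "Im Z \<le> pi" using pi_gt_zero by linarith+
  qed
  ultimately have "L = Z" by simp
  have "\<Phi>' X0 = - 2 * \<i> * pi * X0 + (2 * pi * \<i> * \<mu> + pi) - \<i> * L"
    by (simp add: \<Phi>'_def L_def algebra_simps)
  then show ?thesis unfolding \<open>L = Z\<close> by (simp add: Z_def algebra_simps)
qed

text \<open>The addition theorem merges the two tanh into sinh (2 pi X0) / (cosh A cosh B), and the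
  quadratic equation for w removes exp (2 pi mu) from the numerator.\<close>

lemma \<Phi>''_X0: "\<Phi>'' X0 = - 2 * a"
proof -
  define A B where "A = pi * (X0 + \<sigma>)" and "B = pi * (X0 - \<sigma>)"
  define E where "E = complex_of_real (exp (2 * pi * \<mu>))"
  have E: "E \<noteq> 0" by (simp add: E_def)
  note s = half_strip_shift(1)[OF X0_half_strip, of \<sigma>] half_strip_shift(2)[OF X0_half_strip, of \<sigma>]
  have nz: "cosh A \<noteq> 0" "cosh B \<noteq> 0" using two_cosh_half_strip(1)[OF s(1)] two_cosh_half_strip(1)[OF s(2)] by (auto simp: A_def B_def)
  have prod: "cosh A * cosh B = E / (4 * w)"
    using cosh_prod_X0 w_nz by (simp add: A_def B_def E_def field_simps)
  have "sinh A / cosh A + sinh B / cosh B = sinh (A + B) / (cosh A * cosh B)"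
    using nz by (simp add: sinh_add field_simps)
  also have "A + B = 2 * pi * X0" by (simp add: A_def B_def algebra_simps)
  also have "sinh (2 * pi * X0) = (- w + 1 / w) / 2"
    unfolding sinh_field_def exp_minus exp_X0 by (simp add: inverse_eq_divide)
  also have "(- w + 1 / w) / 2 / (cosh A * cosh B) = 2 * (1 - w\<^sup>2) / E"
    unfolding prod using w_nz E by (simp add: field_simps power2_eq_square)
  finally have t: "sinh A / cosh A + sinh B / cosh B = 2 * (1 - w\<^sup>2) / E" .
  have "2 + 2 * (1 - w\<^sup>2) / E = 2 * (E + 1 - w\<^sup>2) / E" using E by (simp add: field_simps)
  also have "E = - (w\<^sup>2 - 2 * w * cosh (2 * pi * \<sigma>) + 1)" using p_quadratic by (simp add: E_def)
  then have "E + 1 - w\<^sup>2 = - 2 * w * (w - cosh (2 * pi * \<sigma>))" by (simp add: algebra_simps power2_eq_square)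
  also have "w - cosh (2 * pi * \<sigma>) = \<i> * R" by (simp add: w_def)
  finally have "2 + 2 * (1 - w\<^sup>2) / E = - 4 * \<i> * R * w / E" by simp
  moreover have "\<Phi>'' X0 = - \<i> * pi * (2 + (sinh A / cosh A + sinh B / cosh B))"
    by (simp add: \<Phi>''_def A_def B_def algebra_simps)
  moreover have "a = 2 * pi * R * w / E"
    by (simp add: a_def E_def exp_minus field_simps)
  ultimately have "\<Phi>'' X0 = - \<i> * pi * (- 4 * \<i> * R * w / E)" unfolding t by simp
  also have "\<dots> = - (4 * pi * R * w / E)" using i_squared by (simp add: field_simps E)
  finally show ?thesis unfolding \<open>a = _\<close> by simp
qed

lemma \<Phi>''_Re_neg:
  fixes X :: complex
  assumes "-1/2 < Im X" "Im X < 0"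
  shows "Re (\<Phi>'' X) < 0"
proof -
  have "Re (\<Phi>'' X) = pi * (Im (sinh (complex_of_real pi * (X + complex_of_real \<sigma>)) / cosh (complex_of_real pi * (X + complex_of_real \<sigma>))) + Im (sinh (complex_of_real pi * (X - complex_of_real \<sigma>)) / cosh (complex_of_real pi * (X - complex_of_real \<sigma>))))"
    by (simp add: \<Phi>''_def)
  moreover have "Im (sinh (complex_of_real pi * (X + complex_of_real \<sigma>)) / cosh (complex_of_real pi * (X + complex_of_real \<sigma>))) < 0" "Im (sinh (complex_of_real pi * (X - complex_of_real \<sigma>)) / cosh (complex_of_real pi * (X - complex_of_real \<sigma>))) < 0"
    by (intro Im_sinh_div_cosh_neg; use assms in simp)+
  ultimately show ?thesis by (simp add: mult_pos_neg)
qed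

lemma \<Phi>_holomorphic: "\<Phi> holomorphic_on half_strip"
  using \<Phi>_derivative by (meson field_differentiable_def field_differentiable_at_within holomorphic_on_def)

end

section \<open>Decay at infinity and the exact integrand\<close>

lemma Li2_minus_exp_bounded:
  assumes "\<kappa> < 1/2"
  obtains B where "B \<ge> 0" "\<And>Y::complex. Re Y \<le> 0 \<Longrightarrow> \<bar>Im Y\<bar> \<le> \<kappa> \<Longrightarrow> norm (Li2 (- exp (2 * pi * Y))) \<le> B"
proof -
  \<comment> \<open>For Re Y <= 0 the argument lies in a closed sector of the unit disc around the
    negative axis, of half-angle 2 pi kappa < pi. It is compact and avoids the cut, so continuity of
    the dilogarithm suffices.\<close>
  define K where "K = (\<lambda>p. - of_real (fst p) * cis (snd p)) ` ({0..1} \<times> {- (2 * pi * \<kappa>)..2 * pi * \<kappa>})"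
  have "compact K"
    unfolding K_def by (intro compact_continuous_image compact_Times continuous_intros) auto
  moreover have sub: "K \<subseteq> Li2_domain"
  proof
    fix z assume "z \<in> K"
    then obtain r \<theta> where z: "z = - of_real r * cis \<theta>" "0 \<le> r" "- (2 * pi * \<kappa>) \<le> \<theta>" "\<theta> \<le> 2 * pi * \<kappa>"
      by (auto simp: K_def)
    have "2 * pi * \<kappa> < pi" using assms by simp
    then have \<theta>: "\<bar>\<theta>\<bar> < pi" using z(3,4) by linarith
    show "z \<in> Li2_domain"
    proof (cases "r = 0 \<or> \<theta> = 0")
      case True
      then show ?thesis using z by (intro Li2_domainI_Re) (auto intro: le_less_trans[of _ 0])
    next
      case False
      then have "sin \<theta> \<noteq> 0" using \<theta> sin_zero_pi_iff by blast
      then show ?thesis using z False by (intro Li2_domainI_Im) auto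
    qed
  qed
  ultimately have "compact (Li2 ` K)"
    by (intro compact_continuous_image holomorphic_on_imp_continuous_on holomorphic_on_subset[OF Li2_holomorphic_on_domain])
  then obtain B where B: "\<And>z. z \<in> K \<Longrightarrow> norm (Li2 z) \<le> B"
    by (meson bounded_iff compact_imp_bounded image_eqI)
  have "norm (Li2 (- exp (2 * pi * Y))) \<le> max B 0" if "Re Y \<le> 0" "\<bar>Im Y\<bar> \<le> \<kappa>" for Y :: complex
  proof -
    have e: "- exp (2 * pi * Y) = - of_real (exp (2 * pi * Re Y)) * cis (2 * pi * Im Y)"
      by (simp add: exp_eq_polar)
    have "\<bar>2 * pi * Im Y\<bar> \<le> 2 * pi * \<kappa>" using that by (simp add: abs_mult)
    then have "(exp (2 * pi * Re Y), 2 * pi * Im Y) \<in> {0..1} \<times> {- (2 * pi * \<kappa>)..2 * pi * \<kappa>}"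
      using that by (auto simp: mult_le_0_iff)
    then have "- exp (2 * pi * Y) \<in> K" unfolding e K_def by (intro image_eqI[where x="(exp (2 * pi * Re Y), 2 * pi * Im Y)"]) auto
    then show ?thesis using B by fastforce
  qed
  then show thesis by (intro that[of "max B 0"]) auto
qed

context saddle
begin

text \<open>At the left end the quadratic terms of the two \<open>lam0\<close> cancel -i pi X^2, and
  Re \<Phi> behaves like pi T with T = Re X. At the right end oddness reverses their sign, -2 i pi
  X^2 results, and Re \<Phi> behaves like pi (1 + 4 Im X) T; this is the origin of the bound 1/4 on
  \<open>s1\<close>. The dilogarithms contribute bounded terms in both cases.\<close>

lemma \<Phi>_decay:
  assumes "\<kappa> < 1/2" "s1 > 1/4"
  obtains C0 c0 where "c0 > 0"
    "\<And>X. - \<kappa> \<le> Im X \<Longrightarrow> Im X \<le> - s1 \<Longrightarrow> \<bar>Re X\<bar> \<ge> \<bar>\<sigma>\<bar> \<Longrightarrow> Re (\<Phi> X) \<le> C0 - c0 * \<bar>Re X\<bar>"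
proof -
  obtain B where B: "B \<ge> 0" "\<And>Y::complex. Re Y \<le> 0 \<Longrightarrow> \<bar>Im Y\<bar> \<le> \<kappa> \<Longrightarrow> norm (Li2 (- exp (2 * pi * Y))) \<le> B"
    using Li2_minus_exp_bounded[OF assms(1)] by blast
  define D where "D = pi * \<bar>\<mu>\<bar> + B / pi"
  have "Re (\<Phi> X) \<le> D - min pi (4 * pi * s1 - pi) * \<bar>Re X\<bar>"
    if X: "- \<kappa> \<le> Im X" "Im X \<le> - s1" "\<bar>Re X\<bar> \<ge> \<bar>\<sigma>\<bar>" for X
  proof -
    define T y where "T = Re X" and "y = Im X"
    have hs2: "X + \<sigma> \<in> half_strip" "X - \<sigma> \<in> half_strip" "- (X + \<sigma>) \<in> half_strip" "- (X - \<sigma>) \<in> half_strip"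
      using X assms by (auto simp: half_strip_def)
    have y12: "\<bar>y\<bar> \<le> 1/2" using X assms by (auto simp: y_def)
    have mu: "- (2 * pi * \<mu> * y) \<le> pi * \<bar>\<mu>\<bar>"
    proof -
      have "- (2 * pi * \<mu> * y) \<le> 2 * pi * (\<bar>\<mu>\<bar> * \<bar>y\<bar>)"
        using abs_ge_minus_self[of "2 * pi * \<mu> * y"] by (simp add: abs_mult mult_ac)
      also have "\<dots> \<le> 2 * pi * (\<bar>\<mu>\<bar> * (1/2))" using y12 by (intro mult_left_mono) auto
      finally show ?thesis by simp
    qed
    show ?thesis
    proof (cases "T \<le> 0")
      case True
      then have neg: "Re (X + \<sigma>) \<le> 0" "Re (X - \<sigma>) \<le> 0" using X by (auto simp: T_def)
      define l1 l2 where "l1 = Li2 (- exp (2 * pi * (X + \<sigma>)))" and "l2 = Li2 (- exp (2 * pi * (X - \<sigma>)))"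
      have "norm l1 \<le> B" unfolding l1_def using B(2)[OF neg(1)] X assms by simp
      moreover have "norm l2 \<le> B" unfolding l2_def using B(2)[OF neg(2)] X assms by simp
      ultimately have l: "norm l1 \<le> B" "norm l2 \<le> B" by blast+
      have "\<Phi> X = (2 * pi * \<i> * \<mu> + pi) * X + \<i> * pi * \<sigma>\<^sup>2 + \<i> * (pi / 12) + \<i> * (l1 + l2) / (2 * pi)"
        unfolding \<Phi>_def lam0_eq[OF hs2(1)] lam0_eq[OF hs2(2)] l1_def[symmetric] l2_def[symmetric]
        by (simp add: field_simps power2_eq_square)
      then have "Re (\<Phi> X) = pi * T - 2 * pi * \<mu> * y - Im (l1 + l2) / (2 * pi)"
        by (simp add: diff_divide_distrib add_divide_distrib T_def y_def Re_divide_of_real[of _ "2 * pi", simplified])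
      moreover have "- (Im (l1 + l2) / (2 * pi)) \<le> (B + B) / (2 * pi)"
        unfolding minus_divide_left using l abs_Im_le_cmod[of l1] abs_Im_le_cmod[of l2] by (intro divide_right_mono) auto
      moreover have "min pi (4 * pi * s1 - pi) * \<bar>T\<bar> \<le> pi * \<bar>T\<bar>" by (intro mult_right_mono) auto
      ultimately show ?thesis using mu True unfolding D_def T_def[symmetric] by simp
    next
      case False
      then have neg: "Re (- (X + \<sigma>)) \<le> 0" "Re (- (X - \<sigma>)) \<le> 0" using X by (auto simp: T_def)
      define l1 l2 where "l1 = Li2 (- exp (2 * pi * (- (X + \<sigma>))))" and "l2 = Li2 (- exp (2 * pi * (- (X - \<sigma>))))"
      have "norm l1 \<le> B" unfolding l1_def using B(2)[OF neg(1)] X assms by simp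
      moreover have "norm l2 \<le> B" unfolding l2_def using B(2)[OF neg(2)] X assms by simp
      ultimately have l: "norm l1 \<le> B" "norm l2 \<le> B" by blast+
      have e: "lam0 (X + \<sigma>) = - lam0 (- (X + \<sigma>))" "lam0 (X - \<sigma>) = - lam0 (- (X - \<sigma>))"
        by (simp_all only: lam0_uminus minus_minus)
      have "\<Phi> X = - 2 * \<i> * pi * X\<^sup>2 + (2 * pi * \<i> * \<mu> + pi) * X - \<i> * pi * \<sigma>\<^sup>2 - \<i> * (pi / 12) - \<i> * (l1 + l2) / (2 * pi)"
        unfolding \<Phi>_def e lam0_eq[OF hs2(3)] lam0_eq[OF hs2(4)] l1_def[symmetric] l2_def[symmetric]
        by (simp add: field_simps power2_eq_square)
      then have "Re (\<Phi> X) = 4 * pi * (T * y) + pi * T - 2 * pi * \<mu> * y + Im (l1 + l2) / (2 * pi)"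
        by (simp add: T_def y_def Re_divide_of_real[of _ "2 * pi", simplified] power2_eq_square diff_divide_distrib add_divide_distrib)
      moreover have "Im (l1 + l2) / (2 * pi) \<le> (B + B) / (2 * pi)"
        using l abs_Im_le_cmod[of l1] abs_Im_le_cmod[of l2] by (intro divide_right_mono) auto
      moreover have "4 * pi * (T * y) \<le> 4 * pi * (T * (- s1))"
        using False X by (intro mult_left_mono) (auto simp: y_def)
      moreover have "min pi (4 * pi * s1 - pi) * \<bar>T\<bar> \<le> (4 * pi * s1 - pi) * \<bar>T\<bar>" by (intro mult_right_mono) auto
      ultimately show ?thesis using mu False unfolding D_def T_def[symmetric] by (simp add: algebra_simps)
    qed
  qed
  moreover have "min pi (4 * pi * s1 - pi) > 0" using assms by simp
  ultimately show thesis using that by blast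
qed

text \<open>The integrand of \<open>QQ\<close> as a function of X = b x with h = b^2, remainders
  included; \<open>integrand_eq_F\<close> makes the identification.\<close>

definition F :: "real \<Rightarrow> complex \<Rightarrow> complex" where
  "F h X = exp (\<Phi> X / of_real h + of_real pi * X + \<i> * lamE h (X + complex_of_real \<sigma>) + \<i> * lamE h (X - complex_of_real \<sigma>))"

lemma F_holomorphic:
  assumes "h > 0"
  shows "F h holomorphic_on half_strip"
proof -
  have 1: "(\<lambda>X. lamE h (X + complex_of_real \<sigma>)) holomorphic_on half_strip"
    by (rule holomorphic_on_compose_gen[OF _ lamE_holomorphic[OF assms], unfolded o_def])
       (auto intro!: holomorphic_intros simp: half_strip_shift)
  have 2: "(\<lambda>X. lamE h (X - complex_of_real \<sigma>)) holomorphic_on half_strip"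
    by (rule holomorphic_on_compose_gen[OF _ lamE_holomorphic[OF assms], unfolded o_def])
       (auto intro!: holomorphic_intros simp: half_strip_shift)
  show ?thesis unfolding F_def[abs_def]
    using assms by (intro holomorphic_intros \<Phi>_holomorphic 1 2) auto
qed

lemma integrand_eq_F:
  fixes X :: complex
  assumes b: "b > 0" and X: "X \<in> half_strip"
  shows "exp (- \<i> * pi * (X / b)\<^sup>2) * exp (2 * \<i> * pi * (X / b) * ((\<mu> / b) - \<i> * Qb b / 2))
         * sb b (X / b + \<sigma> / b) * sb b (X / b - \<sigma> / b) = F (b\<^sup>2) X"
proof -
  have e: "X / b + \<sigma> / b = (X + complex_of_real \<sigma>) / b" "X / b - \<sigma> / b = (X - complex_of_real \<sigma>) / b"
    by (simp_all add: add_divide_distrib diff_divide_distrib)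
  have nz: "complex_of_real b \<noteq> 0" using b by simp
  have "- \<i> * pi * (X / b)\<^sup>2 + 2 * \<i> * pi * (X / b) * ((\<mu> / b) - \<i> * Qb b / 2) +
      \<i> * (lam0 (X + complex_of_real \<sigma>) / of_real (b\<^sup>2) + lamE (b\<^sup>2) (X + complex_of_real \<sigma>)) +
      \<i> * (lam0 (X - complex_of_real \<sigma>) / of_real (b\<^sup>2) + lamE (b\<^sup>2) (X - complex_of_real \<sigma>)) =
     \<Phi> X / of_real (b\<^sup>2) + of_real pi * X + \<i> * lamE (b\<^sup>2) (X + complex_of_real \<sigma>) + \<i> * lamE (b\<^sup>2) (X - complex_of_real \<sigma>)"
    using nz by (simp add: Qb_def \<Phi>_def field_simps power2_eq_square)
  then show ?thesis
    unfolding e sb_eq_lam[OF b half_strip_shift(1)[OF X]] sb_eq_lam[OF b half_strip_shift(2)[OF X]] F_def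
    by (simp only: exp_add[symmetric])
qed

text \<open>The linear growth of pi X and of the bounds for the two remainders totals (pi + 2 C1)
  |Re X|. The threshold for h makes c0 / h at least 1 + pi + 2 C1, so rate 1 is left over. The
  factor \<open>C\<close> may depend on h, as it serves integrability and the contour shift and not
  the asymptotic estimate.\<close>

lemma F_decay:
  assumes \<kappa>: "\<kappa> < 1/2" and s1: "s1 > 1/4"
  obtains h0 where "h0 > 0" "\<And>h. 0 < h \<Longrightarrow> h < h0 \<Longrightarrow>
     \<exists>C. \<forall>X. - \<kappa> \<le> Im X \<longrightarrow> Im X \<le> - s1 \<longrightarrow> \<bar>Re X\<bar> \<ge> \<bar>\<sigma>\<bar> \<longrightarrow> norm (F h X) \<le> C * exp (- 1 * \<bar>Re X\<bar>)"
proof -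
  obtain C0 c0 where c0: "c0 > 0" "\<And>X. - \<kappa> \<le> Im X \<Longrightarrow> Im X \<le> - s1 \<Longrightarrow> \<bar>Re X\<bar> \<ge> \<bar>\<sigma>\<bar> \<Longrightarrow> Re (\<Phi> X) \<le> C0 - c0 * \<bar>Re X\<bar>"
    using \<Phi>_decay[OF \<kappa> s1] by blast
  obtain C1 where C1: "C1 \<ge> 0" "\<And>h X. h > 0 \<Longrightarrow> \<bar>Im X\<bar> \<le> \<kappa> \<Longrightarrow> norm (lamE h X) \<le> C1 * h * norm X"
    using lamE_bound[OF \<kappa>] by blast
  define h0 where "h0 = min 1 (c0 / (1 + pi + 2 * C1))"
  have pos: "1 + pi + 2 * C1 > 0" using C1 pi_gt_zero by linarith
  then have h0: "h0 > 0" using c0 by (simp add: h0_def)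
  have "\<exists>C. \<forall>X. - \<kappa> \<le> Im X \<longrightarrow> Im X \<le> - s1 \<longrightarrow> \<bar>Re X\<bar> \<ge> \<bar>\<sigma>\<bar> \<longrightarrow> norm (F h X) \<le> C * exp (- 1 * \<bar>Re X\<bar>)"
    if h: "0 < h" "h < h0" for h
  proof (intro exI allI impI)
    fix X assume X: "- \<kappa> \<le> Im X" "Im X \<le> - s1" "\<bar>Re X\<bar> \<ge> \<bar>\<sigma>\<bar>"
    define T where "T = \<bar>Re X\<bar>"
    have h1: "h \<le> 1" "h * (1 + pi + 2 * C1) \<le> c0"
      using h pos by (auto simp: h0_def pos_less_divide_eq)
    have nX: "norm X \<le> T + 1/2" using cmod_le[of X] X \<kappa> s1 by (simp add: T_def)
    have E: "norm (lamE h (X + complex_of_real s)) \<le> C1 * (T + 1/2 + \<bar>\<sigma>\<bar>)" if "\<bar>s\<bar> = \<bar>\<sigma>\<bar>" for s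
    proof -
      have "norm (X + complex_of_real s) \<le> T + 1/2 + \<bar>\<sigma>\<bar>"
        using norm_triangle_ineq[of X "complex_of_real s"] nX that by simp
      then have "C1 * h * norm (X + complex_of_real s) \<le> C1 * 1 * (T + 1/2 + \<bar>\<sigma>\<bar>)"
        using C1 h h1 by (intro mult_mono) auto
      moreover have "norm (lamE h (X + complex_of_real s)) \<le> C1 * h * norm (X + complex_of_real s)"
        by (rule C1(2)) (use h X s1 in auto)
      ultimately show ?thesis by simp
    qed
    have E1: "norm (lamE h (X + complex_of_real \<sigma>)) \<le> C1 * (T + 1/2 + \<bar>\<sigma>\<bar>)" using E[of \<sigma>] by simp
    have E2: "norm (lamE h (X - complex_of_real \<sigma>)) \<le> C1 * (T + 1/2 + \<bar>\<sigma>\<bar>)" using E[of "- \<sigma>"] by simp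
    have P: "Re (\<Phi> X) / h \<le> C0 / h - (1 + pi + 2 * C1) * T"
    proof -
      have "Re (\<Phi> X) / h \<le> (C0 - c0 * T) / h" using c0(2)[OF X] h by (intro divide_right_mono) (auto simp: T_def)
      also have "\<dots> = C0 / h - (c0 / h) * T" by (simp add: diff_divide_distrib)
      also have "\<dots> \<le> C0 / h - (1 + pi + 2 * C1) * T"
        using h h1 by (intro diff_left_mono mult_right_mono) (auto simp: T_def field_simps)
      finally show ?thesis .
    qed
    have "Re (\<Phi> X / of_real h + of_real pi * X + \<i> * lamE h (X + complex_of_real \<sigma>) + \<i> * lamE h (X - complex_of_real \<sigma>))
      = Re (\<Phi> X) / h + pi * Re X - Im (lamE h (X + complex_of_real \<sigma>)) - Im (lamE h (X - complex_of_real \<sigma>))"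
      by (simp add: Re_divide_of_real)
    also have "\<dots> \<le> (C0 / h - (1 + pi + 2 * C1) * T) + pi * T + C1 * (T + 1/2 + \<bar>\<sigma>\<bar>) + C1 * (T + 1/2 + \<bar>\<sigma>\<bar>)"
    proof -
      have "pi * Re X \<le> pi * T" by (simp add: T_def)
      then show ?thesis
        using P E1 E2 abs_Im_le_cmod[of "lamE h (X + complex_of_real \<sigma>)"] abs_Im_le_cmod[of "lamE h (X - complex_of_real \<sigma>)"]
        by linarith
    qed
    also have "\<dots> = (C0 / h + 2 * C1 * (1/2 + \<bar>\<sigma>\<bar>)) + - 1 * T" by (simp add: algebra_simps)
    finally show "norm (F h X) \<le> exp (C0 / h + 2 * C1 * (1/2 + \<bar>\<sigma>\<bar>)) * exp (- 1 * \<bar>Re X\<bar>)"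
      unfolding F_def norm_exp_eq_Re exp_add[symmetric] T_def by simp
  qed
  with h0 show thesis by (rule that)
qed


text \<open>The right side collects the terms of order b^(-2): 7 pi / 24 from 7 Q^2 / 24, -pi mu
  from i mu Q, the leading exponent of s_b (mu / b), and the integrand at the saddle. The three
  values of \<open>lam0\<close> give the three dilogarithms, and 5 pi / 12 is 7 pi / 24 plus three
  times pi / 24.\<close>

lemma fQ_eq: "fQ \<sigma> \<mu> = \<i> * (7 * pi / 24) - \<i> * pi * \<mu>\<^sup>2 / 2 - pi * \<mu> - \<i> * pi * \<sigma>\<^sup>2 + \<i> * lam0 (of_real \<mu>) + \<Phi> X0"
proof -
  have mu: "complex_of_real \<mu> \<in> half_strip" by (simp add: half_strip_def)
  note s = half_strip_shift(1)[OF X0_half_strip, of \<sigma>] half_strip_shift(2)[OF X0_half_strip, of \<sigma>]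
  have e1: "- exp (2 * pi * (X0 + \<sigma>)) = of_real (exp (2 * pi * \<sigma>)) * w"
    unfolding distrib_left exp_add exp_X0 by (simp add: exp_of_real[symmetric])
  have e2: "- exp (2 * pi * (X0 - \<sigma>)) = of_real (exp (- 2 * pi * \<sigma>)) * w"
    unfolding right_diff_distrib exp_diff exp_X0 by (simp add: exp_of_real[symmetric] exp_minus field_simps)
  have e3: "- exp (2 * pi * complex_of_real \<mu>) = - complex_of_real (exp (2 * pi * \<mu>))"
    by (simp add: exp_of_real[symmetric])
  have X: "Ln (- w) = 2 * pi * X0" by (simp add: X0_def)
  define l1 l2 l3 where "l1 = Li2 (of_real (exp (2 * pi * \<sigma>)) * w)" and "l2 = Li2 (of_real (exp (- 2 * pi * \<sigma>)) * w)"
    and "l3 = Li2 (- complex_of_real (exp (2 * pi * \<mu>)))"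
  have f1: "fQ \<sigma> \<mu> = - l3 / (2 * pi * \<i>) - l2 / (2 * pi * \<i>) - l1 / (2 * pi * \<i>) + (1/2 + \<i> * \<mu>) * (2 * pi * X0) - pi * \<mu> + 5 * pi * \<i> / 12"
    unfolding fQ_def Let_def R_def[symmetric] w_def[symmetric] X l1_def l2_def l3_def ..
  have f2: "\<Phi> X0 = - \<i> * pi * X0\<^sup>2 + (2 * pi * \<i> * \<mu> + pi) * X0 + \<i> * (pi * (X0 + \<sigma>)\<^sup>2 / 2 + l1 / (2 * pi) + pi / 24) + \<i> * (pi * (X0 - \<sigma>)\<^sup>2 / 2 + l2 / (2 * pi) + pi / 24)"
    unfolding \<Phi>_def lam0_eq[OF s(1)] lam0_eq[OF s(2)] e1 e2 l1_def l2_def ..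
  have f3: "lam0 (of_real \<mu>) = pi * (complex_of_real \<mu>)\<^sup>2 / 2 + l3 / (2 * pi) + pi / 24"
    unfolding lam0_eq[OF mu] e3 l3_def ..
  have f4: "x / (2 * pi * \<i>) = - \<i> * x / (2 * pi)" for x
    by (simp add: field_simps)
  show ?thesis
    unfolding f1 f2 f3 f4 by (simp add: field_simps power2_eq_square)
qed

section \<open>Laplace's method on the line through the saddle point\<close>

definition \<phi> :: "real \<Rightarrow> complex" where "\<phi> t = \<Phi> (X0 + of_real t) - \<Phi> X0"

lemma X0_line: "X0 + of_real t \<in> half_strip" "-1/2 < Im (X0 + of_real t)" "Im (X0 + of_real t) < 0"
  using Im_X0 by (auto simp: half_strip_def)

lemma Re_a_pos: "Re a > 0"
proof -
  have "a = of_real (2 * pi * R * exp (- 2 * pi * \<mu>)) * w" by (simp add: a_def)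
  then have "Re a = 2 * pi * R * exp (- 2 * pi * \<mu>) * Re w" by (simp only: Re_complex_of_real times_complex.sel Im_complex_of_real)
  then show ?thesis using R_pos Re_w_pos by simp
qed

lemma \<phi>_concave:
  obtains c where "c > 0" "\<And>t. \<bar>t\<bar> \<le> 1 \<Longrightarrow> Re (\<phi> t) \<le> - c * t\<^sup>2" "\<And>t. \<bar>t\<bar> \<ge> 1 \<Longrightarrow> Re (\<phi> t) \<le> - c * \<bar>t\<bar>"
proof (rule strictly_concave_decay[of "\<lambda>t. Re (\<phi> t)" "\<lambda>t. Re (\<Phi>' (X0 + of_real t))" "\<lambda>t. Re (\<Phi>'' (X0 + of_real t))"])
  show "((\<lambda>t. Re (\<phi> t)) has_real_derivative Re (\<Phi>' (X0 + of_real t))) (at t)" for t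
  proof -
    have "((\<lambda>X. \<Phi> X - \<Phi> X0) has_field_derivative \<Phi>' (X0 + of_real t)) (at (X0 + of_real t))"
      using \<Phi>_derivative[OF X0_line(1)] by (auto intro!: derivative_eq_intros)
    from has_real_derivative_Re_horizontal[OF this] show ?thesis by (simp add: \<phi>_def)
  qed
  show "((\<lambda>t. Re (\<Phi>' (X0 + of_real t))) has_real_derivative Re (\<Phi>'' (X0 + of_real t))) (at t)" for t
    by (rule has_real_derivative_Re_horizontal[OF \<Phi>'_derivative[OF X0_line(1)]])
  show "continuous_on {-1..1} (\<lambda>t. Re (\<Phi>'' (X0 + of_real t)))"
  proof -
    have "cosh (complex_of_real pi * (X0 + of_real t + of_real \<sigma>)) \<noteq> 0" "cosh (complex_of_real pi * (X0 + of_real t - of_real \<sigma>)) \<noteq> 0" for t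
      using two_cosh_half_strip(1)[OF half_strip_shift(1)[OF X0_line(1)[of t], of \<sigma>]]
        two_cosh_half_strip(1)[OF half_strip_shift(2)[OF X0_line(1)[of t], of \<sigma>]] by auto
    then show ?thesis unfolding \<Phi>''_def by (intro continuous_intros) auto
  qed
  show "Re (\<Phi>'' (X0 + of_real t)) < 0" for t by (rule \<Phi>''_Re_neg[OF X0_line(2,3)])
qed (use \<Phi>'_X0 that in \<open>auto simp: \<phi>_def\<close>)

text \<open>Taylor's formula of order two on the segment from X0 - 1 to X0 + 1: the linear term
  vanishes at the saddle, the quadratic one is -a t^2, and the third derivative is bounded on the
  compact segment.\<close>

lemma \<phi>_cubic:
  obtains C where "C \<ge> 0" "\<And>t. \<bar>t\<bar> \<le> 1 \<Longrightarrow> norm (\<phi> t + a * of_real (t\<^sup>2)) \<le> C * \<bar>t\<bar> ^ 3"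
proof -
  have hol1: "\<Phi>' holomorphic_on half_strip"
    using \<Phi>'_derivative by (meson field_differentiable_def field_differentiable_at_within holomorphic_on_def)
  have "deriv \<Phi>' X = \<Phi>'' X" if "X \<in> half_strip" for X
    using \<Phi>'_derivative[OF that] by (rule DERIV_imp_deriv)
  then have hol2: "\<Phi>'' holomorphic_on half_strip"
    using holomorphic_deriv[OF hol1 open_half_strip] holomorphic_cong by (metis (no_types, lifting))
  define S where "S = closed_segment (X0 - 1) (X0 + 1)"
  have S: "S \<subseteq> half_strip"
    unfolding S_def using X0_line(1)[of 1] X0_line(1)[of "-1"]
    by (intro closed_segment_subset convex_half_strip) auto
  have inS: "X0 + of_real t \<in> S" if "\<bar>t\<bar> \<le> 1" for t
    unfolding S_def in_segment(1)
    by (rule exI[of _ "(1 + t) / 2"]) (use that in \<open>auto simp: scaleR_conv_of_real field_simps abs_le_iff\<close>)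
  have "continuous_on S (deriv \<Phi>'')"
    using holomorphic_deriv[OF hol2 open_half_strip] S holomorphic_on_imp_continuous_on continuous_on_subset by blast
  then have "bounded (deriv \<Phi>'' ` S)"
    by (intro compact_imp_bounded compact_continuous_image) (auto simp: S_def)
  then obtain B where B: "B > 0" "\<And>X. X \<in> S \<Longrightarrow> norm (deriv \<Phi>'' X) \<le> B"
    by (metis bounded_pos image_eqI)
  define f where "f i = (if i = 0 then \<Phi> else if i = 1 then \<Phi>' else if i = 2 then \<Phi>'' else deriv \<Phi>'')" for i :: nat
  have "norm (\<phi> t + a * of_real (t\<^sup>2)) \<le> B / 2 * \<bar>t\<bar> ^ 3" if t: "\<bar>t\<bar> \<le> 1" for t
  proof -
    have taylor: "norm (f 0 (X0 + of_real t) - (\<Sum>i\<le>2. f i X0 * (X0 + of_real t - X0) ^ i / fact i)) \<le> B * norm (X0 + of_real t - X0) ^ Suc 2 / fact 2"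
    proof (rule complex_Taylor)
      show "convex S" by (simp add: S_def)
      fix i and x assume x: "x \<in> S" and i: "i \<le> (2::nat)"
      then have xh: "x \<in> half_strip" using S by auto
      have "i = 0 \<or> i = 1 \<or> i = 2" using i by auto
      then have "(f i has_field_derivative f (Suc i) x) (at x)"
        using \<Phi>_derivative[OF xh] \<Phi>'_derivative[OF xh] holomorphic_derivI[OF hol2 open_half_strip xh]
        by (auto simp: f_def)
      then show "(f i has_field_derivative f (Suc i) x) (at x within S)" by (rule has_field_derivative_at_within)
    next
      show "cmod (f (Suc 2) x) \<le> B" if "x \<in> S" for x using B(2)[OF that] by (simp add: f_def)
    qed (use inS[OF t] inS[of 0] in auto)
    have sum: "(\<Sum>i\<le>2. f i X0 * (X0 + of_real t - X0) ^ i / fact i) = \<Phi> X0 - a * of_real (t\<^sup>2)"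
      by (simp add: numeral_2_eq_2 f_def \<Phi>'_X0 \<Phi>''_X0)
    have eq: "f 0 (X0 + of_real t) - (\<Phi> X0 - a * of_real (t\<^sup>2)) = \<phi> t + a * of_real (t\<^sup>2)"
      by (simp add: f_def \<phi>_def)
    have "norm (\<phi> t + a * of_real (t\<^sup>2)) \<le> B * norm (X0 + of_real t - X0) ^ Suc 2 / fact 2"
      using taylor unfolding sum eq .
    also have "\<dots> = B / 2 * \<bar>t\<bar> ^ 3" by (simp add: numeral_3_eq_3 numeral_2_eq_2)
    finally show ?thesis .
  qed
  then show thesis using B by (intro that[of "B / 2"]) auto
qed

text \<open>The part of the exponent that is of order 1 along the saddle line, with its constant pi
  X0 split off into the prefactor (\<open>F_X0\<close>).\<close>

definition \<zeta> :: "real \<Rightarrow> real \<Rightarrow> complex" where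
  "\<zeta> b t = of_real (pi * t) + \<i> * lamE (b\<^sup>2) (X0 + of_real t + complex_of_real \<sigma>) + \<i> * lamE (b\<^sup>2) (X0 + of_real t - complex_of_real \<sigma>)"

lemma \<zeta>_bound:
  obtains C where "C \<ge> 0" "\<And>b t. 0 < b \<Longrightarrow> b \<le> 1 \<Longrightarrow> norm (\<zeta> b t) \<le> C * (\<bar>t\<bar> + b)"
proof -
  have "\<bar>Im X0\<bar> < 1/2" using Im_X0 by auto
  then obtain C1 where C1: "C1 \<ge> 0" "\<And>h X. h > 0 \<Longrightarrow> \<bar>Im X\<bar> \<le> \<bar>Im X0\<bar> \<Longrightarrow> norm (lamE h X) \<le> C1 * h * norm X"
    using lamE_bound by blast
  define M where "M = norm X0 + \<bar>\<sigma>\<bar>"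
  have M: "M \<ge> 0" by (simp add: M_def)
  have "norm (\<zeta> b t) \<le> (pi + 2 * C1 + 2 * C1 * M) * (\<bar>t\<bar> + b)" if b: "0 < b" "b \<le> 1" for b t
  proof -
    have b2: "b\<^sup>2 \<le> b" "b\<^sup>2 \<le> 1" using b by (simp_all add: power2_eq_square mult_left_le mult_le_one)
    have E: "norm (lamE (b\<^sup>2) (X0 + of_real t + complex_of_real s)) \<le> C1 * \<bar>t\<bar> + C1 * M * b" if "\<bar>s\<bar> = \<bar>\<sigma>\<bar>" for s
    proof -
      have "norm (X0 + of_real t + complex_of_real s) \<le> M + \<bar>t\<bar>"
        using norm_triangle_ineq[of "X0 + of_real t" "complex_of_real s"] norm_triangle_ineq[of X0 "complex_of_real t"] that
        by (simp add: M_def)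
      then have "C1 * b\<^sup>2 * norm (X0 + of_real t + complex_of_real s) \<le> C1 * b\<^sup>2 * (M + \<bar>t\<bar>)"
        using C1 by (intro mult_left_mono) auto
      also have "\<dots> = C1 * M * b\<^sup>2 + C1 * \<bar>t\<bar> * b\<^sup>2" by (simp add: algebra_simps)
      also have "\<dots> \<le> C1 * M * b + C1 * \<bar>t\<bar> * 1" using C1 M b2 by (intro add_mono mult_left_mono) auto
      moreover have "norm (lamE (b\<^sup>2) (X0 + of_real t + complex_of_real s)) \<le> C1 * b\<^sup>2 * norm (X0 + of_real t + complex_of_real s)"
        by (rule C1(2)) (use b in auto)
      ultimately show ?thesis by simp
    qed
    have "norm (\<zeta> b t) \<le> norm (complex_of_real (pi * t)) + norm (\<i> * lamE (b\<^sup>2) (X0 + of_real t + complex_of_real \<sigma>)) + norm (\<i> * lamE (b\<^sup>2) (X0 + of_real t - complex_of_real \<sigma>))"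
      unfolding \<zeta>_def by (intro norm_triangle_mono order_refl)
    also have "\<dots> \<le> pi * \<bar>t\<bar> + (C1 * \<bar>t\<bar> + C1 * M * b) + (C1 * \<bar>t\<bar> + C1 * M * b)"
      using E[of \<sigma>] E[of "- \<sigma>"] by (simp add: norm_mult abs_mult)
    also have "\<dots> \<le> (pi + 2 * C1 + 2 * C1 * M) * (\<bar>t\<bar> + b)"
    proof -
      have "0 \<le> 2 * C1 * M * \<bar>t\<bar>" "0 \<le> (pi + 2 * C1) * b" using C1 M b pi_gt_zero by (auto intro!: mult_nonneg_nonneg add_nonneg_nonneg)
      then show ?thesis by (simp add: algebra_simps)
    qed
    finally show ?thesis .
  qed
  then show thesis using C1 M pi_gt_zero by (intro that[of "pi + 2 * C1 + 2 * C1 * M"]) auto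
qed

lemma F_X0:
  assumes "b > 0"
  shows "F (b\<^sup>2) (X0 + of_real t) = exp (\<Phi> X0 / of_real (b\<^sup>2) + pi * X0) * exp (\<phi> t / of_real (b\<^sup>2) + \<zeta> b t)"
  unfolding F_def \<phi>_def \<zeta>_def exp_add[symmetric]
  by (rule arg_cong[where f=exp]) (simp add: algebra_simps diff_divide_distrib)

definition L :: "real \<Rightarrow> real \<Rightarrow> complex" where
  "L b t = exp (\<phi> (b * t) / of_real (b\<^sup>2) + \<zeta> b (b * t))"

text \<open>The pointwise estimate has an integrable majorant proportional to b, so comparison with
  the exact Gaussian integral gives an error K b. Integrability of \<open>L b\<close> is a premise
  because the contour shift delivers it.\<close>

lemma Laplace_estimate:
  obtains K b0 where "K \<ge> 0" "b0 > 0" "\<And>b. 0 < b \<Longrightarrow> b < b0 \<Longrightarrow>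
     L b integrable_on UNIV \<Longrightarrow>
     norm (integral UNIV (L b) - of_real (sqrt pi) / csqrt a) \<le> K * b"
proof -
  obtain c0 where c0: "c0 > 0" "\<And>t. \<bar>t\<bar> \<le> 1 \<Longrightarrow> Re (\<phi> t) \<le> - c0 * t\<^sup>2" "\<And>t. \<bar>t\<bar> \<ge> 1 \<Longrightarrow> Re (\<phi> t) \<le> - c0 * \<bar>t\<bar>"
    using \<phi>_concave by blast
  define c where "c = min c0 (Re a)"
  have c: "c > 0" "Re a \<ge> c" using c0 Re_a_pos by (auto simp: c_def)
  have near: "Re (\<phi> t) \<le> - c * t\<^sup>2" if "\<bar>t\<bar> \<le> 1" for t
    using c0(2)[OF that] mult_right_mono[of c c0 "t\<^sup>2"] by (simp add: c_def)
  have far: "Re (\<phi> t) \<le> - c * \<bar>t\<bar>" if "\<bar>t\<bar> \<ge> 1" for t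
    using c0(3)[OF that] mult_right_mono[of c c0 "\<bar>t\<bar>"] by (simp add: c_def)
  obtain C where C: "C \<ge> 0" "\<And>t. \<bar>t\<bar> \<le> 1 \<Longrightarrow> norm (\<phi> t + a * of_real (t\<^sup>2)) \<le> C * \<bar>t\<bar> ^ 3"
    using \<phi>_cubic by blast
  obtain C1 where C1: "C1 \<ge> 0" "\<And>b t. 0 < b \<Longrightarrow> b \<le> 1 \<Longrightarrow> norm (\<zeta> b t) \<le> C1 * (\<bar>t\<bar> + b)"
    using \<zeta>_bound by blast
  define K where "K = (C + 2 * C1) * exp (2 * C1 + c) + exp C1 + exp c"
  define E where "E t = (1 + \<bar>t\<bar> ^ 3) * exp (- c * \<bar>t\<bar>)" for t :: real
  have Eint: "E integrable_on UNIV" unfolding E_def by (rule integrable_on_cubic_exp_minus_abs[OF c(1)])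
  have K0: "K \<ge> 0" unfolding K_def using C C1 by (intro add_nonneg_nonneg mult_nonneg_nonneg) auto
  have I0: "integral UNIV E \<ge> 0" using Eint by (intro integral_nonneg) (auto simp: E_def)
  define b0 where "b0 = min (1/2) (c / (C1 + 1))"
  have b0: "b0 > 0" using c C1 by (simp add: b0_def)
  show thesis
  proof (rule that[of "K * integral UNIV E" b0])
    fix b :: real assume b: "0 < b" "b < b0"
    assume int: "L b integrable_on UNIV"
    have b2: "b \<le> 1/2" using b by (simp add: b0_def)
    have "b * (C1 + 1) \<le> c" using b C1 by (simp add: b0_def pos_less_divide_eq)
    then have b3: "C1 * b \<le> c" using b by (simp add: algebra_simps)
    have pt: "norm (L b t - exp (- a * of_real (t\<^sup>2))) \<le> (b * K) * E t" for t
      using laplace_pointwise_bound[where \<phi>=\<phi> and \<zeta>=\<zeta>, OF c C(1) C1(1) C(2) near far b(1) b2 b3, of t] C1(2)[OF b(1)] b2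
      unfolding K_def[symmetric] E_def L_def by (simp add: mult.assoc)
    have "norm (integral UNIV (\<lambda>t. L b t - exp (- a * of_real (t\<^sup>2)))) \<le> integral UNIV (\<lambda>t. (b * K) * E t)"
      by (rule integral_norm_bound_integral)
         (use pt int gaussian_integral_complex(2)[OF Re_a_pos] Eint in \<open>auto intro!: integrable_diff integrable_on_mult_right\<close>)
    then show "norm (integral UNIV (L b) - of_real (sqrt pi) / csqrt a) \<le> K * integral UNIV E * b"
      unfolding integral_diff[OF int gaussian_integral_complex(2)[OF Re_a_pos]] gaussian_integral_complex(1)[OF Re_a_pos] integral_mult_right
      by (simp add: mult_ac)
  qed (use K0 I0 b0 in auto)
qed

text \<open>Since a is a positive multiple of w, csqrt a contains exp (Ln w / 2), and exp (pi X0) is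
  the same factor times exp (-i pi / 2), by which 3 pi / 4 becomes pi / 4. The factors exp (-pi mu)
  and sqrt pi cancel as well.\<close>

lemma amplitude_eq:
  "exp (3 * \<i> * pi / 4 - pi * \<mu> + pi * X0) * (of_real (sqrt pi) / csqrt a) =
     exp (\<i> * pi / 4) / complex_of_real (sqrt 2 * (exp (2 * pi * \<mu>) - (sinh (2 * pi * \<sigma>))\<^sup>2) powr (1/4))"
proof -
  define \<rho> where "\<rho> = 2 * pi * R * exp (- 2 * pi * \<mu>)"
  have \<rho>: "\<rho> > 0" using R_pos by (simp add: \<rho>_def)
  have a: "a = of_real \<rho> * w" by (simp add: a_def \<rho>_def)
  have anz: "a \<noteq> 0" using Re_a_pos by auto
  have "csqrt a = exp (Ln a / 2)" using csqrt_exp_Ln[OF anz] .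
  also have "Ln a = of_real (ln \<rho>) + Ln w" unfolding a
    by (rule Ln_unique) (use \<rho> w_nz mpi_less_Im_Ln[OF w_nz] Im_Ln_le_pi[OF w_nz] in \<open>auto simp: exp_add exp_of_real\<close>)
  finally have csq: "csqrt a = exp ((of_real (ln \<rho>) + Ln w) / 2)" .
  have "exp (ln \<rho> / 2) = sqrt \<rho>" using \<rho> by (simp add: ln_sqrt[symmetric])
  then have "exp (complex_of_real (ln \<rho>) / 2) = of_real (sqrt \<rho>)"
    by (metis exp_of_real of_real_divide of_real_numeral)
  then have sq: "csqrt a = of_real (sqrt \<rho>) * exp (Ln w / 2)"
    using csq by (simp add: add_divide_distrib exp_add)
  have X: "pi * X0 = Ln w / 2 - \<i> * pi / 2"
    unfolding X0_def Ln_minus_w by (simp add: field_simps)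
  have s\<rho>: "sqrt \<rho> = sqrt pi * (sqrt 2 * sqrt R) * exp (- pi * \<mu>)"
  proof -
    have "exp (- 2 * pi * \<mu>) = (exp (- pi * \<mu>))\<^sup>2" by (simp add: power2_eq_square flip: exp_add)
    then show ?thesis unfolding \<rho>_def by (simp add: real_sqrt_mult)
  qed
  have pw: "(exp (2 * pi * \<mu>) - (sinh (2 * pi * \<sigma>))\<^sup>2) powr (1/4) = sqrt R"
  proof -
    have "(exp (2 * pi * \<mu>) - (sinh (2 * pi * \<sigma>))\<^sup>2) powr (1/4) = (R powr 2) powr (1/4)"
      unfolding R_sq[symmetric] using R_pos by (simp add: powr_numeral)
    also have "\<dots> = R powr (1/2)" unfolding powr_powr by simp
    finally show ?thesis using R_pos by (simp add: powr_half_sqrt)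
  qed
  have e: "exp (3 * \<i> * pi / 4 - pi * \<mu> + pi * X0) = exp (\<i> * pi / 4) * of_real (exp (- pi * \<mu>)) * exp (Ln w / 2)"
    unfolding X exp_of_real[symmetric] exp_add[symmetric]
    by (rule arg_cong[where f=exp]) (simp add: field_simps)
  have nz: "exp (Ln w / 2) \<noteq> 0" "complex_of_real (exp (- pi * \<mu>)) \<noteq> 0" "complex_of_real (sqrt pi) \<noteq> 0" "complex_of_real (sqrt R) \<noteq> 0"
    using R_pos by auto
  show ?thesis
    unfolding e pw sq s\<rho> using nz unfolding of_real_mult by (simp add: field_simps)
qed


section \<open>Moving the contour and collecting powers of b\<close>

definition QQ_integrand :: "real \<Rightarrow> real \<Rightarrow> complex" where
  "QQ_integrand b = (\<lambda>t::real.
         let x = complex_of_real t - \<i> * complex_of_real (3 * Qb b / 8) in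
         exp (- \<i> * pi * x\<^sup>2) * exp (2 * \<i> * pi * x * (complex_of_real (\<mu> / b) - \<i> * Qb b / 2))
         * sb b (x + complex_of_real (\<sigma> / b)) * sb b (x - complex_of_real (\<sigma> / b)))"

text \<open>In the variable X the given line lies at height -(3/8) (1 + b^2); it is moved to the
  height of the saddle point, and the parameter is then rescaled by b. The factor 1 / b of the first
  substitution and the factor b of the second cancel.\<close>

lemma contour_integral_eq:
  obtains b0 where "b0 > 0" "\<And>b. 0 < b \<Longrightarrow> b < b0 \<Longrightarrow>
     L b integrable_on UNIV \<and>
     integral UNIV (QQ_integrand b)
     = exp (\<Phi> X0 / of_real (b\<^sup>2) + pi * X0) * integral UNIV (L b)"
proof -
  \<comment> \<open>For b < 1/3 the given line has height between -5/12 and -3/8. The values 7/16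
    and 3/8, adjusted to include Im X0, thus enclose both lines and respect the limits 1/2 and
    1/4.\<close>
  define \<kappa> where "\<kappa> = max (- Im X0) (7/16)"
  define s1 where "s1 = min (- Im X0) (3/8)"
  have k: "\<kappa> < 1/2" "s1 > 1/4" using Im_X0 by (auto simp: \<kappa>_def s1_def)
  obtain h0 where h0: "h0 > 0" "\<And>h. 0 < h \<Longrightarrow> h < h0 \<Longrightarrow>
     \<exists>C. \<forall>X. - \<kappa> \<le> Im X \<longrightarrow> Im X \<le> - s1 \<longrightarrow> \<bar>Re X\<bar> \<ge> \<bar>\<sigma>\<bar> \<longrightarrow> norm (F h X) \<le> C * exp (- 1 * \<bar>Re X\<bar>)"
    using F_decay[OF k] by blast
  define b0 where "b0 = min (1/3) (sqrt h0)"
  have b0: "b0 > 0" using h0 by (simp add: b0_def)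
  show thesis
  proof (rule that[OF b0])
    fix b :: real assume b: "0 < b" "b < b0"
    have "b < sqrt h0" using b by (simp add: b0_def)
    then have "b\<^sup>2 < (sqrt h0)\<^sup>2" using b by (intro power_strict_mono) auto
    then have hb: "0 < b\<^sup>2" "b\<^sup>2 < h0" using b h0 by auto
    have "b\<^sup>2 < (1/3)\<^sup>2" using b by (intro power_strict_mono) (auto simp: b0_def)
    then have b9: "b\<^sup>2 < 1/9" by (simp add: power2_eq_square)
    obtain C where C: "\<And>X. - \<kappa> \<le> Im X \<Longrightarrow> Im X \<le> - s1 \<Longrightarrow> \<bar>Re X\<bar> \<ge> \<bar>\<sigma>\<bar> \<Longrightarrow> norm (F (b\<^sup>2) X) \<le> C * exp (- 1 * \<bar>Re X\<bar>)"
      using h0(2)[OF hb] by blast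
    define y1 where "y1 = - (3 / 8) - 3 / 8 * b\<^sup>2"
    define y0 where "y0 = Im X0"
    have "s1 \<le> 3/8" "\<kappa> \<ge> 7/16" by (auto simp: s1_def \<kappa>_def)
    then have "- \<kappa> \<le> y1 \<and> y1 \<le> - s1" using hb b9 unfolding y1_def by (intro conjI) linarith+
    then have y1: "- \<kappa> \<le> y1" "y1 \<le> - s1" by blast+
    have y0: "- \<kappa> \<le> y0" "y0 \<le> - s1" by (auto simp: y0_def \<kappa>_def s1_def)
    have seg: "- \<kappa> \<le> y \<and> y \<le> - s1" if "y \<in> closed_segment y1 y0" for y
      using that y0 y1 by (auto simp: closed_segment_eq_real_ivl split: if_splits)
    have seg': "- \<kappa> \<le> y \<and> y \<le> - s1" if "y \<in> closed_segment y0 y1" for y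
      using that seg by (simp add: closed_segment_commute)
    have strip: "z \<in> half_strip" if "- \<kappa> \<le> Im z \<and> Im z \<le> - s1" for z
      using that k by (auto simp: half_strip_def)
    note shift = integral_horizontal_line_shift[OF F_holomorphic[OF hb(1)] open_half_strip convex_half_strip, where M="\<bar>\<sigma>\<bar>" and C=C and c=1]
    have int1: "integrable lborel (\<lambda>t. F (b\<^sup>2) (Complex t y1))"
      by (rule shift(1)[of y1 y0]) (use seg strip C in auto)
    have int0: "integrable lborel (\<lambda>t. F (b\<^sup>2) (Complex t y0))"
      by (rule shift(1)[of y0 y1]) (use seg' strip C in auto)
    have eq: "integral UNIV (\<lambda>t. F (b\<^sup>2) (Complex t y1)) = integral UNIV (\<lambda>t. F (b\<^sup>2) (Complex t y0))"
      by (rule shift(2)) (use seg strip C in auto)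
    define A where "A = exp (\<Phi> X0 / of_real (b\<^sup>2) + pi * X0)"
    have A0: "A \<noteq> 0" by (simp add: A_def)
    have FI: "F (b\<^sup>2) (Complex (Re X0 + b * t) y0) = A * L b t" for t
    proof -
      have "Complex (Re X0 + b * t) y0 = X0 + of_real (b * t)" by (simp add: complex_eq_iff y0_def)
      then show ?thesis using F_X0[OF b(1), of "b * t"] by (simp only: A_def L_def)
    qed
    have "integrable lborel (\<lambda>t. F (b\<^sup>2) (Complex (Re X0 + b * t) y0))"
      using lborel_integrable_real_affine[OF int0, of b "Re X0"] b by simp
    then have "integrable lborel (\<lambda>t. A * L b t)" unfolding FI .
    then have "integrable lborel (\<lambda>t. inverse A * (A * L b t))" by (rule integrable_mult_right)
    moreover have "inverse A * (A * L b t) = L b t" for t using A0 by (simp add: mult.assoc[symmetric])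
    ultimately have "integrable lborel (L b)" by (simp only:)
    then have Lint: "L b integrable_on UNIV" by (rule integrable_on_lborel)
    have "integral UNIV (QQ_integrand b)
       = integral UNIV (\<lambda>t. F (b\<^sup>2) (Complex (0 + b * t) y1))"
    proof (rule integral_cong)
      fix t :: real
      define X where "X = Complex (0 + b * t) y1"
      have "b * (3 * Qb b / 8) = - y1" using b by (simp add: Qb_def y1_def field_simps power2_eq_square)
      then have "X = of_real (b * t) - \<i> * of_real (b * (3 * Qb b / 8))" by (simp add: complex_eq_iff X_def)
      then have x: "complex_of_real t - \<i> * complex_of_real (3 * Qb b / 8) = X / of_real b"
        using b by (simp add: diff_divide_distrib)
      have "X \<in> half_strip" by (rule strip) (use y1 in \<open>simp add: X_def\<close>)
      from integrand_eq_F[OF b(1) this]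
      show "QQ_integrand b t = F (b\<^sup>2) (Complex (0 + b * t) y1)"
        unfolding QQ_integrand_def Let_def x X_def[symmetric] by simp
    qed
    also have "\<dots> = integral UNIV (\<lambda>t. F (b\<^sup>2) (Complex t y1)) / of_real b"
      by (rule integral_UNIV_affine[OF int1 b(1)])
    also have "\<dots> = integral UNIV (\<lambda>t. F (b\<^sup>2) (Complex (Re X0 + b * t) y0))"
      unfolding eq by (rule integral_UNIV_affine[OF int0 b(1), symmetric])
    also have "\<dots> = A * integral UNIV (L b)" unfolding FI by simp
    finally show "L b integrable_on UNIV \<and>
     integral UNIV (QQ_integrand b)
     = exp (\<Phi> X0 / of_real (b\<^sup>2) + pi * X0) * integral UNIV (L b)"
      using Lint by (simp add: A_def)
  qed
qed

definition amplitude :: complex where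
  "amplitude = exp (\<i> * pi / 4) / complex_of_real (sqrt 2 * (exp (2 * pi * \<mu>) - (sinh (2 * pi * \<sigma>))\<^sup>2) powr (1/4))"

lemma amplitude_nz: "amplitude \<noteq> 0"
  using cond by (simp add: amplitude_def)

text \<open>As Q^2 = b^(-2) + 2 + b^2, the exponent of the prefactor splits by powers of b. Order
  b^(-2) completes \<open>fQ\<close>; order 1 gives i pi (1/6 + 7/12) = 3 i pi / 4 and -pi mu; order
  b^2 gives 7 i pi b^2 / 24, which joins the remainder of s_b (mu / b).\<close>

lemma QQ_factorization:
  assumes b: "b > 0"
    and J: "integral UNIV (QQ_integrand b)
       = exp (\<Phi> X0 / of_real (b\<^sup>2) + pi * X0) * J"
  shows "QQ b (\<sigma> / b) (\<mu> / b) = exp (fQ \<sigma> \<mu> / of_real (b\<^sup>2)) * exp (3 * \<i> * pi / 4 - pi * \<mu> + pi * X0)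
      * exp (\<i> * (7 * pi * b\<^sup>2 / 24) + \<i> * lamE (b\<^sup>2) (of_real \<mu>)) * J"
proof -
  have nz: "complex_of_real b \<noteq> 0" using b by simp
  have mu: "complex_of_real \<mu> \<in> half_strip" by (simp add: half_strip_def)
  have sb: "sb b (complex_of_real (\<mu> / b)) = exp (\<i> * (lam0 (of_real \<mu>) / of_real (b\<^sup>2) + lamE (b\<^sup>2) (of_real \<mu>)))"
    using sb_eq_lam[OF b mu] by simp
  define P where "P = \<i> * pi * (complex_of_real (1/6 + 7 * (Qb b)\<^sup>2 / 24 - (\<mu> / b)\<^sup>2 / 2) + \<i> * complex_of_real (\<mu> / b) * Qb b - (complex_of_real (\<sigma> / b))\<^sup>2)"
  define S where "S = \<i> * (lam0 (of_real \<mu>) / of_real (b\<^sup>2) + lamE (b\<^sup>2) (of_real \<mu>))"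
  define T where "T = \<Phi> X0 / of_real (b\<^sup>2) + pi * X0"
  have "QQ b (\<sigma> / b) (\<mu> / b) = exp P * exp S * (exp T * J)"
    unfolding QQ_def J[unfolded QQ_integrand_def] sb P_def S_def T_def by simp
  also have "\<dots> = exp (P + S + T) * J" by (simp only: exp_add mult.assoc)
  also have "P + S + T = fQ \<sigma> \<mu> / of_real (b\<^sup>2) + (3 * \<i> * pi / 4 - pi * \<mu> + pi * X0) + (\<i> * (7 * pi * b\<^sup>2 / 24) + \<i> * lamE (b\<^sup>2) (of_real \<mu>))"
    unfolding fQ_eq P_def S_def T_def using nz by (simp add: Qb_def field_simps power2_eq_square)
  finally show ?thesis by (simp only: exp_add)
qed

lemma QQ_asymptotics:
  "(\<lambda>b::real. QQ b (\<sigma> / b) (\<mu> / b) - amplitude * exp (fQ \<sigma> \<mu> / complex_of_real (b\<^sup>2)))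
     \<in> O[at_right (0::real)](\<lambda>b. complex_of_real b * amplitude * exp (fQ \<sigma> \<mu> / complex_of_real (b\<^sup>2)))"
proof -
  obtain b1 where b1: "b1 > 0" "\<And>b. 0 < b \<Longrightarrow> b < b1 \<Longrightarrow>
     L b integrable_on UNIV \<and>
     integral UNIV (QQ_integrand b)
     = exp (\<Phi> X0 / of_real (b\<^sup>2) + pi * X0) * integral UNIV (L b)"
    using contour_integral_eq by blast
  obtain K b2 where K: "K \<ge> 0" "b2 > 0" "\<And>b. 0 < b \<Longrightarrow> b < b2 \<Longrightarrow>
     L b integrable_on UNIV \<Longrightarrow>
     norm (integral UNIV (L b) - of_real (sqrt pi) / csqrt a) \<le> K * b"
    using Laplace_estimate by blast
  obtain C where C: "C \<ge> 0" "\<And>h X. h > 0 \<Longrightarrow> \<bar>Im X\<bar> \<le> 0 \<Longrightarrow> norm (lamE h X) \<le> C * h * norm X"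
    using lamE_bound[of 0] by auto
  define g where "g = complex_of_real (sqrt pi) / csqrt a"
  define k where "k = exp (3 * \<i> * pi / 4 - pi * \<mu> + pi * X0)"
  have amp: "amplitude = k * g" unfolding amplitude_def k_def g_def by (rule amplitude_eq[symmetric])
  define N where "N = 7 * pi / 24 + C * \<bar>\<mu>\<bar>"
  have N: "N \<ge> 0" using C by (simp add: N_def)
  define M where "M = N * exp N * (norm g + K) + K"
  have main: "norm (QQ b (\<sigma> / b) (\<mu> / b) - amplitude * exp (fQ \<sigma> \<mu> / complex_of_real (b\<^sup>2)))
      \<le> (M / norm g) * norm (complex_of_real b * amplitude * exp (fQ \<sigma> \<mu> / complex_of_real (b\<^sup>2)))"
    if b: "0 < b" "b < min 1 (min b1 b2)" for b
  proof -
    define J where "J = integral UNIV (L b)"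
    have Jg: "norm (J - g) \<le> K * b" unfolding J_def g_def using b b1(2)[of b] by (intro K(3)) auto
    define \<epsilon> where "\<epsilon> = \<i> * (7 * pi * b\<^sup>2 / 24) + \<i> * lamE (b\<^sup>2) (of_real \<mu>)"
    define e where "e = exp (fQ \<sigma> \<mu> / complex_of_real (b\<^sup>2))"
    have Q: "QQ b (\<sigma> / b) (\<mu> / b) = e * k * exp \<epsilon> * J"
      unfolding e_def k_def \<epsilon>_def by (rule QQ_factorization) (use b b1(2)[of b] in \<open>auto simp: J_def\<close>)
    have b2: "b\<^sup>2 \<le> b" using b by (simp add: power2_eq_square mult_left_le)
    have "norm \<epsilon> \<le> norm (\<i> * (7 * complex_of_real pi * b\<^sup>2 / 24)) + norm (\<i> * lamE (b\<^sup>2) (of_real \<mu>))"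
      unfolding \<epsilon>_def by (rule order_trans[OF norm_triangle_ineq]) simp
    also have "\<dots> \<le> 7 * pi * b\<^sup>2 / 24 + C * b\<^sup>2 * \<bar>\<mu>\<bar>"
      using C(2)[of "b\<^sup>2" "of_real \<mu>"] b by (simp add: norm_mult norm_divide norm_power)
    also have "\<dots> = N * b\<^sup>2" by (simp add: N_def algebra_simps)
    also have "\<dots> \<le> N * b" using N b2 by (intro mult_left_mono)
    finally have \<epsilon>: "norm \<epsilon> \<le> N * b" .
    also have "\<dots> \<le> N" using N b by (simp add: mult_left_le)
    finally have \<epsilon>N: "norm \<epsilon> \<le> N" .
    have "norm (exp \<epsilon> - exp 0) \<le> exp N * norm (\<epsilon> - 0)"
      using \<epsilon>N N complex_Re_le_cmod[of \<epsilon>] by (intro norm_exp_diff_le) auto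
    then have ex: "norm (exp \<epsilon> - 1) \<le> exp N * (N * b)" using \<epsilon> by (auto intro: order_trans mult_left_mono)
    have nJ: "norm J \<le> norm g + K"
    proof -
      have "norm J \<le> norm g + norm (J - g)" using norm_triangle_ineq[of g "J - g"] by simp
      also have "norm (J - g) \<le> K" using Jg K(1) b mult_left_le[of b K] by simp
      finally show ?thesis by simp
    qed
    \<comment> \<open>Two errors of order b enter, exp \<epsilon> - 1 from the prefactor and J - g
      from Laplace's method; this decomposition keeps them apart.\<close>
    have "norm (exp \<epsilon> * J - g) \<le> norm ((exp \<epsilon> - 1) * J) + norm (J - g)"
      using norm_triangle_ineq[of "(exp \<epsilon> - 1) * J" "J - g"] by (simp add: algebra_simps)
    also have "\<dots> \<le> exp N * (N * b) * (norm g + K) + K * b"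
      unfolding norm_mult by (intro add_mono mult_mono ex nJ Jg) (use N b in auto)
    also have "\<dots> = M * b" by (simp add: M_def algebra_simps)
    finally have est: "norm (exp \<epsilon> * J - g) \<le> M * b" .
    have "QQ b (\<sigma> / b) (\<mu> / b) - amplitude * e = e * k * (exp \<epsilon> * J - g)"
      unfolding Q amp by (simp add: algebra_simps)
    then have "norm (QQ b (\<sigma> / b) (\<mu> / b) - amplitude * e) \<le> norm e * norm k * (M * b)"
      using est by (simp add: norm_mult mult_left_mono)
    also have "\<dots> = (M / norm g) * norm (complex_of_real b * amplitude * e)"
      using amplitude_nz b unfolding amp by (simp add: norm_mult)
    finally show ?thesis by (simp add: e_def)
  qed
  have "eventually (\<lambda>b. b \<in> {0<..<min 1 (min b1 b2)}) (at_right (0::real))"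
    using b1(1) K(2) by (intro eventually_at_right_real) auto
  then have "eventually (\<lambda>b. norm (QQ b (\<sigma> / b) (\<mu> / b) - amplitude * exp (fQ \<sigma> \<mu> / complex_of_real (b\<^sup>2)))
      \<le> (M / norm g) * norm (complex_of_real b * amplitude * exp (fQ \<sigma> \<mu> / complex_of_real (b\<^sup>2)))) (at_right 0)"
    by (rule eventually_mono) (use main in auto)
  then show ?thesis by (rule bigoI)
qed

end

section \<open>The generating function\<close>

text \<open>The derivative is written in coordinates: this form passes directly through sums,
  products and composition, and it makes the complex homogeneity demanded by
  \<open>holomorphic2_on\<close> immediate.\<close>

definition complex_diff2 :: "(complex \<times> complex \<Rightarrow> complex) \<Rightarrow> complex \<times> complex \<Rightarrow> bool" where
  "complex_diff2 F p \<longleftrightarrow> (\<exists>\<alpha> \<beta>. (F has_derivative (\<lambda>v. \<alpha> * fst v + \<beta> * snd v)) (at p))"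

lemma complex_diff2_const: "complex_diff2 (\<lambda>_. c) p"
  unfolding complex_diff2_def by (rule exI[of _ 0], rule exI[of _ 0]) simp

lemma complex_diff2_fst: "complex_diff2 fst p"
  unfolding complex_diff2_def by (rule exI[of _ 1], rule exI[of _ 0]) (auto intro!: derivative_eq_intros)

lemma complex_diff2_snd: "complex_diff2 snd p"
  unfolding complex_diff2_def by (rule exI[of _ 0], rule exI[of _ 1]) (auto intro!: derivative_eq_intros)

lemma complex_diff2_add:
  assumes "complex_diff2 F p" "complex_diff2 G p"
  shows "complex_diff2 (\<lambda>x. F x + G x) p"
proof -
  obtain \<alpha> \<beta> \<gamma> \<delta> where "(F has_derivative (\<lambda>v. \<alpha> * fst v + \<beta> * snd v)) (at p)" "(G has_derivative (\<lambda>v. \<gamma> * fst v + \<delta> * snd v)) (at p)"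
    using assms by (auto simp: complex_diff2_def)
  from has_derivative_add[OF this] show ?thesis
    unfolding complex_diff2_def by (intro exI[of _ "\<alpha> + \<gamma>"] exI[of _ "\<beta> + \<delta>"]) (simp add: algebra_simps)
qed

lemma complex_diff2_mult:
  assumes "complex_diff2 F p" "complex_diff2 G p"
  shows "complex_diff2 (\<lambda>x. F x * G x) p"
proof -
  obtain \<alpha> \<beta> \<gamma> \<delta> where "(F has_derivative (\<lambda>v. \<alpha> * fst v + \<beta> * snd v)) (at p)" "(G has_derivative (\<lambda>v. \<gamma> * fst v + \<delta> * snd v)) (at p)"
    using assms by (auto simp: complex_diff2_def)
  from has_derivative_mult[OF this] show ?thesis
    unfolding complex_diff2_def
    by (intro exI[of _ "F p * \<gamma> + \<alpha> * G p"] exI[of _ "F p * \<delta> + \<beta> * G p"]) (simp add: algebra_simps)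
qed

lemma complex_diff2_compose:
  assumes "complex_diff2 F p" "(g has_field_derivative g') (at (F p))"
  shows "complex_diff2 (\<lambda>x. g (F x)) p"
proof -
  obtain \<alpha> \<beta> where F: "(F has_derivative (\<lambda>v. \<alpha> * fst v + \<beta> * snd v)) (at p)"
    using assms by (auto simp: complex_diff2_def)
  have "(g has_derivative (\<lambda>v. g' * v)) (at (F p))"
    using assms(2) by (simp add: has_field_derivative_def)
  from has_derivative_compose[OF F this] show ?thesis
    unfolding complex_diff2_def by (intro exI[of _ "g' * \<alpha>"] exI[of _ "g' * \<beta>"]) (simp add: algebra_simps)
qed

lemma complex_diff2_imp_continuous: "complex_diff2 F p \<Longrightarrow> continuous (at p) F"
  unfolding complex_diff2_def using has_derivative_continuous by blast

lemma holomorphic2_onI: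
  assumes "open U" "\<And>p. p \<in> U \<Longrightarrow> complex_diff2 F p"
  shows "holomorphic2_on F U"
  unfolding holomorphic2_on_def
proof (intro conjI ballI assms(1))
  fix p assume "p \<in> U"
  from assms(2)[OF this] obtain \<alpha> \<beta> where "(F has_derivative (\<lambda>v. \<alpha> * fst v + \<beta> * snd v)) (at p)"
    unfolding complex_diff2_def by blast
  then show "\<exists>D. (F has_derivative D) (at p) \<and> (\<forall>c v. D (c * fst v, c * snd v) = c * D v)"
    by (intro exI[of _ "\<lambda>v. \<alpha> * fst v + \<beta> * snd v"]) (simp add: algebra_simps)
qed

section \<open>The principal-branch formula and its domain of holomorphy\<close>

definition W_arg :: "complex \<times> complex \<Rightarrow> complex" where
  "W_arg p = exp (of_real pi * snd p) * sin (2 * of_real pi * fst p)"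

definition W_eta :: "complex \<times> complex \<Rightarrow> complex" where
  "W_eta p = Arcsin (W_arg p) / (2 * of_real pi)"

definition W_z1 :: "complex \<times> complex \<Rightarrow> complex" where
  "W_z1 p = - exp (2 * \<i> * of_real pi * (fst p + W_eta p - \<i> * snd p / 2))"

definition W_z2 :: "complex \<times> complex \<Rightarrow> complex" where
  "W_z2 p = - exp (- 2 * \<i> * of_real pi * (fst p + W_eta p + \<i> * snd p / 2))"

definition W_fun :: "complex \<times> complex \<Rightarrow> complex" where
  "W_fun p = (Li2 (W_z1 p) + Li2 (W_z2 p) - (2 * of_real pi * W_eta p)\<^sup>2 + (of_real pi * snd p)\<^sup>2) / (8 * (of_real pi)\<^sup>2)"

definition Arcsin_domain :: "complex set" where
  "Arcsin_domain = {z. Im z = 0 \<longrightarrow> \<bar>Re z\<bar> < 1}"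

text \<open>The points at which the formula meets none of the cuts of Arcsin and of the two
  dilogarithms; there one closed expression with principal branches is itself the
  continuation.\<close>

definition W_domain :: "(complex \<times> complex) set" where
  "W_domain = {p. W_arg p \<in> Arcsin_domain \<and> W_z1 p \<in> Li2_domain \<and> W_z2 p \<in> Li2_domain}"

lemma open_Arcsin_domain: "open Arcsin_domain"
proof -
  have *: "Arcsin_domain = {z. Im z < 0} \<union> {z. Im z > 0} \<union> ({z. Re z < 1} \<inter> {z. Re z > -1})"
    by (auto simp: Arcsin_domain_def abs_less_iff)
  show ?thesis unfolding *
    by (intro open_Un open_Int open_halfspace_Re_lt open_halfspace_Re_gt open_halfspace_Im_lt open_halfspace_Im_gt)
qed

lemma complex_diff2_cmult: "complex_diff2 F p \<Longrightarrow> complex_diff2 (\<lambda>x. c * F x) p"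
  by (intro complex_diff2_mult complex_diff2_const)

lemma complex_diff2_W_arg: "complex_diff2 W_arg p"
proof -
  have "complex_diff2 (\<lambda>p. exp (of_real pi * snd p)) p"
    by (rule complex_diff2_compose[OF complex_diff2_cmult[OF complex_diff2_snd] DERIV_exp])
  moreover have "complex_diff2 (\<lambda>p. sin (2 * of_real pi * fst p)) p"
    by (rule complex_diff2_compose[OF complex_diff2_cmult[OF complex_diff2_fst] DERIV_sin])
  ultimately show ?thesis unfolding W_arg_def[abs_def] by (rule complex_diff2_mult)
qed

lemma complex_diff2_W_eta:
  assumes "W_arg p \<in> Arcsin_domain"
  shows "complex_diff2 W_eta p"
proof -
  have "complex_diff2 (\<lambda>p. Arcsin (W_arg p)) p"
    by (rule complex_diff2_compose[OF complex_diff2_W_arg has_field_derivative_Arcsin])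
       (use assms in \<open>simp add: Arcsin_domain_def\<close>)
  from complex_diff2_cmult[OF this, of "1 / (2 * of_real pi)"] show ?thesis
    unfolding W_eta_def[abs_def] by simp
qed

lemma complex_diff2_W_z:
  assumes "W_arg p \<in> Arcsin_domain"
  shows "complex_diff2 W_z1 p" "complex_diff2 W_z2 p"
proof -
  have e: "complex_diff2 (\<lambda>p. c * (fst p + W_eta p + d * snd p)) p" for c d
    by (intro complex_diff2_cmult complex_diff2_add complex_diff2_fst complex_diff2_snd complex_diff2_W_eta assms)
  have d: "((\<lambda>z. - exp z) has_field_derivative - exp z) (at z)" for z :: complex
    by (auto intro!: derivative_eq_intros)
  have "complex_diff2 (\<lambda>p. - exp (2 * \<i> * of_real pi * (fst p + W_eta p + (- \<i> / 2) * snd p))) p"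
    by (rule complex_diff2_compose[OF e d])
  then show "complex_diff2 W_z1 p" unfolding W_z1_def[abs_def] by simp
  have "complex_diff2 (\<lambda>p. - exp (- 2 * \<i> * of_real pi * (fst p + W_eta p + (\<i> / 2) * snd p))) p"
    by (rule complex_diff2_compose[OF e d])
  then show "complex_diff2 W_z2 p" unfolding W_z2_def[abs_def] by simp
qed

lemma complex_diff2_W_fun:
  assumes "p \<in> W_domain"
  shows "complex_diff2 W_fun p"
proof -
  have A: "W_arg p \<in> Arcsin_domain" and z: "W_z1 p \<in> Li2_domain" "W_z2 p \<in> Li2_domain"
    using assms by (auto simp: W_domain_def)
  have 1: "complex_diff2 (\<lambda>p. Li2 (W_z1 p)) p"
    by (rule complex_diff2_compose[OF complex_diff2_W_z(1)[OF A] Li2_has_field_derivative[OF z(1)]])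
  have 2: "complex_diff2 (\<lambda>p. Li2 (W_z2 p)) p"
    by (rule complex_diff2_compose[OF complex_diff2_W_z(2)[OF A] Li2_has_field_derivative[OF z(2)]])
  have c: "complex_diff2 (\<lambda>p. 1 / (8 * (of_real pi)\<^sup>2) * (Li2 (W_z1 p) + Li2 (W_z2 p) +
      (- ((2 * of_real pi)\<^sup>2)) * (W_eta p * W_eta p) + (of_real pi)\<^sup>2 * (snd p * snd p))) p"
    by (intro complex_diff2_cmult complex_diff2_add complex_diff2_mult[OF complex_diff2_W_eta[OF A] complex_diff2_W_eta[OF A]]
        complex_diff2_mult[OF complex_diff2_snd complex_diff2_snd] 1 2)
  have eq: "W_fun = (\<lambda>q. 1 / (8 * (of_real pi)\<^sup>2) * (Li2 (W_z1 q) + Li2 (W_z2 q) +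
      (- ((2 * of_real pi)\<^sup>2)) * (W_eta q * W_eta q) + (of_real pi)\<^sup>2 * (snd q * snd q)))"
    by (rule ext) (simp add: W_fun_def power_mult_distrib power2_eq_square[of "W_eta _"] power2_eq_square[of "snd _"])
  show ?thesis unfolding eq by (rule c)
qed

lemma open_W_domain: "open W_domain"
proof -
  have "continuous_on UNIV W_arg"
    by (intro continuous_at_imp_continuous_on ballI complex_diff2_imp_continuous complex_diff2_W_arg)
  then have o1: "open (W_arg -` Arcsin_domain)"
    using open_Arcsin_domain by (simp add: continuous_on_open_vimage)
  have c: "continuous_on (W_arg -` Arcsin_domain) W_z1" "continuous_on (W_arg -` Arcsin_domain) W_z2"
    by (intro continuous_at_imp_continuous_on ballI complex_diff2_imp_continuous complex_diff2_W_z; simp)+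
  have *: "W_domain = ((W_arg -` Arcsin_domain) \<inter> W_z1 -` Li2_domain) \<inter> ((W_arg -` Arcsin_domain) \<inter> W_z2 -` Li2_domain)"
    by (auto simp: W_domain_def)
  show ?thesis
    unfolding * by (intro open_Int continuous_open_preimage[OF c(1) o1 open_Li2_domain] continuous_open_preimage[OF c(2) o1 open_Li2_domain])
qed

text \<open>For real arguments the exponentials have modulus exp (pi n) < 1, which keeps the
  dilogarithms off their cut, and the same factor keeps the argument of Arcsin below 1. The case s =
  0 is included because the point (0, -1), from which all paths start, lies there.\<close>

lemma W_base_point:
  assumes "0 \<le> s" "s < 1/4" "n < 0"
  shows "W_arg (of_real s, of_real n) = of_real (exp (pi * n) * sin (2 * pi * s))"
    "W_eta (of_real s, of_real n) = of_real (eta_base s n)"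
    "(of_real s, of_real n) \<in> W_domain"
proof -
  define x where "x = exp (pi * n) * sin (2 * pi * s)"
  have s: "0 \<le> sin (2 * pi * s)" "sin (2 * pi * s) \<le> 1" using assms by (auto intro!: sin_ge_zero)
  have "exp (pi * n) < 1" using assms by (simp add: mult_pos_neg)
  moreover have "x \<le> exp (pi * n)" "0 \<le> x" using s by (simp_all add: x_def mult_left_le)
  ultimately have x: "\<bar>x\<bar> < 1" by linarith
  have "W_arg (of_real s, of_real n) = of_real x"
    by (simp add: W_arg_def x_def exp_of_real[symmetric] sin_of_real[symmetric])
  then show A: "W_arg (of_real s, of_real n) = of_real (exp (pi * n) * sin (2 * pi * s))" unfolding x_def .
  show e: "W_eta (of_real s, of_real n) = of_real (eta_base s n)"
    unfolding W_eta_def A eta_base_def x_def[symmetric] using of_real_arcsin[of x] x by simp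
  have z1: "norm (W_z1 (of_real s, of_real n)) < 1" "norm (W_z2 (of_real s, of_real n)) < 1"
    unfolding W_z1_def W_z2_def e using assms by (auto simp: mult_pos_neg)
  show "(of_real s, of_real n) \<in> W_domain"
    unfolding W_domain_def mem_Collect_eq
  proof (intro conjI)
    show "W_arg (of_real s, of_real n) \<in> Arcsin_domain" unfolding A x_def[symmetric] using x by (simp add: Arcsin_domain_def)
    show "W_z1 (of_real s, of_real n) \<in> Li2_domain"
      using complex_Re_le_cmod[of "W_z1 (of_real s, of_real n)"] z1 by (intro Li2_domainI_Re) simp
    show "W_z2 (of_real s, of_real n) \<in> Li2_domain"
      using complex_Re_le_cmod[of "W_z2 (of_real s, of_real n)"] z1 by (intro Li2_domainI_Re) simp
  qed
qed

lemma W_fun_base: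
  assumes "0 \<le> s" "s < 1/4" "n < 0"
  shows "W_fun (of_real s, of_real n) = W_base s n"
  unfolding W_fun_def W_base_def Let_def W_z1_def W_z2_def W_base_point(2)[OF assms] by (simp add: power_mult_distrib)

section \<open>Values at the points (i sigma, -mu - i/2)\<close>

context saddle
begin

text \<open>This is 2 pi eta at the point in question: exp (pi nu) = -i exp (-pi mu) cancels the
  factor i of sin (2 pi i sigma), so the argument of arcsin is real. The hypothesis on sigma and mu
  says precisely that it lies in (-1, 1).\<close>

definition \<theta> :: real where "\<theta> = arcsin (exp (- pi * \<mu>) * sinh (2 * pi * \<sigma>))"

lemma \<theta>_facts:
  shows "\<bar>exp (- pi * \<mu>) * sinh (2 * pi * \<sigma>)\<bar> < 1" "sin \<theta> = exp (- pi * \<mu>) * sinh (2 * pi * \<sigma>)"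
    "cos \<theta> = exp (- pi * \<mu>) * R" "- (pi / 2) < \<theta>" "\<theta> < pi / 2"
proof -
  define x where "x = exp (- pi * \<mu>) * sinh (2 * pi * \<sigma>)"
  have E: "(exp (- pi * \<mu>))\<^sup>2 * exp (2 * pi * \<mu>) = 1" by (simp add: power2_eq_square flip: exp_add)
  have "(exp (- pi * \<mu>))\<^sup>2 * (sinh (2 * pi * \<sigma>))\<^sup>2 < (exp (- pi * \<mu>))\<^sup>2 * exp (2 * pi * \<mu>)"
    using cond by (intro mult_strict_left_mono) auto
  then have "x\<^sup>2 < 1" unfolding E by (simp add: x_def power_mult_distrib)
  then show x: "\<bar>exp (- pi * \<mu>) * sinh (2 * pi * \<sigma>)\<bar> < 1" unfolding x_def[symmetric] by (simp add: abs_square_less_1)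
  then have x1: "-1 < x" "x < 1" unfolding x_def[symmetric] by auto
  show "sin \<theta> = exp (- pi * \<mu>) * sinh (2 * pi * \<sigma>)" unfolding \<theta>_def using x1 unfolding x_def[symmetric] by simp
  have "(exp (- pi * \<mu>) * R)\<^sup>2 = (exp (- pi * \<mu>))\<^sup>2 * exp (2 * pi * \<mu>) - x\<^sup>2"
    unfolding power_mult_distrib R_sq x_def by (simp add: algebra_simps)
  then have "1 - x\<^sup>2 = (exp (- pi * \<mu>) * R)\<^sup>2" unfolding E by simp
  then have "sqrt (1 - x\<^sup>2) = exp (- pi * \<mu>) * R" using R_pos by simp
  then show "cos \<theta> = exp (- pi * \<mu>) * R" unfolding \<theta>_def x_def[symmetric] using x1 by (simp add: cos_arcsin)
  show "- (pi / 2) < \<theta>" "\<theta> < pi / 2" unfolding \<theta>_def x_def[symmetric] using arcsin_lt_bounded[OF x1] by auto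
qed

abbreviation W_point :: "complex \<times> complex" where
  "W_point \<equiv> (\<i> * complex_of_real \<sigma>, - complex_of_real \<mu> - \<i> / 2)"

lemma W_point_values:
  shows "W_arg W_point = of_real (exp (- pi * \<mu>) * sinh (2 * pi * \<sigma>))"
    and "W_eta W_point = of_real (\<theta> / (2 * pi))"
    and "W_z1 W_point = exp (of_real (- 2 * pi * \<sigma> - pi * \<mu>) + \<i> * of_real (pi / 2 + \<theta>))"
    and "W_z2 W_point = exp (of_real (2 * pi * \<sigma> - pi * \<mu>) + \<i> * of_real (pi / 2 - \<theta>))"
proof -
  have s: "sin (2 * complex_of_real pi * (\<i> * of_real \<sigma>)) = \<i> * of_real (sinh (2 * pi * \<sigma>))"
  proof -
    have "sin (\<i> * of_real (2 * pi * \<sigma>)) = \<i> * sinh (complex_of_real (2 * pi * \<sigma>))" by (simp add: sinh_conv_sin)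
    also have "sinh (complex_of_real (2 * pi * \<sigma>)) = of_real (sinh (2 * pi * \<sigma>))"
      by (simp add: sinh_field_def exp_of_real[symmetric])
    finally show ?thesis by (simp add: mult_ac)
  qed
  have e2: "exp (- (\<i> * of_real (pi / 2))) = - \<i>" by (simp add: complex_eq_iff Re_exp Im_exp)
  have e: "exp (complex_of_real pi * (- of_real \<mu> - \<i> / 2)) = - \<i> * of_real (exp (- pi * \<mu>))"
  proof -
    have "complex_of_real pi * (- of_real \<mu> - \<i> / 2) = of_real (- pi * \<mu>) + - (\<i> * of_real (pi / 2))" by (simp add: algebra_simps)
    then have "exp (complex_of_real pi * (- of_real \<mu> - \<i> / 2)) = of_real (exp (- pi * \<mu>)) * exp (- (\<i> * of_real (pi / 2)))"
      by (simp only: exp_add exp_of_real)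
    then show ?thesis unfolding e2 by simp
  qed
  show A: "W_arg W_point = of_real (exp (- pi * \<mu>) * sinh (2 * pi * \<sigma>))"
    unfolding W_arg_def fst_conv snd_conv s e by (simp add: complex_eq_iff)
  show eta: "W_eta W_point = of_real (\<theta> / (2 * pi))"
    unfolding W_eta_def A \<theta>_def using of_real_arcsin[of "exp (- pi * \<mu>) * sinh (2 * pi * \<sigma>)"] \<theta>_facts(1) by simp
  have m: "- exp z = exp (z + \<i> * of_real pi)" for z by (simp add: exp_add)
  show "W_z1 W_point = exp (of_real (- 2 * pi * \<sigma> - pi * \<mu>) + \<i> * of_real (pi / 2 + \<theta>))"
    unfolding W_z1_def eta fst_conv snd_conv m
    by (rule arg_cong[where f=exp]) (simp add: complex_eq_iff field_simps)
  show "W_z2 W_point = exp (of_real (2 * pi * \<sigma> - pi * \<mu>) + \<i> * of_real (pi / 2 - \<theta>))"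
    unfolding W_z2_def eta fst_conv snd_conv m
    by (rule arg_cong[where f=exp]) (simp add: complex_eq_iff field_simps)
qed

text \<open>The angles pi/2 + theta and pi/2 - theta lie in (0, pi). For the same reason the
  exponents in \<open>W_point_values\<close> are the principal logarithms.\<close>

lemma W_z_Im_pos: "Im (W_z1 W_point) > 0" "Im (W_z2 W_point) > 0"
  unfolding W_point_values Im_exp using \<theta>_facts(4,5) by (auto intro!: sin_gt_zero mult_pos_pos)

lemma W_point_in_domain: "W_point \<in> W_domain"
  unfolding W_domain_def mem_Collect_eq
proof (intro conjI)
  show "W_arg W_point \<in> Arcsin_domain" unfolding W_point_values using \<theta>_facts(1) by (simp add: Arcsin_domain_def)
qed (use W_z_Im_pos in \<open>auto intro: Li2_domainI_Im\<close>)

lemma Ln_W_z: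
  "Ln (W_z1 W_point) = of_real (- 2 * pi * \<sigma> - pi * \<mu>) + \<i> * of_real (pi / 2 + \<theta>)"
  "Ln (W_z2 W_point) = of_real (2 * pi * \<sigma> - pi * \<mu>) + \<i> * of_real (pi / 2 - \<theta>)"
  unfolding W_point_values using \<theta>_facts(4,5) by (auto intro!: Ln_exp)

text \<open>With e = exp (2 pi sigma) the first left side is -e (sinh (2 pi sigma) + i R), whose
  bracket has squared modulus exp (2 pi mu). Inverting it means conjugating and dividing by this,
  and sin theta and cos theta are sinh (2 pi sigma) and R up to the common factor exp (-pi mu). The
  second identity is the same with 1/e.\<close>

lemma one_minus_x:
  "1 - of_real (exp (2 * pi * \<sigma>)) * w = inverse (W_z1 W_point)"
  "1 - of_real (exp (- 2 * pi * \<sigma>)) * w = inverse (W_z2 W_point)"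
proof -
  define e where "e = exp (2 * pi * \<sigma>)"
  have e0: "e > 0" "exp (- 2 * pi * \<sigma>) = 1 / e" by (auto simp: e_def exp_minus field_simps)
  have ch: "cosh (2 * pi * \<sigma>) = (e + 1 / e) / 2" "sinh (2 * pi * \<sigma>) = (e - 1 / e) / 2"
    by (auto simp: cosh_field_def sinh_field_def e_def exp_minus field_simps)
  have ex: "exp (- 2 * pi * \<mu>) = exp (- pi * \<mu>) * exp (- pi * \<mu>)" by (simp flip: exp_add)
  have z1: "W_z1 W_point = of_real (exp (- 2 * pi * \<mu>) / e) * Complex (- sinh (2 * pi * \<sigma>)) R"
  proof -
    have "W_z1 W_point = of_real (exp (- 2 * pi * \<sigma>) * exp (- pi * \<mu>)) * Complex (- sin \<theta>) (cos \<theta>)"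
    proof -
      have "W_z1 W_point = of_real (exp (- 2 * pi * \<sigma> - pi * \<mu>)) * cis (pi / 2 + \<theta>)"
        unfolding W_point_values by (simp only: exp_add exp_of_real cis_conv_exp)
      moreover have "cis (pi / 2 + \<theta>) = Complex (- sin \<theta>) (cos \<theta>)"
        by (simp add: complex_eq_iff cos_add sin_add)
      moreover have "exp (- 2 * pi * \<sigma> - pi * \<mu>) = exp (- 2 * pi * \<sigma>) * exp (- pi * \<mu>)" by (simp flip: exp_add)
      ultimately show ?thesis by (simp only:)
    qed
    then show ?thesis unfolding \<theta>_facts(2,3) e0(2) ex by (simp add: complex_eq_iff)
  qed
  have z2: "W_z2 W_point = of_real (exp (- 2 * pi * \<mu>) * e) * Complex (sinh (2 * pi * \<sigma>)) R"
  proof -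
    have "W_z2 W_point = of_real (exp (2 * pi * \<sigma>) * exp (- pi * \<mu>)) * Complex (sin \<theta>) (cos \<theta>)"
    proof -
      have "W_z2 W_point = of_real (exp (2 * pi * \<sigma> - pi * \<mu>)) * cis (pi / 2 - \<theta>)"
        unfolding W_point_values by (simp only: exp_add exp_of_real cis_conv_exp)
      moreover have "cis (pi / 2 - \<theta>) = Complex (sin \<theta>) (cos \<theta>)"
        by (simp add: complex_eq_iff cos_diff sin_diff)
      moreover have "exp (2 * pi * \<sigma> - pi * \<mu>) = exp (2 * pi * \<sigma>) * exp (- pi * \<mu>)" by (simp flip: exp_add)
      ultimately show ?thesis by (simp only:)
    qed
    then show ?thesis unfolding \<theta>_facts(2,3) e_def[symmetric] ex by (simp add: complex_eq_iff)
  qed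
  have S: "(sinh (2 * pi * \<sigma>))\<^sup>2 + R\<^sup>2 = exp (2 * pi * \<mu>)" unfolding R_sq by simp
  have E: "exp (- 2 * pi * \<mu>) * exp (2 * pi * \<mu>) = 1" by (simp flip: exp_add)
  have prod: "Complex (- s) r * Complex (- s) (- r) = of_real (s\<^sup>2 + r\<^sup>2)" for s r by (simp add: complex_eq_iff power2_eq_square)
  have "1 - e * cosh (2 * pi * \<sigma>) = e * - sinh (2 * pi * \<sigma>)" "1 - 1 / e * cosh (2 * pi * \<sigma>) = 1 / e * sinh (2 * pi * \<sigma>)"
    unfolding ch using e0(1) by (simp_all add: field_simps)
  note c1 = this
  have x1: "1 - of_real e * w = of_real e * Complex (- sinh (2 * pi * \<sigma>)) (- R)"
    using c1(1) by (simp add: complex_eq_iff w_def)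
  have x2: "1 - of_real (1 / e) * w = of_real (1 / e) * Complex (sinh (2 * pi * \<sigma>)) (- R)"
    using c1(2) by (simp add: complex_eq_iff w_def flip: of_real_divide)
  have "W_z1 W_point * (1 - of_real e * w) = of_real (exp (- 2 * pi * \<mu>)) * (Complex (- sinh (2 * pi * \<sigma>)) R * Complex (- sinh (2 * pi * \<sigma>)) (- R))"
    unfolding z1 x1 using e0 by (simp add: field_simps)
  also have "\<dots> = of_real (exp (- 2 * pi * \<mu>) * exp (2 * pi * \<mu>))" unfolding prod S by simp
  finally have "W_z1 W_point * (1 - of_real e * w) = 1" unfolding E by simp
  then show "1 - of_real (exp (2 * pi * \<sigma>)) * w = inverse (W_z1 W_point)"
    unfolding e_def by (metis inverse_unique)
  have "W_z2 W_point * (1 - of_real (1 / e) * w) = of_real (exp (- 2 * pi * \<mu>)) * (Complex (- (- sinh (2 * pi * \<sigma>))) R * Complex (- (- sinh (2 * pi * \<sigma>))) (- R))"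
    unfolding z2 x2 using e0 by (simp add: field_simps)
  also have "\<dots> = of_real (exp (- 2 * pi * \<mu>) * exp (2 * pi * \<mu>))" unfolding prod using S by simp
  finally have "W_z2 W_point * (1 - of_real (1 / e) * w) = 1" unfolding E by simp
  then show "1 - of_real (exp (- 2 * pi * \<sigma>)) * w = inverse (W_z2 W_point)"
    unfolding e0(2) by (metis inverse_unique)
qed

lemma Ln_minus_scaled_w:
  "Ln (- (of_real (exp r) * w)) = of_real r + Ln (- w)"
  using w_nz mpi_less_Im_Ln[of "- w"] Im_Ln_le_pi[of "- w"]
  by (intro Ln_unique) (auto simp: exp_add exp_of_real)

lemma Li2_scaled_w:
  assumes "1 - of_real (exp r) * w = inverse z" "Im z > 0"
  shows "Li2 (of_real (exp r) * w) = Li2 z + (of_real r + Ln (- w)) * Ln z + (Ln z)\<^sup>2 / 2 - of_real (pi\<^sup>2 / 6)"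
proof -
  define x where "x = of_real (exp r) * w"
  have "Im x > 0" using R_pos by (simp add: x_def w_simps)
  then have "- x \<notin> \<real>\<^sub>\<le>\<^sub>0" by (auto simp: complex_nonpos_Reals_iff)
  from Li2_inverse_one_minus[OF this]
  have "Li2 (1 / (1 - x)) = Li2 x + Ln (- x) * Ln (1 - x) - (Ln (1 - x))\<^sup>2 / 2 + of_real (pi\<^sup>2 / 6)" .
  moreover have "1 / (1 - x) = z" using assms by (simp add: x_def divide_inverse)
  moreover have "Ln (1 - x) = - Ln z"
    using assms Ln_inverse[of z] by (simp add: x_def complex_nonpos_Reals_iff)
  moreover have "Ln (- x) = of_real r + Ln (- w)" unfolding x_def by (rule Ln_minus_scaled_w)
  ultimately show ?thesis unfolding x_def[symmetric] by (simp add: algebra_simps)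
qed

text \<open>The inversion formula introduces the products of Ln (-w) with Ln z1 and Ln z2. Since Ln
  z1 + Ln z2 = -2 pi mu + i pi, they sum to exactly what cancels (1/2 + i mu) Ln (-w). What remains
  besides the dilogarithms is a quadratic polynomial in sigma, mu and theta, whose theta^2 term is
  the eta term of W.\<close>

lemma fQ_W_fun:
  "fQ \<sigma> \<mu> = 4 * \<i> * pi * W_fun W_point
     - Li2 (- complex_of_real (exp (2 * pi * \<mu>))) / (2 * pi * \<i>)
     - 2 * \<i> * pi * complex_of_real (\<sigma>\<^sup>2) + \<i> * pi / 4"
proof -
  define lw where "lw = Ln (- w)"
  define l1 l2 l3 where "l1 = Li2 (W_z1 W_point)" and "l2 = Li2 (W_z2 W_point)" and "l3 = Li2 (- complex_of_real (exp (2 * pi * \<mu>)))"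
  have L1: "Li2 (of_real (exp (2 * pi * \<sigma>)) * w) = l1 + (of_real (2 * pi * \<sigma>) + lw) * Ln (W_z1 W_point) + (Ln (W_z1 W_point))\<^sup>2 / 2 - of_real (pi\<^sup>2 / 6)"
    unfolding l1_def lw_def by (rule Li2_scaled_w[OF one_minus_x(1) W_z_Im_pos(1)])
  have L2: "Li2 (of_real (exp (- 2 * pi * \<sigma>)) * w) = l2 + (of_real (- 2 * pi * \<sigma>) + lw) * Ln (W_z2 W_point) + (Ln (W_z2 W_point))\<^sup>2 / 2 - of_real (pi\<^sup>2 / 6)"
    unfolding l2_def lw_def by (rule Li2_scaled_w[OF one_minus_x(2) W_z_Im_pos(2)])
  have f: "fQ \<sigma> \<mu> = - l3 / (2 * pi * \<i>) - Li2 (of_real (exp (- 2 * pi * \<sigma>)) * w) / (2 * pi * \<i>) - Li2 (of_real (exp (2 * pi * \<sigma>)) * w) / (2 * pi * \<i>) + (1/2 + \<i> * \<mu>) * lw - pi * \<mu> + 5 * pi * \<i> / 12"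
    unfolding fQ_def Let_def R_def[symmetric] w_def[symmetric] lw_def l3_def ..
  have W: "W_fun W_point = (l1 + l2 - (of_real \<theta>)\<^sup>2 + (of_real pi * (- of_real \<mu> - \<i> / 2))\<^sup>2) / (8 * (of_real pi)\<^sup>2)"
    unfolding W_fun_def W_point_values(2) l1_def l2_def by simp
  have i: "x / (2 * pi * \<i>) = - \<i> * x / (2 * pi)" for x by (simp add: field_simps)
  define p where "p = complex_of_real pi"
  have p: "p \<noteq> 0" by (simp add: p_def)
  show ?thesis
    unfolding f W L1 L2 Ln_W_z i l3_def[symmetric] of_real_add of_real_diff of_real_mult of_real_divide of_real_power of_real_numeral of_real_minus p_def[symmetric]
    using p by (simp add: field_simps power2_eq_square)
qed

end

section \<open>Paths inside the domain and the continuation\<close>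

lemma W_domain_connect_base:
  assumes "0 \<le> s" "s < 1/4" "n < 0"
  shows "connected_component W_domain (0, -1) (of_real s, of_real n)"
proof -
  define T where "T = (\<lambda>q. (complex_of_real (fst q), complex_of_real (snd q))) ` ({0..<1/4} \<times> {..<0})"
  have "connected T" unfolding T_def
    by (intro connected_continuous_image continuous_intros connected_Times) auto
  moreover have "T \<subseteq> W_domain" using W_base_point(3) by (auto simp: T_def)
  moreover have "(of_real s, of_real n) \<in> T"
    unfolding T_def by (rule image_eqI[where x="(s, n)"]) (use assms in auto)
  moreover have "(0, -1) \<in> T" unfolding T_def by (rule image_eqI[where x="(0, -1)"]) auto
  ultimately show ?thesis unfolding connected_component_def by blast
qed

text \<open>At first coordinate 0 both the argument of arcsin and eta vanish, and the dilogarithm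
  arguments keep modulus exp (-pi) while nu moves from -1 to -1 - i/2.\<close>

lemma W_domain_connect_vertical: "connected_component W_domain (0, -1) (0, -1 - \<i> / 2)"
proof -
  define T where "T = (\<lambda>s. (0 :: complex, -1 - \<i> * complex_of_real s)) ` {0..1/2}"
  have "connected T" unfolding T_def
    by (intro connected_continuous_image continuous_intros) auto
  moreover have "T \<subseteq> W_domain"
  proof
    fix p assume "p \<in> T"
    then obtain s where p: "p = (0, -1 - \<i> * complex_of_real s)" by (auto simp: T_def)
    have A: "W_arg p = 0" "W_eta p = 0" by (auto simp: W_arg_def W_eta_def p)
    have "norm (W_z1 p) < 1" "norm (W_z2 p) < 1" unfolding W_z1_def W_z2_def A unfolding p by auto
    then show "p \<in> W_domain"
      using complex_Re_le_cmod[of "W_z1 p"] complex_Re_le_cmod[of "W_z2 p"]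
      by (auto simp: W_domain_def A Arcsin_domain_def intro!: Li2_domainI_Re)
  qed
  moreover have "(0, -1) \<in> T" unfolding T_def by (rule image_eqI[where x=0]) auto
  moreover have "(0, -1 - \<i> / 2) \<in> T" unfolding T_def by (rule image_eqI[where x="1/2"]) auto
  ultimately show ?thesis unfolding connected_component_def by blast
qed

text \<open>For sigma = 0 the hypothesis holds with every mu, so mu can be brought to its value
  there; scaling sigma up from 0 then keeps sinh^2 below its final value. Every point on the way
  satisfies the hypothesis, and \<open>W_point_in_domain\<close> applies to it.\<close>

lemma W_domain_connect_point:
  assumes "exp (2 * pi * \<mu>) > (sinh (2 * pi * \<sigma>))\<^sup>2"
  shows "connected_component W_domain (0, -1) (\<i> * complex_of_real \<sigma>, - complex_of_real \<mu> - \<i> / 2)"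
proof -
  define T1 where "T1 = (\<lambda>m. (\<i> * complex_of_real 0, - complex_of_real m - \<i> / 2)) ` UNIV"
  define T2 where "T2 = (\<lambda>t. (\<i> * complex_of_real (t * \<sigma>), - complex_of_real \<mu> - \<i> / 2)) ` {0..1}"
  have "connected T1" "connected T2" unfolding T1_def T2_def
    by (intro connected_continuous_image continuous_intros; simp)+
  moreover have "T1 \<subseteq> W_domain"
  proof -
    have "(\<i> * complex_of_real 0, - complex_of_real m - \<i> / 2) \<in> W_domain" for m
    proof -
      interpret saddle 0 m by unfold_locales simp
      show ?thesis by (rule W_point_in_domain)
    qed
    then show ?thesis by (auto simp: T1_def)
  qed
  moreover have "T2 \<subseteq> W_domain"
  proof -
    have "(\<i> * complex_of_real (t * \<sigma>), - complex_of_real \<mu> - \<i> / 2) \<in> W_domain" if t: "0 \<le> t" "t \<le> 1" for t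
    proof -
      have "\<bar>2 * pi * (t * \<sigma>)\<bar> \<le> \<bar>2 * pi * \<sigma>\<bar>" using t by (simp add: abs_mult mult_left_le_one_le)
      then have "\<bar>sinh (2 * pi * (t * \<sigma>))\<bar> \<le> \<bar>sinh (2 * pi * \<sigma>)\<bar>"
        by (metis abs_ge_zero sinh_real_abs sinh_real_le_iff abs_of_nonneg)
      then have "(sinh (2 * pi * (t * \<sigma>)))\<^sup>2 \<le> (sinh (2 * pi * \<sigma>))\<^sup>2" by (simp add: abs_le_square_iff)
      then interpret saddle "t * \<sigma>" \<mu> using assms by unfold_locales simp
      show ?thesis by (rule W_point_in_domain)
    qed
    then show ?thesis by (auto simp: T2_def)
  qed
  moreover have "(0, -1 - \<i> / 2) \<in> T1" unfolding T1_def by (rule image_eqI[where x=1]) auto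
  moreover have "(0, - complex_of_real \<mu> - \<i> / 2) \<in> T1" unfolding T1_def by (rule image_eqI[where x=\<mu>]) auto
  moreover have "(0, - complex_of_real \<mu> - \<i> / 2) \<in> T2" unfolding T2_def by (rule image_eqI[where x=0]) auto
  moreover have "(\<i> * complex_of_real \<sigma>, - complex_of_real \<mu> - \<i> / 2) \<in> T2" unfolding T2_def by (rule image_eqI[where x=1]) auto
  ultimately have "connected_component W_domain (0, -1 - \<i> / 2) (0, - complex_of_real \<mu> - \<i> / 2)"
    "connected_component W_domain (0, - complex_of_real \<mu> - \<i> / 2) (\<i> * complex_of_real \<sigma>, - complex_of_real \<mu> - \<i> / 2)"
    unfolding connected_component_def by blast+
  then show ?thesis using W_domain_connect_vertical connected_component_trans by metis
qed

text \<open>Passing to the component of (0, -1) secures the connectedness that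
  \<open>W_continuation\<close> demands; the component is open because \<open>W_domain\<close> is,
  and it contains the base region by \<open>W_domain_connect_base\<close>.\<close>

lemma W_continuation_W_fun: "W_continuation W_fun (connected_component_set W_domain (0, -1))"
  unfolding W_continuation_def
proof (intro conjI)
  show "connected (connected_component_set W_domain (0, -1))" by simp
  show "holomorphic2_on W_fun (connected_component_set W_domain (0, -1))"
    by (rule holomorphic2_onI[OF open_connected_component[OF open_W_domain] complex_diff2_W_fun])
       (use connected_component_subset in blast)
  show "\<forall>(sg, nu)\<in>W_base_region. (complex_of_real sg, complex_of_real nu) \<in> connected_component_set W_domain (0, -1) \<and>
        W_fun (complex_of_real sg, complex_of_real nu) = W_base sg nu"
    using W_domain_connect_base W_fun_base by (auto simp: W_base_region_def)
qed

theorem theorem2p4: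
  shows "(\<forall>sigma_s mu :: real. exp (2 * pi * mu) > (sinh (2 * pi * sigma_s))\<^sup>2 \<longrightarrow>
           (let A = exp (\<i> * pi / 4)
                    / complex_of_real (sqrt 2 * (exp (2 * pi * mu) - (sinh (2 * pi * sigma_s))\<^sup>2) powr (1/4))
            in (\<lambda>b::real. QQ b (sigma_s / b) (mu / b) - A * exp (fQ sigma_s mu / complex_of_real (b\<^sup>2)))
                 \<in> O[at_right (0::real)](\<lambda>b. complex_of_real b * A * exp (fQ sigma_s mu / complex_of_real (b\<^sup>2)))))
       \<and> (\<exists>W U. W_continuation W U \<and>
            (\<forall>sigma_s mu :: real. exp (2 * pi * mu) > (sinh (2 * pi * sigma_s))\<^sup>2 \<longrightarrow>
               (\<i> * complex_of_real sigma_s, - complex_of_real mu - \<i> / 2) \<in> U \<and>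
               fQ sigma_s mu = 4 * \<i> * pi * W (\<i> * complex_of_real sigma_s, - complex_of_real mu - \<i> / 2)
                 - Li2 (- complex_of_real (exp (2 * pi * mu))) / (2 * pi * \<i>)
                 - 2 * \<i> * pi * complex_of_real (sigma_s\<^sup>2) + \<i> * pi / 4))"
proof (intro conjI allI impI exI[of _ W_fun] exI[of _ "connected_component_set W_domain (0, -1)"])
  fix \<sigma> \<mu> :: real assume c: "exp (2 * pi * \<mu>) > (sinh (2 * pi * \<sigma>))\<^sup>2"
  interpret saddle \<sigma> \<mu> by unfold_locales (rule c)
  show "let A = exp (\<i> * pi / 4)
                    / complex_of_real (sqrt 2 * (exp (2 * pi * \<mu>) - (sinh (2 * pi * \<sigma>))\<^sup>2) powr (1/4))
            in (\<lambda>b::real. QQ b (\<sigma> / b) (\<mu> / b) - A * exp (fQ \<sigma> \<mu> / complex_of_real (b\<^sup>2)))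
                 \<in> O[at_right (0::real)](\<lambda>b. complex_of_real b * A * exp (fQ \<sigma> \<mu> / complex_of_real (b\<^sup>2)))"
    using QQ_asymptotics unfolding Let_def amplitude_def .
  show "(\<i> * complex_of_real \<sigma>, - complex_of_real \<mu> - \<i> / 2) \<in> connected_component_set W_domain (0, -1)"
    using W_domain_connect_point[OF c] by simp
  show "fQ \<sigma> \<mu> = 4 * \<i> * pi * W_fun (\<i> * complex_of_real \<sigma>, - complex_of_real \<mu> - \<i> / 2)
                 - Li2 (- complex_of_real (exp (2 * pi * \<mu>))) / (2 * pi * \<i>)
                 - 2 * \<i> * pi * complex_of_real (\<sigma>\<^sup>2) + \<i> * pi / 4"
    by (rule fQ_W_fun)
qed (rule W_continuation_W_fun)

end
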